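(* Let $\mathbf{a}=(a_1,\dots,a_n)$ be an $n$-tuple of positive integers. The following are equivalent: (i) for every $\mathbf{a}$-colored complex, there exists a reverse-lexicographic $\mathbf{a}$-colored complex with the same $f$-vector; (ii) either $n=1$, or $\mathbf{a}=(1,\dots,1)$. Likewise, the following are equivalent: (i') for every finite $\mathbf{a}$-colored multicomplex, there exists a reverse-lexicographic $\mathbf{a}$-colored multicomplex with the same $f$-vector; (ii) either $n=1$, or $\mathbf{a}=(1,\dots,1)$.
   Context: An ordered partition of a non-empty set is an ordered tuple of pairwise disjoint non-empty subsets whose union is the set. An $\mathbf{a}$-colored complex is a finite simplicial complex $\Delta$ on a non-empty vertex set $V$ (with $\{v\}\in\Delta$ for all $v\in V$), together with an ordered partition $(V_1,\dots,V_n)$ of $V$, such that $|F\cap V_i|\le a_i$ for every face $F$ and every $i$. Its $f$-vector is $(f_0,\dots,f_{\dim\Delta})$ where $f_i$ is the number of $i$-dimensional faces (faces with $i+1$ elements). A multicomplex on a non-empty set of variables $X$ is a set $M$ of monomials in variables from $X$ that contains $1$ and is closed under taking divisors (not every $x\in X$ need lie in $M$). Its $f$-vector is $(f_0,f_1,\dots)$, where $f_i$ is the number of monomials of degree $i$ in $M$. For a monomial $m$ and $Y\subseteq X$, $m_Y$ denotes the part of $m$ in the variables of $Y$ (the product of $x^{\text{exponent of }x\text{ in }m}$ over $x\in Y$). An $\mathbf{a}$-colored multicomplex is a pair $(M,\pi)$ with $M$ a multicomplex on $X$ and $\pi=(X_1,\dots,X_n)$ an ordered partition of $X$ such that $\deg(m_{X_i})\le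 a_i$ for all $m\in M$ and all $i$. A complex with vertices in $X$ is identified with a finite multicomplex of squarefree monomials via $\{x_{i_1},\dots,x_{i_t}\}\leftrightarrow x_{i_1}\cdots x_{i_t}$. Reverse-lexicographic objects: let $X=\bigsqcup_{t=1}^nX_t$ with $X_t=\{x_{t,1},x_{t,2},\dots\}$ countably infinite, linearly ordered by $x_{i,j}>x_{i',j'}$ iff $j>j'$, or $j=j'$ and $i<i'$. For monomials $m,m'$ of the same degree, $m<_{\ell ex}m'$ iff at the largest variable whose exponents differ, the exponent in $m$ is smaller; and $m<_{r\ell}m'$ iff $m>_{\ell ex}m'$. Let $\mathcal M$ be the set of all monomials $m$ in $X$ with $\deg(m_{X_t})\le a_t$ for all $t$, and $\mathcal M(\mathbf 1)$ the set of squarefree monomials in $\mathcal M$. A reverse-lexicographic $\mathbf{a}$-colored multicomplex (resp. complex) is a finite multicomplex $M\subseteq\mathcal M$ (resp. $M\subseteq\mathcal M(\mathbf 1)$, viewed as a simplicial complex) such that for every $d$: if $m\in M$ has degree $d$, $m'\in\mathcal M$ (resp. $m'\in\mathcal M(\mathbf 1)$) has degree $d$ and $m'>_{r\ell}m$, then $m'\in M$. *)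

theory Defs
  imports Main "HOL-Library.Multiset"
begin

text \<open>
  A tuple \<open>a = (a\<^sub>1, \<dots>, a\<^sub>n)\<close> is a list of length \<open>n\<close>, so colours are numbered \<open>0, \<dots>, n - 1\<close>.
  Monomials are multisets of variables: the exponent of \<open>x\<close> in \<open>m\<close> is \<open>count m x\<close>, the degree is
  \<open>size m\<close>, divisibility is \<open>\<subseteq>#\<close>, and the monomial 1 is \<open>{#}\<close>.
\<close>

definition ordered_partition :: "'v set \<Rightarrow> 'v set list \<Rightarrow> bool" where
  "ordered_partition V P \<longleftrightarrow>
     V \<noteq> {} \<and> \<Union> (set P) = V \<and> (\<forall>B\<in>set P. B \<noteq> {}) \<and>
     (\<forall>i<length P. \<forall>j<length P. i \<noteq> j \<longrightarrow> P ! i \<inter> P ! j = {})"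


subsection \<open>Colored complexes\<close>

definition simplicial_complex_on :: "'v set \<Rightarrow> 'v set set \<Rightarrow> bool" where
  "simplicial_complex_on V \<Delta> \<longleftrightarrow>
     finite V \<and> V \<noteq> {} \<and> \<Delta> \<subseteq> Pow V \<and> (\<forall>v\<in>V. {v} \<in> \<Delta>) \<and>
     (\<forall>F\<in>\<Delta>. \<forall>G. G \<subseteq> F \<longrightarrow> G \<in> \<Delta>)"

definition colored_complex :: "nat list \<Rightarrow> 'v set \<Rightarrow> 'v set set \<Rightarrow> 'v set list \<Rightarrow> bool" where
  "colored_complex a V \<Delta> P \<longleftrightarrow>
     simplicial_complex_on V \<Delta> \<and> ordered_partition V P \<and> length P = length a \<and>
     (\<forall>F\<in>\<Delta>. \<forall>i<length a. card (F \<inter> P ! i) \<le> a ! i)"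

text \<open>
  The tuple \<open>(f\<^sub>0, \<dots>, f\<^sub>d)\<close> with \<open>d = dim \<Delta>\<close>; its length \<open>d + 1\<close> is the largest cardinality of a face.
\<close>

definition complex_f_vector :: "'v set set \<Rightarrow> nat list" where
  "complex_f_vector \<Delta> = map (\<lambda>i. card {F \<in> \<Delta>. card F = i + 1}) [0..<Max (card ` \<Delta>)]"


subsection \<open>Colored multicomplexes\<close>

definition multicomplex_on :: "'v set \<Rightarrow> 'v multiset set \<Rightarrow> bool" where
  "multicomplex_on X M \<longleftrightarrow>
     X \<noteq> {} \<and> (\<forall>m\<in>M. set_mset m \<subseteq> X) \<and> {#} \<in> M \<and>
     (\<forall>m\<in>M. \<forall>m'. m' \<subseteq># m \<longrightarrow> m' \<in> M)"

definition monomial_part :: "'v multiset \<Rightarrow> 'v set \<Rightarrow> 'v multiset" where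
  "monomial_part m Y = filter_mset (\<lambda>x. x \<in> Y) m"

definition colored_multicomplex ::
    "nat list \<Rightarrow> 'v set \<Rightarrow> 'v multiset set \<Rightarrow> 'v set list \<Rightarrow> bool" where
  "colored_multicomplex a X M P \<longleftrightarrow>
     multicomplex_on X M \<and> ordered_partition X P \<and> length P = length a \<and>
     (\<forall>m\<in>M. \<forall>i<length a. size (monomial_part m (P ! i)) \<le> a ! i)"

text \<open>Only meaningful for finite \<open>M\<close>, since \<open>card\<close> is 0 on infinite sets.\<close>

definition multicomplex_f_vector :: "'v multiset set \<Rightarrow> nat \<Rightarrow> nat" where
  "multicomplex_f_vector M = (\<lambda>d. card {m \<in> M. size m = d})"


subsection \<open>Reverse-lexicographic objects\<close>

text \<open>
  The pair \<open>(t, j)\<close> is the variable \<open>x\<^sub>t\<^sub>,\<^sub>j\<close>, with both indices counted from 0.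
\<close>

type_synonym var = "nat \<times> nat"

definition var_class :: "nat \<Rightarrow> var set" where
  "var_class t = {t} \<times> UNIV"

definition all_vars :: "nat \<Rightarrow> var set" where
  "all_vars n = (\<Union>t<n. var_class t)"

definition var_less :: "var \<Rightarrow> var \<Rightarrow> bool" where
  "var_less y x \<longleftrightarrow> snd x > snd y \<or> (snd x = snd y \<and> fst x < fst y)"

definition lex_less :: "var multiset \<Rightarrow> var multiset \<Rightarrow> bool" where
  "lex_less m m' \<longleftrightarrow> size m = size m' \<and>
     (\<exists>x. count m x < count m' x \<and> (\<forall>y. var_less x y \<longrightarrow> count m y = count m' y))"

definition revlex_less :: "var multiset \<Rightarrow> var multiset \<Rightarrow> bool" where
  "revlex_less m m' \<longleftrightarrow> lex_less m' m"

definition bounded_monomials :: "nat list \<Rightarrow> var multiset set" where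
  "bounded_monomials a =
     {m. set_mset m \<subseteq> all_vars (length a) \<and>
         (\<forall>t<length a. size (monomial_part m (var_class t)) \<le> a ! t)}"

definition bounded_squarefree_monomials :: "nat list \<Rightarrow> var multiset set" where
  "bounded_squarefree_monomials a = {m \<in> bounded_monomials a. \<forall>x. count m x \<le> 1}"

definition revlex_closed_in :: "var multiset set \<Rightarrow> var multiset set \<Rightarrow> bool" where
  "revlex_closed_in N M \<longleftrightarrow>
     (\<forall>d. \<forall>m\<in>M. \<forall>m'\<in>N. size m = d \<and> size m' = d \<and> revlex_less m m' \<longrightarrow> m' \<in> M)"

definition revlex_multicomplex :: "nat list \<Rightarrow> var multiset set \<Rightarrow> bool" where
  "revlex_multicomplex a M \<longleftrightarrow>
     finite M \<and> multicomplex_on (all_vars (length a)) M \<and>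
     M \<subseteq> bounded_monomials a \<and> revlex_closed_in (bounded_monomials a) M"

text \<open>
  A complex given by squarefree monomials; its faces are the sets \<open>set_mset m\<close> for \<open>m \<in> M\<close>.
\<close>

definition revlex_complex :: "nat list \<Rightarrow> var multiset set \<Rightarrow> bool" where
  "revlex_complex a M \<longleftrightarrow>
     finite M \<and> multicomplex_on (all_vars (length a)) M \<and>
     M \<subseteq> bounded_squarefree_monomials a \<and>
     revlex_closed_in (bounded_squarefree_monomials a) M"

end

theory Submission
  imports Defs "HOL-Library.Multiset_Order"
begin

text \<open>
  If all bounds are 1, the number \<open>q\<close> encodes the variable of colour \<open>q mod n\<close> and index \<open>q div n\<close>,
  and the reverse-lexicographic order becomes the (reversed) multiset order on \<open>nat multiset\<close>. What
  has to be shown is that initial segments have the smallest shadows (Frankl, Furedi and Kalai).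
  Among all families of given size with smallest shadow take the one that is least in the multiset
  order on families. By induction on the number of colours it can be compressed in the sections
  that fix the vertex of one colour, so these sections are initial segments. If it were not an
  initial segment itself, then its last few members could be exchanged for its first gaps: the
  number of new shadow elements contributed by a set is explicit, every gap costs at most 1, and at
  most one gap costs anything at all. Pairs are treated separately, by Turan's theorem. A single
  colour without repetition is the case of a modulus exceeding the number of vertices. For a single
  colour with repetition (Macaulay) let \<open>A\<^sub>0\<close> be the members of a compressed family \<open>A\<close> that avoid
  the least variable: the shadow has size at least \<open>|A| - |A\<^sub>0|\<close>, with equality for initial segments,
  and \<open>A\<close> contains everything up to the largest member of \<open>A\<^sub>0\<close>.

  Conversely, if the bounds differ, an unbalanced distribution of a given number of variables among
  the colours admits more monomials of full degree than the balanced one that a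
  reverse-lexicographic object must use. If all bounds equal \<open>b \<ge> 2\<close>
  and there are at least two colours, consider two variables more than one full-degree monomial
  needs. Forbidding a pair of vertices of equal colour leaves a complex with more facets than a
  reverse-lexicographic one, which has to forbid a pair of different colours. Forbidding the product
  of the two additional variables leaves a multicomplex in which the monomials of full degree have
  a smaller shadow than in a reverse-lexicographic one.
\<close>

text \<open>Compression compares two sets only if they share a variable or miss a common colour.
  What it cannot settle is the relation between sets without a common variable that together use all
  colours, and the exchange argument deals with exactly this remainder: nearly every contradiction
  there comes from a modified set that still shares a variable or a missing colour with an old one.
  In several of these modifications two variables move while a third must stay, which is why pairs
  need a separate argument. Compression rests on two facts about fewer colours that are always used
  together: initial segments have least shadow, and their shadows are again initial segments.
  Initial segments form a chain, so comparing cardinalities then yields inclusions. The scheme is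
  run twice, with residues as colours that occur at most once, and for Macaulay with every single
  variable as a colour of unrestricted exponent. Choosing a least family makes it compressed in all
  colours at once, without iterating compressions.\<close>

lemma mset_lessI:
  fixes M N :: "'a::linorder multiset"
  assumes "count M x < count N x" and "\<And>y. x < y \<Longrightarrow> count M y \<le> count N y"
  shows "M < N"
  unfolding less_multiset\<^sub>H\<^sub>O
proof (intro conjI allI impI)
  show "M \<noteq> N" using assms(1) by auto
  fix y assume "count N y < count M y"
  then have "\<not> x < y" "y \<noteq> x" using assms(1) assms(2)[of y] by auto
  then have "y < x" by simp
  then show "\<exists>z. y < z \<and> count M z < count N z" using assms(1) by blast
qed

text \<open>The witness is the greatest element at which the multiplicities differ. For monomials of
  equal degree \<open><\<close> is therefore the lexicographic order decided at the greatest
  variable.\<close>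

lemma mset_lessE:
  fixes M N :: "'a::linorder multiset"
  assumes "M < N"
  obtains x where "count M x < count N x" and "\<And>y. x < y \<Longrightarrow> count M y = count N y"
proof -
  let ?D = "{x. count M x \<noteq> count N x}"
  have D: "?D \<subseteq> set_mset M \<union> set_mset N" by (auto simp: not_in_iff)
  then have fin: "finite ?D" by (rule finite_subset) simp
  have "M \<noteq> N" using assms by auto
  then have "?D \<noteq> {}" by (simp add: multiset_eq_iff)
  then have "\<exists>x\<in>?D. \<forall>y\<in>?D. y \<le> x"
    using Max_in[OF fin] Max_ge[OF fin] by (intro bexI[of _ "Max ?D"] ballI)
  then obtain x where D: "x \<in> ?D" "\<forall>y\<in>?D. y \<le> x" by (rule bexE)
  then have x: "count M x \<noteq> count N x" "\<And>y. x < y \<Longrightarrow> count M y = count N y"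
    by (auto simp: not_le[symmetric])
  have "\<not> count N x < count M x"
  proof
    assume "count N x < count M x"
    then have "N < M" by (rule mset_lessI) (simp add: x(2))
    then show False using assms by simp
  qed
  then show ?thesis using x by (intro that[of x]) simp_all
qed

lemma mset_less_bound:
  fixes M N :: "'a::linorder multiset"
  assumes "M < N" "p \<in># M"
  shows "\<exists>q\<in>#N. p \<le> q"
proof (rule ccontr)
  assume "\<not> ?thesis"
  then have "\<forall>q\<in>#N. q < p" by auto
  then have "N < M" using assms(2) ex_gt_imp_less_multiset by blast
  then show False using assms(1) by simp
qed

section \<open>Initial segments and shadows\<close>

definition init :: "'a::linorder set \<Rightarrow> 'a set \<Rightarrow> bool" where
  "init L S \<longleftrightarrow> finite S \<and> S \<subseteq> L \<and> (\<forall>x\<in>S. \<forall>y\<in>L. y < x \<longrightarrow> y \<in> S)"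

lemma init_chain: "init L S \<Longrightarrow> init L T \<Longrightarrow> S \<subseteq> T \<or> T \<subseteq> S"
proof (rule ccontr)
  assume I: "init L S" "init L T" and "\<not> (S \<subseteq> T \<or> T \<subseteq> S)"
  then obtain x y where xy: "x \<in> S" "x \<notin> T" "y \<in> T" "y \<notin> S" by blast
  then have "x < y \<or> y < x" by (metis linorder_cases)
  then show False using I xy unfolding init_def by blast
qed

lemma init_card_subset: "init L S \<Longrightarrow> init L T \<Longrightarrow> card S \<le> card T \<Longrightarrow> S \<subseteq> T"
  using init_chain[of L S T] card_seteq[of S T] by (auto simp: init_def)

text \<open>\<open>X\<close> merely certifies that \<open>L\<close>, which may be infinite, has at
  least \<open>m\<close> elements. Each step adds the least element not yet taken.\<close>

lemma init_exists:
  fixes L :: "'a::wellorder set"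
  assumes "finite X" "X \<subseteq> L" "m \<le> card X"
  shows "\<exists>S. init L S \<and> card S = m"
  using assms(3)
proof (induction m)
  case 0
  then show ?case by (intro exI[of _ "{}"]) (simp add: init_def)
next
  case (Suc m)
  then obtain S where S: "init L S" "card S = m" by auto
  have "\<not> X \<subseteq> S" using S Suc.prems card_mono[of S X] by (auto simp: init_def)
  then have ex: "\<exists>x. x \<in> L - S" using assms by blast
  define y where "y = (LEAST x. x \<in> L - S)"
  have y: "y \<in> L - S" unfolding y_def using ex by (rule LeastI_ex)
  have least: "y \<le> x" if "x \<in> L - S" for x unfolding y_def using that by (rule Least_le)
  have "init L (insert y S)"
    using S(1) y least unfolding init_def by (auto simp: leD)
  then show ?case using S y by (intro exI[of _ "insert y S"]) (auto simp: init_def)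
qed

text \<open>Otherwise all of \<open>W\<close> would lie below \<open>q\<close> and hence inside
  \<open>S\<close> without \<open>q\<close>, which is too small. Later this keeps the first few gaps
  below a known set of gaps.\<close>

lemma init_bound:
  assumes "init L S" "finite W" "W \<subseteq> L" "card S \<le> card W" "q \<in> S"
  shows "\<exists>w\<in>W. q \<le> w"
proof (rule ccontr)
  assume "\<not> ?thesis"
  then have lt: "w < q" if "w \<in> W" for w using that by auto
  then have "W \<subseteq> S - {q}" using assms by (auto simp: init_def)
  then have "card W \<le> card (S - {q})" using assms by (intro card_mono) (auto simp: init_def)
  also have "\<dots> < card S" using assms by (intro psubset_card_mono) (auto simp: init_def)
  finally show False using assms by simp
qed

text \<open>The choice is unique by \<open>init_card_subset\<close>, but has a meaning only if
  \<open>L\<close> has at least \<open>m\<close> elements; therefore the facts about it take a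
  finite subset of \<open>L\<close> as evidence.\<close>

definition init_seg :: "'a::wellorder set \<Rightarrow> nat \<Rightarrow> 'a set" where
  "init_seg L m = (SOME S. init L S \<and> card S = m)"

lemma init_seg:
  assumes "finite X" "X \<subseteq> L"
  shows "init L (init_seg L (card X))" "card (init_seg L (card X)) = card X"
  using someI_ex[OF init_exists[OF assms order_refl]] by (auto simp: init_seg_def)

lemma init_diff_card:
  assumes "init L S" "finite X" "X \<subseteq> L" "card X = card S" "y \<in> S - X"
  shows "\<exists>x\<in>X - S. y < x"
proof -
  have "\<not> X \<subseteq> S" using assms card_subset_eq[of S X] by (auto simp: init_def)
  then obtain x where x: "x \<in> X - S" by blast
  then have "\<not> x < y" "x \<noteq> y" using assms by (auto simp: init_def)
  then have "y < x" by simp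
  then show ?thesis using x by blast
qed

lemma mset_set_lessI:
  assumes "finite A" "finite B" "A \<noteq> B" "\<And>y. y \<in> A - B \<Longrightarrow> \<exists>x\<in>B - A. y < x"
  shows "mset_set A < mset_set B"
  unfolding less_multiset\<^sub>H\<^sub>O
proof (intro conjI allI impI)
  show "mset_set A \<noteq> mset_set B" using assms(1-3) finite_set_mset_mset_set by metis
  fix y assume "count (mset_set B) y < count (mset_set A) y"
  then have "y \<in> A - B" using assms(1,2) by (auto simp: count_mset_set' split: if_splits)
  then obtain x where "x \<in> B - A" "y < x" using assms(4) by blast
  then show "\<exists>x>y. count (mset_set A) x < count (mset_set B) x"
    using assms(1,2) by (intro exI[of _ x]) simp
qed

definition shadow :: "'a multiset set \<Rightarrow> 'a multiset set" where
  "shadow A = {G. \<exists>q. add_mset q G \<in> A}"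

lemma shadow_mono: "A \<subseteq> B \<Longrightarrow> shadow A \<subseteq> shadow B"
  by (auto simp: shadow_def)

lemma shadow_eq: "shadow A = (\<Union>m\<in>A. (\<lambda>q. m - {#q#}) ` set_mset m)"
proof
  show "shadow A \<subseteq> (\<Union>m\<in>A. (\<lambda>q. m - {#q#}) ` set_mset m)"
  proof
    fix G assume "G \<in> shadow A"
    then obtain q where "add_mset q G \<in> A" by (auto simp: shadow_def)
    then show "G \<in> (\<Union>m\<in>A. (\<lambda>q. m - {#q#}) ` set_mset m)"
      by (intro UN_I[of "add_mset q G"]) (auto intro!: image_eqI[of _ _ q])
  qed
  show "(\<Union>m\<in>A. (\<lambda>q. m - {#q#}) ` set_mset m) \<subseteq> shadow A"
  proof
    fix G assume "G \<in> (\<Union>m\<in>A. (\<lambda>q. m - {#q#}) ` set_mset m)"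
    then obtain m q where "m \<in> A" "q \<in># m" "G = m - {#q#}" by blast
    then have "add_mset q G \<in> A" by simp
    then show "G \<in> shadow A" by (auto simp: shadow_def)
  qed
qed

lemma finite_shadow: "finite A \<Longrightarrow> finite (shadow A)"
  by (simp add: shadow_eq)

section \<open>Coloured levels, sections and compression\<close>

text \<open>\<open>R\<close> holds of the degrees that a monomial may have in a single colour.\<close>

locale colored =
  fixes cls :: "nat \<Rightarrow> nat" and R :: "nat \<Rightarrow> bool"
  assumes R_0: "R 0" and R_Suc: "R (Suc s) \<Longrightarrow> R s"
begin

definition part :: "nat \<Rightarrow> nat multiset \<Rightarrow> nat multiset" where
  "part c m = filter_mset (\<lambda>q. cls q = c) m"

definition rest :: "nat \<Rightarrow> nat multiset \<Rightarrow> nat multiset" where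
  "rest c m = filter_mset (\<lambda>q. cls q \<noteq> c) m"

definition level :: "nat set \<Rightarrow> nat \<Rightarrow> nat multiset set" where
  "level C k = {m. size m = k \<and> cls ` set_mset m \<subseteq> C \<and> (\<forall>c. R (size (part c m)))}"

lemma rest_part: "rest c m + part c m = m"
  by (simp add: rest_def part_def multiset_eq_iff)

lemma part_add: "part c (m + m') = part c m + part c m'"
  and rest_add: "rest c (m + m') = rest c m + rest c m'"
  by (simp_all add: part_def rest_def)

lemma part_rest [simp]: "part c (rest c m) = {#}" "rest c (part c m) = {#}"
    "part c (part c m) = part c m" "rest c (rest c m) = rest c m"
  by (auto simp: part_def rest_def multiset_eq_iff)

lemma part_rest_other: "d \<noteq> c \<Longrightarrow> part d (rest c m) = part d m"
  "d \<noteq> c \<Longrightarrow> part d (part c m) = {#}"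
  by (auto simp: part_def rest_def multiset_eq_iff)

lemma level_rest:
  assumes "m \<in> level C k"
  shows "rest c m \<in> level (C - {c}) (k - size (part c m))"
proof -
  have "size (rest c m) + size (part c m) = k"
    using assms rest_part[of c m] by (metis (mono_tags, lifting) level_def mem_Collect_eq size_union)
  moreover have "R (size (part d (rest c m)))" for d
    using assms R_0 by (cases "d = c") (auto simp: part_rest_other level_def)
  ultimately show ?thesis using assms by (auto simp: level_def rest_def)
qed

lemma level_combine:
  assumes "G \<in> level (C - {c}) (k - size X)" "X = part c F" "F \<in> level C k"
  shows "G + X \<in> level C k" "part c (G + X) = X" "rest c (G + X) = G"
proof -
  have "cls q \<noteq> c" if "q \<in># G" for q using assms(1) that by (auto simp: level_def)
  then have G: "part c G = {#}" "rest c G = G"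
    by (auto simp: part_def rest_def filter_mset_eq_conv filter_mset_eq_mempty_iff)
  then show p: "part c (G + X) = X" "rest c (G + X) = G"
    using assms(2) by (simp_all add: part_add rest_add)
  have "size X \<le> k" using assms(2,3) by (auto simp: level_def part_def intro: size_filter_mset_lesseq)
  then have "size (G + X) = k" using assms(1) by (simp add: level_def)
  moreover have "R (size (part d (G + X)))" for d
    using assms p G by (cases "d = c") (auto simp: part_add part_rest_other level_def)
  ultimately show "G + X \<in> level C k"
    using assms by (auto simp: level_def part_def)
qed

lemma level_down: "add_mset q G \<in> level C (Suc k) \<Longrightarrow> G \<in> level C k"
proof -
  assume a: "add_mset q G \<in> level C (Suc k)"
  have "R (size (part d G))" for d
  proof -
    have "R (size (part d (add_mset q G)))" using a by (auto simp: level_def)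
    then show ?thesis using R_Suc by (auto simp: part_def split: if_splits)
  qed
  then show ?thesis using a by (auto simp: level_def)
qed

lemma shadow_level: "A \<subseteq> level C (Suc k) \<Longrightarrow> shadow A \<subseteq> level C k"
  using level_down by (auto simp: shadow_def)

text \<open>The condition \<open>part c X = X\<close> restricts attention to monomials
  \<open>X\<close> purely of colour \<open>c\<close>, so that a family is the disjoint union of its
  translated sections.\<close>

definition sec :: "nat \<Rightarrow> nat multiset set \<Rightarrow> nat multiset \<Rightarrow> nat multiset set" where
  "sec c A X = {G. G + X \<in> A \<and> part c G = {#} \<and> part c X = X}"

text \<open>The compression operator known from proofs of the Kruskal-Katona and Clements-Lindstrom
  theorems, with the part in one colour held fixed.\<close>

definition compress :: "nat set \<Rightarrow> nat \<Rightarrow> nat \<Rightarrow> nat multiset set \<Rightarrow> nat multiset set" where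
  "compress C k c A = {m \<in> level C k.
     rest c m \<in> init_seg (level (C - {c}) (k - size (part c m))) (card (sec c A (part c m)))}"

lemma sec_finite: "finite A \<Longrightarrow> finite (sec c A X)"
proof -
  assume "finite A"
  moreover have "inj_on (\<lambda>G. G + X) (sec c A X)" by (auto simp: inj_on_def)
  moreover have "(\<lambda>G. G + X) ` sec c A X \<subseteq> A" by (auto simp: sec_def)
  ultimately show ?thesis using inj_on_finite by blast
qed

lemma sec_level: "A \<subseteq> level C k \<Longrightarrow> sec c A X \<subseteq> level (C - {c}) (k - size X)"
proof
  fix G assume "A \<subseteq> level C k" "G \<in> sec c A X"
  then have "G + X \<in> level C k" "part c (G + X) = X" "rest c G = G"
    using rest_part[of c G] by (auto simp: sec_def part_add)
  moreover have "rest c X = {#}" using \<open>G \<in> sec c A X\<close> part_rest(2)[of c X] by (simp add: sec_def)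
  ultimately show "G \<in> level (C - {c}) (k - size X)"
    using level_rest[of "G + X" C k c] by (simp add: rest_add)
qed

lemma sec_iff: "m \<in> A \<longleftrightarrow> rest c m \<in> sec c A (part c m)"
  by (simp add: sec_def rest_part)

lemma init_seg_sec:
  assumes "finite A" "A \<subseteq> level C k"
  shows "init (level (C - {c}) (k - size X)) (init_seg (level (C - {c}) (k - size X)) (card (sec c A X)))"
    and "card (init_seg (level (C - {c}) (k - size X)) (card (sec c A X))) = card (sec c A X)"
  by (rule init_seg[OF sec_finite[OF assms(1)] sec_level[OF assms(2)]])+

text \<open>A nonempty section supplies a member \<open>F\<close> with part \<open>X\<close>. By
  \<open>level_combine\<close> every remainder from the smaller level can then be joined to
  \<open>X\<close> without leaving \<open>level C k\<close>.\<close>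

lemma sec_compress:
  assumes "finite A" "A \<subseteq> level C k" "sec c A X \<noteq> {}"
  shows "sec c (compress C k c A) X = init_seg (level (C - {c}) (k - size X)) (card (sec c A X))"
proof -
  obtain F where F: "F \<in> A" "X = part c F"
    using assms(3) by (auto simp: sec_def part_add)
  then have FL: "F \<in> level C k" using assms by auto
  have I: "init_seg (level (C - {c}) (k - size X)) (card (sec c A X)) \<subseteq> level (C - {c}) (k - size X)"
    using init_seg_sec(1)[OF assms(1,2)] by (auto simp: init_def)
  show ?thesis
  proof (intro equalityI subsetI)
    fix G assume "G \<in> sec c (compress C k c A) X"
    then show "G \<in> init_seg (level (C - {c}) (k - size X)) (card (sec c A X))"
      using rest_part[of c G] F part_rest(2)[of c F] by (auto simp: sec_def compress_def part_add rest_add)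
  next
    fix G assume G: "G \<in> init_seg (level (C - {c}) (k - size X)) (card (sec c A X))"
    note lc = level_combine[OF subsetD[OF I G] F(2) FL]
    have "part c G = {#}" using lc(3) part_rest(1)[of c "G + X"] by simp
    then show "G \<in> sec c (compress C k c A) X"
      using lc G F by (auto simp: sec_def compress_def)
  qed
qed

lemma family_sections: "(\<Union>X\<in>part c ` A. (\<lambda>G. G + X) ` sec c A X) = A"
proof
  show "A \<subseteq> (\<Union>X\<in>part c ` A. (\<lambda>G. G + X) ` sec c A X)"
  proof
    fix m assume "m \<in> A"
    then have "rest c m \<in> sec c A (part c m)" using sec_iff by blast
    then have "m \<in> (\<lambda>G. G + part c m) ` sec c A (part c m)"
      by (rule image_eqI[rotated]) (simp add: rest_part)
    then show "m \<in> (\<Union>X\<in>part c ` A. (\<lambda>G. G + X) ` sec c A X)"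
      using \<open>m \<in> A\<close> by (rule UN_I[OF imageI, rotated])
  qed
qed (auto simp: sec_def)

lemma card_sections:
  assumes "finite A"
  shows "card A = (\<Sum>X\<in>part c ` A. card (sec c A X))"
proof -
  have "card A = card (\<Union>X\<in>part c ` A. (\<lambda>G. G + X) ` sec c A X)"
    by (simp only: family_sections)
  also have "\<dots> = (\<Sum>X\<in>part c ` A. card ((\<lambda>G. G + X) ` sec c A X))"
  proof (intro card_UN_disjoint ballI impI)
    fix X Y :: "nat multiset" assume "X \<noteq> Y"
    have P: "part c m = X" if "m \<in> (\<lambda>G. G + X) ` sec c A X" for m X
      using that by (auto simp: sec_def part_add)
    show "(\<lambda>G. G + X) ` sec c A X \<inter> (\<lambda>G. G + Y) ` sec c A Y = {}"
    proof (rule Int_emptyI)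
      fix m assume "m \<in> (\<lambda>G. G + X) ` sec c A X" "m \<in> (\<lambda>G. G + Y) ` sec c A Y"
      then show False using P \<open>X \<noteq> Y\<close> by metis
    qed
  qed (use assms sec_finite in auto)
  also have "\<dots> = (\<Sum>X\<in>part c ` A. card (sec c A X))"
    by (intro sum.cong refl card_image) (auto simp: inj_on_def)
  finally show ?thesis .
qed

lemma sec_nonempty: "sec c A X \<noteq> {} \<longleftrightarrow> X \<in> part c ` A"
proof
  assume "sec c A X \<noteq> {}"
  then obtain G where "G \<in> sec c A X" by blast
  then show "X \<in> part c ` A" by (intro image_eqI[of _ _ "G + X"]) (auto simp: sec_def part_add)
next
  assume "X \<in> part c ` A"
  then show "sec c A X \<noteq> {}" using sec_iff[of _ A c] by blast
qed

lemma compress_props: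
  assumes "finite A" "A \<subseteq> level C k"
  shows "finite (compress C k c A)" "card (compress C k c A) = card A"
    "part c ` compress C k c A = part c ` A"
proof -
  let ?B = "compress C k c A"
  have nz: "X \<in> part c ` A \<longleftrightarrow> card (sec c A X) \<noteq> 0" for X
    using sec_nonempty sec_finite[OF assms(1)] by (metis card_eq_0_iff)
  have I: "init_seg (level (C - {c}) (k - size X)) (card (sec c A X)) \<noteq> {} \<longleftrightarrow> X \<in> part c ` A" for X
    using nz init_seg_sec[OF assms, of c X] by (metis card_eq_0_iff init_def)
  have 1: "part c ` ?B \<subseteq> part c ` A" using I by (auto simp: compress_def)
  have 2: "part c ` A \<subseteq> part c ` ?B"
  proof
    fix X assume X: "X \<in> part c ` A"
    then have ne: "sec c A X \<noteq> {}" by (simp only: sec_nonempty)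
    have "sec c ?B X \<noteq> {}" unfolding sec_compress[OF assms ne] using I[of X] X by simp
    then show "X \<in> part c ` ?B" by (simp only: sec_nonempty)
  qed
  show P: "part c ` ?B = part c ` A" using 1 2 by auto
  have s: "sec c ?B X = init_seg (level (C - {c}) (k - size X)) (card (sec c A X))" if "X \<in> part c ` A" for X
    using that by (intro sec_compress[OF assms]) (simp only: sec_nonempty)
  have fs: "finite (sec c ?B X)" if "X \<in> part c ` A" for X
    using s[OF that] init_seg_sec(1)[OF assms] by (auto simp: init_def)
  show f: "finite ?B"
    using P fs assms by (subst family_sections[of c, symmetric]) auto
  show "card ?B = card A"
    using card_sections[OF f, of c] card_sections[OF assms(1), of c] P s init_seg_sec(2)[OF assms] by simp
qed

definition shadow_min :: "nat set \<Rightarrow> bool" where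
  "shadow_min C \<longleftrightarrow> (\<forall>k A S. finite A \<and> A \<subseteq> level C k \<and> init (level C k) S \<and> card S \<le> card A \<longrightarrow>
     card (shadow S) \<le> card (shadow A))"

definition shadow_init :: "nat set \<Rightarrow> bool" where
  "shadow_init C \<longleftrightarrow> (\<forall>k S. init (level C (Suc k)) S \<longrightarrow> init (level C k) (shadow S))"

text \<open>Removing a variable of colour \<open>c\<close> leaves the remainder alone, so one
  section passes into another of the same level and the two segments are compared by size. Removing
  a variable of another colour happens inside a section; there the hypotheses on
  \<open>C - {c}\<close> make the shadow of the segment an initial segment that is not larger than
  the one available.\<close>

lemma shadow_compress:
  assumes "finite A" "A \<subseteq> level C (Suc k)" and min: "shadow_min (C - {c})" and ini: "shadow_init (C - {c})"
  shows "shadow (compress C (Suc k) c A) \<subseteq> compress C k c (shadow A)"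
proof
  note sh = finite_shadow[OF assms(1)] shadow_level[OF assms(2)]
  fix m assume "m \<in> shadow (compress C (Suc k) c A)"
  then obtain q where q: "add_mset q m \<in> compress C (Suc k) c A" by (auto simp: shadow_def)
  let ?I = "\<lambda>X. init_seg (level (C - {c}) (Suc k - size X)) (card (sec c A X))"
  let ?J = "\<lambda>X. init_seg (level (C - {c}) (k - size X)) (card (sec c (shadow A) X))"
  have L: "add_mset q m \<in> level C (Suc k)" and r: "rest c (add_mset q m) \<in> ?I (part c (add_mset q m))"
    using q by (auto simp: compress_def)
  have mL: "m \<in> level C k" using level_down L by blast
  have J: "init (level (C - {c}) (k - size X)) (?J X)" "card (?J X) = card (sec c (shadow A) X)" for X
    using init_seg_sec[OF sh] by auto
  have I: "init (level (C - {c}) (Suc k - size X)) (?I X)" "card (?I X) = card (sec c A X)" for X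
    using init_seg_sec[OF assms(1,2)] by auto
  have "rest c m \<in> ?J (part c m)"
  proof (cases "cls q = c")
    case True
    let ?X = "part c m"
    have X: "part c (add_mset q m) = add_mset q ?X" "rest c (add_mset q m) = rest c m"
      using True by (auto simp: part_def rest_def)
    have "sec c A (add_mset q ?X) \<subseteq> sec c (shadow A) ?X"
      by (auto simp: sec_def shadow_def)
    then have "card (sec c A (add_mset q ?X)) \<le> card (sec c (shadow A) ?X)"
      by (intro card_mono sec_finite sh)
    then have "?I (add_mset q ?X) \<subseteq> ?J ?X"
      using I[of "add_mset q ?X"] J[of ?X] by (intro init_card_subset[of "level (C - {c}) (k - size ?X)"]) auto
    then show ?thesis using r X by auto
  next
    case False
    let ?X = "part c m"
    have X: "part c (add_mset q m) = ?X" "rest c (add_mset q m) = add_mset q (rest c m)"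
      using False by (auto simp: part_def rest_def)
    have sz: "Suc k - size ?X = Suc (k - size ?X)"
      using mL by (auto simp: level_def part_def Suc_diff_le size_filter_mset_lesseq)
    have sub: "shadow (sec c A ?X) \<subseteq> sec c (shadow A) ?X"
      by (auto simp: sec_def shadow_def part_def split: if_splits)
    have "init (level (C - {c}) (k - size ?X)) (shadow (?I ?X))"
      using ini I(1)[of ?X] unfolding shadow_init_def sz by blast
    moreover have "card (shadow (?I ?X)) \<le> card (?J ?X)"
    proof -
      have "card (shadow (?I ?X)) \<le> card (shadow (sec c A ?X))"
        using min I[of ?X] sec_finite[OF assms(1)] sec_level[OF assms(2)]
        unfolding shadow_min_def by (metis order_refl)
      also have "\<dots> \<le> card (?J ?X)" unfolding J(2) by (intro card_mono sec_finite sh sub)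
      finally show ?thesis .
    qed
    ultimately have "shadow (?I ?X) \<subseteq> ?J ?X" using J(1) init_card_subset by blast
    moreover have "rest c m \<in> shadow (?I ?X)" using r X by (auto simp: shadow_def)
    ultimately show ?thesis by auto
  qed
  then show "m \<in> compress C k c (shadow A)" using mL by (simp add: compress_def)
qed

text \<open>Within each section whatever enters is smaller than something that leaves, and adding
  the common part preserves the order of monomials.\<close>

lemma compress_less:
  assumes "finite A" "A \<subseteq> level C k" "compress C k c A \<noteq> A"
  shows "mset_set (compress C k c A) < mset_set A"
proof (rule mset_set_lessI)
  let ?B = "compress C k c A"
  fix y assume y: "y \<in> ?B - A"
  let ?X = "part c y"
  let ?I = "init_seg (level (C - {c}) (k - size ?X)) (card (sec c A ?X))"
  have "rest c y \<in> ?I - sec c A ?X" using y sec_iff by (auto simp: compress_def)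
  then obtain G where G: "G \<in> sec c A ?X - ?I" "rest c y < G"
    using init_diff_card[OF init_seg_sec(1)[OF assms(1,2)] sec_finite sec_level] assms(1,2)
      init_seg_sec(2)[OF assms(1,2)] by metis
  have "part c (G + ?X) = ?X" "rest c (G + ?X) = G"
    using G rest_part[of c G] by (auto simp: sec_def part_add rest_add)
  then have "G + ?X \<in> A - ?B" using G by (auto simp: sec_def compress_def)
  moreover have "y < G + ?X" using G(2) rest_part[of c y] by (metis add_strict_right_mono)
  ultimately show "\<exists>x\<in>A - ?B. y < x" by blast
qed (use assms compress_props in auto)

text \<open>\<open>mset_set\<close> turns families into multisets of monomials, on which the multiset order is a
  well-order; replacing members by smaller ones makes a family smaller.\<close>

definition minimal_family :: "nat set \<Rightarrow> nat \<Rightarrow> nat multiset set \<Rightarrow> bool" where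
  "minimal_family C k A \<longleftrightarrow> finite A \<and> A \<subseteq> level C k \<and>
     (\<forall>B. finite B \<and> B \<subseteq> level C k \<and> card B = card A \<and> card (shadow B) \<le> card (shadow A) \<longrightarrow>
        \<not> mset_set B < mset_set A)"

lemma minimal_family_exists:
  assumes "finite A" "A \<subseteq> level C k"
  obtains B where "minimal_family C k B" "card B = card A" "card (shadow B) \<le> card (shadow A)"
proof -
  define P where "P M \<longleftrightarrow> (\<exists>B. M = mset_set B \<and> finite B \<and> B \<subseteq> level C k \<and> card B = card A \<and>
     card (shadow B) \<le> card (shadow A))" for M
  have "P (mset_set A)" using assms by (auto simp: P_def)
  then have P: "P (LEAST M. P M)" and le: "\<And>M. P M \<Longrightarrow> (LEAST M. P M) \<le> M"
    by (auto intro: LeastI Least_le)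
  then obtain B where B: "(LEAST M. P M) = mset_set B" "finite B" "B \<subseteq> level C k" "card B = card A"
     "card (shadow B) \<le> card (shadow A)" unfolding P_def by blast
  have "minimal_family C k B"
    unfolding minimal_family_def
  proof (intro conjI allI impI)
    fix D assume D: "finite D \<and> D \<subseteq> level C k \<and> card D = card B \<and> card (shadow D) \<le> card (shadow B)"
    then have "P (mset_set D)" using B by (auto simp: P_def)
    then show "\<not> mset_set D < mset_set B" using le B(1) by (metis leD)
  qed (use B in auto)
  then show ?thesis using that B by blast
qed

text \<open>Compression keeps the cardinality, does not enlarge the shadow, and lowers the family
  unless it fixes it. So a least family equals its own compression, and its sections are initial
  segments.\<close>

lemma minimal_family_closed:
  assumes A: "minimal_family C k A" and min: "shadow_min (C - {c})" and ini: "shadow_init (C - {c})"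
    and F: "F \<in> A" "G \<in> level C k" "G < F" "part c G = part c F"
  shows "G \<in> A"
proof -
  have fin: "finite A" "A \<subseteq> level C k" using A by (auto simp: minimal_family_def)
  have "card (shadow (compress C k c A)) \<le> card (shadow A)"
  proof (cases k)
    case 0
    then have "shadow (compress C k c A) = {}" by (auto simp: shadow_def compress_def level_def)
    then show ?thesis by simp
  next
    case (Suc j)
    have "shadow (compress C k c A) \<subseteq> compress C j c (shadow A)"
      using shadow_compress[OF _ _ min ini] fin Suc by blast
    moreover have "finite (compress C j c (shadow A))" "card (compress C j c (shadow A)) = card (shadow A)"
      using compress_props[OF finite_shadow shadow_level] fin Suc by auto
    ultimately show ?thesis by (metis card_mono)
  qed
  moreover have "compress C k c A \<subseteq> level C k" by (auto simp: compress_def)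
  ultimately have "\<not> mset_set (compress C k c A) < mset_set A"
    using A compress_props[OF fin] unfolding minimal_family_def by metis
  then have eq: "compress C k c A = A" using compress_less[OF fin] by blast
  let ?X = "part c F"
  let ?I = "init_seg (level (C - {c}) (k - size ?X)) (card (sec c A ?X))"
  have "rest c F \<in> ?I" using F(1) eq by (auto simp: compress_def)
  moreover have "rest c G < rest c F"
    using F(3,4) rest_part[of c F] rest_part[of c G] by (metis add_less_cancel_right)
  moreover have "rest c G \<in> level (C - {c}) (k - size ?X)" using level_rest F(2,4) by metis
  ultimately have "rest c G \<in> ?I" using init_seg_sec(1)[OF fin, of c ?X] by (auto simp: init_def)
  then have "G \<in> compress C k c A" using F by (simp add: compress_def)
  then show ?thesis using eq by simp
qed

lemma shadow_min_via_minimal: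
  assumes "finite A" "A \<subseteq> level C k" "init (level C k) S" "card S \<le> card A"
    and "\<And>B. minimal_family C k B \<Longrightarrow> card S \<le> card B \<Longrightarrow> card (shadow S) \<le> card (shadow B)"
  shows "card (shadow S) \<le> card (shadow A)"
  using minimal_family_exists[OF assms(1,2)] assms(4,5) by (metis order_trans)

end

section \<open>One colour without bounds: Macaulay's theorem\<close>

text \<open>Every variable is a colour of its own with arbitrary exponent. Fixing the part in colour
  \<open>c\<close> means fixing the exponent of \<open>c\<close>, and induction on colours is
  induction on the number of variables.\<close>

interpretation macaulay: colored "\<lambda>q. q" "\<lambda>_. True"
  by standard simp_all

lemma macaulay_level: "macaulay.level C k = {m. size m = k \<and> set_mset m \<subseteq> C}"
  by (simp add: macaulay.level_def)

lemma macaulay_part: "macaulay.part c m = replicate_mset (count m c) c"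
  by (simp add: macaulay.part_def multiset_eq_iff)

text \<open>Multiplying two monomials by the same variable preserves their order, so the variable
  that was removed from the larger one also works for the smaller one.\<close>

lemma macaulay_shadow_init: "macaulay.shadow_init C"
  unfolding macaulay.shadow_init_def
proof (intro allI impI)
  fix k S assume S: "init (macaulay.level C (Suc k)) S"
  have "y \<in> shadow S" if m: "m \<in> shadow S" and y: "y \<in> macaulay.level C k" "y < m" for m y
  proof -
    obtain q where q: "add_mset q m \<in> S" using m by (auto simp: shadow_def)
    then have "add_mset q m \<in> macaulay.level C (Suc k)" using S by (auto simp: init_def)
    then have "add_mset q y \<in> macaulay.level C (Suc k)" using y by (simp add: macaulay_level)
    moreover have "add_mset q y < add_mset q m" using y(2) by (rule add_mset_lt_right_lt)
    ultimately have "add_mset q y \<in> S" using S q by (auto simp: init_def)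
    then show ?thesis by (auto simp: shadow_def)
  qed
  then show "init (macaulay.level C k) (shadow S)"
    using S macaulay.shadow_level[of S C k] finite_shadow by (auto simp: init_def)
qed

lemma card_shadow_ge:
  assumes "finite A"
  shows "card {m \<in> A. x \<in># m} \<le> card (shadow A)"
proof (rule card_inj_on_le[of "\<lambda>m. m - {#x#}"])
  show "inj_on (\<lambda>m. m - {#x#}) {m \<in> A. x \<in># m}"
    by (auto simp: inj_on_def) (metis insert_DiffM)
  show "(\<lambda>m. m - {#x#}) ` {m \<in> A. x \<in># m} \<subseteq> shadow A"
  proof
    fix G assume "G \<in> (\<lambda>m. m - {#x#}) ` {m \<in> A. x \<in># m}"
    then have "add_mset x G \<in> A" by auto
    then show "G \<in> shadow A" by (auto simp: shadow_def)
  qed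
qed (use assms finite_shadow in auto)

text \<open>In an initial segment the removed variable can be exchanged for the least variable
  \<open>x\<close>, which only makes the monomial smaller. Division by \<open>x\<close> alone thus
  reaches the whole shadow.\<close>

lemma macaulay_card_shadow_init:
  assumes "init (macaulay.level C k) S" "x \<in> C" "\<And>c. c \<in> C \<Longrightarrow> x \<le> c"
  shows "card (shadow S) \<le> card {m \<in> S. x \<in># m}"
proof (rule surj_card_le)
  show "finite {m \<in> S. x \<in># m}" using assms by (auto simp: init_def)
  show "shadow S \<subseteq> (\<lambda>m. m - {#x#}) ` {m \<in> S. x \<in># m}"
  proof
    fix G assume "G \<in> shadow S"
    then obtain q where q: "add_mset q G \<in> S" by (auto simp: shadow_def)
    then have L: "add_mset q G \<in> macaulay.level C k" using assms by (auto simp: init_def)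
    then have "add_mset x G \<in> macaulay.level C k" using assms(2) by (auto simp: macaulay_level)
    moreover have "q = x \<or> add_mset x G < add_mset q G"
      using L assms(3)[of q] by (auto simp: macaulay_level add_mset_lt_left_lt le_less)
    ultimately have "add_mset x G \<in> S" using assms(1) q by (auto simp: init_def)
    then show "G \<in> (\<lambda>m. m - {#x#}) ` {m \<in> S. x \<in># m}"
      by (intro image_eqI[of _ _ "add_mset x G"]) auto
  qed
qed

lemma size_two_variables:
  assumes "set_mset m \<subseteq> {x, y}" "x \<noteq> y"
  shows "size m = count m x + count m y"
proof -
  have "m = replicate_mset (count m x) x + replicate_mset (count m y) y"
    using assms by (auto simp: multiset_eq_iff not_in_iff[symmetric])
  then have "size m = size (replicate_mset (count m x) x + replicate_mset (count m y) y)" by simp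
  then show ?thesis by simp
qed

text \<open>A monomial of degree \<open>k\<close> is determined by its exponent of \<open>y\<close>.
  Below the exponent of the missing monomial \<open>t\<close> division by \<open>x\<close> keeps
  this exponent, above it division by \<open>y\<close> lowers it by one into the hole left by
  \<open>t\<close>; together this is injective. For the full level the claim would fail by
  one.\<close>

lemma macaulay_two_variables:
  assumes "x \<noteq> y" "finite A" "A \<subseteq> macaulay.level {x, y} k" "t \<in> macaulay.level {x, y} k" "t \<notin> A"
  shows "card A \<le> card (shadow A)"
proof -
  define f where "f m = (if count m y < count t y then m - {#x#} else m - {#y#})" for m
  have size: "count m x + count m y = k" if "m \<in> macaulay.level {x, y} k" for m
    using that size_two_variables[of m x y] assms(1) by (auto simp: macaulay_level)
  have eqI: "m = m'" if "m \<in> macaulay.level {x, y} k" "m' \<in> macaulay.level {x, y} k"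
    "count m y = count m' y" for m m'
  proof (rule multiset_eqI)
    fix z
    show "count m z = count m' z"
    proof (cases "z \<in> {x, y}")
      case True
      then show ?thesis using size[OF that(1)] size[OF that(2)] that(3) by auto
    next
      case False
      then have "z \<notin># m" "z \<notin># m'" using that(1,2) by (auto simp: macaulay_level)
      then show ?thesis by (simp add: not_in_iff)
    qed
  qed
  have lt: "x \<in># m" if "m \<in> A" "count m y < count t y" for m
    using size[of m] size[of t] that assms by (intro count_inI) auto
  have gt: "count t y < count m y" if "m \<in> A" "\<not> count m y < count t y" for m
    using eqI[of m t] that assms by fastforce
  have cnt: "count (f m) y = (if count m y < count t y then count m y else count m y - 1)" for m
    using assms(1) by (simp add: f_def)
  show ?thesis
  proof (rule card_inj_on_le[of f])
    show "inj_on f A"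
    proof (rule inj_onI)
      fix m m' assume m: "m \<in> A" "m' \<in> A" "f m = f m'"
      have "count m y = count m' y"
        using cnt[of m] cnt[of m'] gt[of m] gt[of m'] m by (auto split: if_splits)
      then show "m = m'" using eqI m assms(3) by blast
    qed
    show "f ` A \<subseteq> shadow A"
    proof
      fix G assume "G \<in> f ` A"
      then obtain m where m: "m \<in> A" "G = f m" by auto
      have "\<exists>q. add_mset q G = m"
      proof (cases "count m y < count t y")
        case True
        then show ?thesis using m lt by (intro exI[of _ x]) (simp add: f_def)
      next
        case False
        then have "count t y < count m y" using gt m(1) by blast
        then have "y \<in># m" by (metis gr_implies_not0 not_in_iff)
        then show ?thesis using m False by (intro exI[of _ y]) (simp add: f_def)
      qed
      then obtain q where "add_mset q G = m" by blast
      then show "G \<in> shadow A" using m(1) unfolding shadow_def by blast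
    qed
  qed (use assms finite_shadow in auto)
qed

lemma card_le_one_subset:
  assumes "L \<subseteq> {w}" "A \<subseteq> L" "S \<subseteq> L" "card S \<le> card A"
  shows "S \<subseteq> A"
proof (cases "S = {}")
  case False
  then have "S = {w}" using assms by blast
  then show ?thesis using assms by (cases "A = {}") auto
qed simp

text \<open>At the position \<open>z\<close> that decides between \<open>x G\<close> and
  \<open>v\<close> the latter has a variable, so \<open>y \<le> z\<close>. Turning \<open>x\<close>
  into \<open>y\<close> can spoil the comparison only for \<open>z = y\<close> with equality there,
  and then \<open>v\<close> divides \<open>y G\<close>, hence equals it by degree.\<close>

lemma macaulay_raise:
  assumes v: "v \<in> macaulay.level C k" "x \<notin># v"
    and w: "add_mset x G \<in> macaulay.level C k" "add_mset x G \<le> v"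
    and y: "\<And>c. c \<in> C \<Longrightarrow> c = x \<or> y \<le> c" "x < y"
  shows "add_mset y G \<le> v"
proof -
  have "add_mset x G < v" using w(2) v(2) by (auto simp: le_less)
  then obtain z where z: "count (add_mset x G) z < count v z"
    "\<And>p. z < p \<Longrightarrow> count (add_mset x G) p = count v p" by (rule mset_lessE) blast
  have "z \<in># v" using z(1) by (intro count_inI) auto
  then have zy: "y \<le> z" "z \<noteq> x" using v y(1)[of z] by (auto simp: macaulay_level)
  show ?thesis
  proof (cases "count (add_mset y G) z < count v z")
    case True
    then have "add_mset y G < v" using z(2) zy y(2) by (intro mset_lessI[of _ z]) auto
    then show ?thesis by simp
  next
    case False
    then have zeq: "z = y" "count (add_mset y G) y = count v y"
      using z(1) zy by (auto split: if_splits)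
    have "v \<subseteq># add_mset y G"
    proof (rule mset_subset_eqI)
      fix p
      show "count v p \<le> count (add_mset y G) p"
      proof (cases "p \<in># v")
        case True
        then have "p = y \<or> y < p" using v y(1)[of p] by (auto simp: macaulay_level)
        then show ?thesis using zeq z(2)[of p] y(2) by auto
      qed (simp add: not_in_iff)
    qed
    moreover have "size v = size (add_mset y G)" using v w by (simp add: macaulay_level)
    ultimately have "v = add_mset y G"
      by (metis mset_subset_size order_less_irrefl subset_mset.le_less)
    then show ?thesis by simp
  qed
qed

lemma macaulay_shadow_min:
  assumes "finite C"
  shows "macaulay.shadow_min C"
  using assms
proof (induction "card C" arbitrary: C rule: less_induct)
  case less
  show ?case
    unfolding macaulay.shadow_min_def
  proof (intro allI impI, elim conjE)
    fix k A S
    assume A: "finite A" "A \<subseteq> macaulay.level C k" and S: "init (macaulay.level C k) S"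
      and cd: "card S \<le> card A"
    have SL: "S \<subseteq> macaulay.level C k" "finite S" using S by (auto simp: init_def)
    have sub: "card (shadow S) \<le> card (shadow A)" if "S \<subseteq> A"
      using that card_mono[OF finite_shadow[OF A(1)] shadow_mono[of S A]] by blast
    \<comment> \<open>The general case needs three variables, since an exchange between two of them
      must leave some exponent fixed for compression to apply.\<close>
    consider "C = {}" | x where "C = {x}" | "card C = 2" | "3 \<le> card C"
      by (metis One_nat_def Suc_1 card_0_eq card_1_singletonE le_neq_implies_less less.prems less_2_cases
          not_less_eq_eq numeral_3_eq_3)
    then show "card (shadow S) \<le> card (shadow A)"
    proof cases
      case 1
      then have "macaulay.level C k \<subseteq> {{#}}" by (auto simp: macaulay_level)
      from card_le_one_subset[OF this A(2) SL(1) cd] show ?thesis by (rule sub)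
    next
      case (2 x)
      then have "macaulay.level C k \<subseteq> {replicate_mset k x}"
        by (auto simp: macaulay_level dest: set_mset_subset_singletonD)
      from card_le_one_subset[OF this A(2) SL(1) cd] show ?thesis by (rule sub)
    next
      case 3
      then obtain x y where "C = {x, y}" "x \<noteq> y" by (auto simp: card_2_iff)
      then obtain x y where xy: "C = {x, y}" "x < y" by (metis insert_commute linorder_neqE_nat)
      show ?thesis
      proof (cases "macaulay.level C k \<subseteq> A")
        case True
        then show ?thesis using SL(1) by (intro sub) auto
      next
        case False
        then have "card A \<le> card (shadow A)" using A xy macaulay_two_variables[of x y A k] by auto
        moreover have "card (shadow S) \<le> card S"
          using macaulay_card_shadow_init[OF S, of x] xy SL(2) card_mono[of S "{m \<in> S. x \<in># m}"] by force
        ultimately show ?thesis using cd by simp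
      qed
    next
      case 4
      show ?thesis
      proof (rule macaulay.shadow_min_via_minimal[OF A S cd])
        fix B assume B: "macaulay.minimal_family C k B" and cdB: "card S \<le> card B"
        have BL: "finite B" "B \<subseteq> macaulay.level C k" using B by (auto simp: macaulay.minimal_family_def)
        have ne: "C \<noteq> {}" using 4 by auto
        define x where "x = Min C"
        have x: "x \<in> C" "\<And>c. c \<in> C \<Longrightarrow> x \<le> c" using less.prems ne by (auto simp: x_def)
        have "card (C - {x}) \<noteq> 0" using 4 x(1) by (simp add: card_Diff_singleton)
        then have ne': "C - {x} \<noteq> {}" by force
        define y where "y = Min (C - {x})"
        have "y \<in> C - {x}" unfolding y_def using less.prems ne' by (intro Min_in) auto
        then have y: "y \<in> C" "x < y" using x(2)[of y] by auto
        have y_le: "c = x \<or> y \<le> c" if "c \<in> C" for c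
          unfolding y_def using less.prems that by (cases "c = x") (auto intro!: Min_le)
        have closed: "G \<in> B" if "F \<in> B" "G \<in> macaulay.level C k" "G < F" "c \<in> C" "count G c = count F c" for F G c
        proof (rule macaulay.minimal_family_closed[OF B _ macaulay_shadow_init that(1-3)])
          show "macaulay.shadow_min (C - {c})"
            using less.prems that(4) by (intro less.hyps card_Diff1_less) auto
        qed (simp add: macaulay_part that)
        \<comment> \<open>Exchanging any variable for the least one makes the monomial smaller and
          keeps the exponent of a third variable \<open>c\<close>.\<close>
        have stable: "add_mset x G \<in> B" if "add_mset p G \<in> B" for p G
        proof (cases "p = x")
          case False
          have L: "add_mset p G \<in> macaulay.level C k" using that BL by blast
          then have p: "p \<in> C" "x < p" using False x(2)[of p] by (auto simp: macaulay_level)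
          have "card (C - {x, p}) = card C - 2" using x(1) p by (subst card_Diff_subset) auto
          then have "C - {x, p} \<noteq> {}" using 4 by force
          then obtain c where c: "c \<in> C" "c \<noteq> x" "c \<noteq> p" by blast
          show ?thesis
            using L x p c by (intro closed[OF that, of _ c]) (auto simp: macaulay_level add_mset_lt_left_lt)
        qed (use that in simp)
        \<comment> \<open>The initial segment generated by the members that avoid the least
          variable.\<close>
        define T where "T = {w \<in> macaulay.level C k. \<exists>v\<in>B. x \<notin># v \<and> w \<le> v}"
        \<comment> \<open>Induction on the exponent of \<open>x\<close> in \<open>w\<close>: one
          factor \<open>x\<close> is raised to the next variable \<open>y\<close> without passing
          \<open>v\<close>, and \<open>stable\<close> lowers it again. Exponent 0 is compression in
          \<open>x\<close> itself.\<close>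
        have inB: "w \<in> B" if "w \<in> macaulay.level C k" "v \<in> B" "x \<notin># v" "w \<le> v" for w v
          using that
        proof (induction "count w x" arbitrary: w)
          case 0
          then show ?case using closed[of v w x] x(1) by (cases "w = v") (auto simp: not_in_iff)
        next
          case (Suc j)
          then have "x \<in># w" by (intro count_inI) simp
          then obtain G where w: "w = add_mset x G" by (metis insert_DiffM)
          have "add_mset y G \<le> v"
            by (rule macaulay_raise[of v C k x G y]) (use Suc.prems BL w y y_le in auto)
          moreover have "add_mset y G \<in> macaulay.level C k"
            using Suc.prems(1) w y(1) by (auto simp: macaulay_level)
          moreover have "j = count (add_mset y G) x" using Suc.hyps(2) w y(2) by auto
          ultimately have "add_mset y G \<in> B" using Suc.hyps(1) Suc.prems by blast
          then show ?case using stable w by blast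
        qed
        then have TB: "T \<subseteq> B" by (auto simp: T_def)
        have Ti: "init (macaulay.level C k) T"
          unfolding init_def
        proof (intro conjI ballI impI)
          show "finite T" using TB BL finite_subset by blast
          show "T \<subseteq> macaulay.level C k" by (auto simp: T_def)
          fix u w assume "u \<in> T" "w \<in> macaulay.level C k" "w < u"
          then obtain v where "v \<in> B" "x \<notin># v" "u \<le> v" by (auto simp: T_def)
          moreover have "w \<le> v" using \<open>w < u\<close> \<open>u \<le> v\<close> by simp
          ultimately show "w \<in> T" using \<open>w \<in> macaulay.level C k\<close> by (auto simp: T_def)
        qed
        show "card (shadow S) \<le> card (shadow B)"
        proof (cases "S \<subseteq> T")
          case True
          then show ?thesis using TB BL finite_shadow shadow_mono[of S B] by (intro card_mono) auto
        next
          case False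
          then have "T \<subseteq> S" using init_chain[OF S Ti] by blast
          \<comment> \<open>So \<open>S\<close> has at least as many members avoiding
            \<open>x\<close> as \<open>B\<close>, and consequently at most as many containing
            \<open>x\<close>.\<close>
          then have sub0: "{m \<in> B. x \<notin># m} \<subseteq> {m \<in> S. x \<notin># m}" using BL by (auto simp: T_def)
          have split: "card X = card {m \<in> X. x \<in># m} + card {m \<in> X. x \<notin># m}" if "finite X" for X
            using that by (subst card_Un_disjoint[symmetric]) (auto intro!: arg_cong[of _ _ card])
          have "card {m \<in> B. x \<notin># m} \<le> card {m \<in> S. x \<notin># m}" using sub0 SL by (intro card_mono) auto
          then have "card {m \<in> S. x \<in># m} \<le> card {m \<in> B. x \<in># m}"
            using split[OF SL(2)] split[OF BL(1)] cdB by linarith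
          then show ?thesis
            using macaulay_card_shadow_init[OF S x] card_shadow_ge[OF BL(1), of x] by linarith
        qed
      qed
    qed
  qed
qed

section \<open>The coloured Kruskal--Katona theorem\<close>

text \<open>If the level is run through in increasing order, this is what \<open>w\<close> adds to
  the shadow of everything before it.\<close>

definition new_shadow :: "nat multiset set \<Rightarrow> nat multiset \<Rightarrow> nat multiset set" where
  "new_shadow L w = {G \<in> shadow {w}. \<forall>w'\<in>L. w' < w \<longrightarrow> G \<notin> shadow {w'}}"

lemma finite_new_shadow: "finite (new_shadow L w)"
  unfolding new_shadow_def by (rule finite_subset[of _ "shadow {w}"]) (auto intro: finite_shadow)

lemma in_shadow: "G \<in> shadow A \<longleftrightarrow> (\<exists>w\<in>A. G \<in> shadow {w})"
  by (auto simp: shadow_def)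

text \<open>The contributions \<open>new_shadow\<close> are pairwise disjoint. Removing the final
  part \<open>R\<close> of \<open>A\<close> loses at least the contributions of its members, since
  all remaining ones are smaller. Adding \<open>Q\<close> gains at most the contributions of its
  members, since by \<open>fill\<close> everything below them is present afterwards.\<close>

lemma exchange_card:
  assumes A: "finite A" "A \<subseteq> L" and R: "R \<subseteq> A" and Q: "finite Q" "Q \<subseteq> L"
    and below: "\<And>a x. a \<in> A - R \<Longrightarrow> x \<in> R \<Longrightarrow> a < x"
    and fill: "\<And>q w. q \<in> Q \<Longrightarrow> w \<in> L \<Longrightarrow> w < q \<Longrightarrow> w \<in> (A - R) \<union> Q"
    and cost: "(\<Sum>q\<in>Q. card (new_shadow L q)) \<le> (\<Sum>x\<in>R. card (new_shadow L x))"
  shows "card (shadow ((A - R) \<union> Q)) \<le> card (shadow A)"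
proof -
  have fR: "finite R" using A R finite_subset by blast
  have "shadow ((A - R) \<union> Q) \<subseteq> shadow (A - R) \<union> (\<Union>q\<in>Q. new_shadow L q)"
  proof
    fix G assume "G \<in> shadow ((A - R) \<union> Q)"
    then consider "G \<in> shadow (A - R)" | q where "q \<in> Q" "G \<in> shadow {q}"
      by (auto simp: in_shadow[of _ "A - R \<union> Q"] in_shadow[of _ "A - R"])
    then show "G \<in> shadow (A - R) \<union> (\<Union>q\<in>Q. new_shadow L q)"
    proof cases
      case (2 q)
      \<comment> \<open>The first set of the level with \<open>G\<close> in its shadow. It belongs
        to the new family, so \<open>G\<close> is either an old shadow element or counted as a
        contribution of \<open>w\<close>.\<close>
      define w where "w = (LEAST w. w \<in> L \<and> G \<in> shadow {w})"
      have qL: "q \<in> L \<and> G \<in> shadow {q}" using 2 Q by blast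
      have w: "w \<in> L" "G \<in> shadow {w}"
        using LeastI[of "\<lambda>w. w \<in> L \<and> G \<in> shadow {w}", OF qL] by (auto simp: w_def)
      have le: "w \<le> w'" if "w' \<in> L" "G \<in> shadow {w'}" for w'
        unfolding w_def using that by (intro Least_le) auto
      have new: "G \<in> new_shadow L w" using w le by (force simp: new_shadow_def)
      have "w \<in> (A - R) \<union> Q" using le[of q] qL fill[OF 2(1) w(1)] 2(1) by (cases "w = q") auto
      then show ?thesis using new w(2) in_shadow by blast
    qed simp
  qed
  then have "card (shadow ((A - R) \<union> Q)) \<le> card (shadow (A - R) \<union> (\<Union>q\<in>Q. new_shadow L q))"
    using A Q finite_new_shadow by (intro card_mono) (auto intro: finite_shadow)
  also have "\<dots> \<le> card (shadow (A - R)) + card (\<Union>q\<in>Q. new_shadow L q)" by (rule card_Un_le)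
  also have "\<dots> \<le> card (shadow (A - R)) + (\<Sum>q\<in>Q. card (new_shadow L q))"
    using card_UN_le[OF Q(1)] by simp
  also have "\<dots> \<le> card (shadow (A - R)) + (\<Sum>x\<in>R. card (new_shadow L x))" using cost by simp
  also have "(\<Sum>x\<in>R. card (new_shadow L x)) = card (\<Union>x\<in>R. new_shadow L x)"
  proof (rule card_UN_disjoint[symmetric])
    show "\<forall>x\<in>R. \<forall>y\<in>R. x \<noteq> y \<longrightarrow> new_shadow L x \<inter> new_shadow L y = {}"
    proof (intro ballI impI Int_emptyI)
      fix x y G assume "x \<in> R" "y \<in> R" "x \<noteq> y" "G \<in> new_shadow L x" "G \<in> new_shadow L y"
      then have "x \<in> L" "y \<in> L" "G \<in> shadow {x}" "G \<in> shadow {y}"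
        "\<not> x < y" "\<not> y < x" using A R unfolding new_shadow_def by blast+
      then show False using \<open>x \<noteq> y\<close> by simp
    qed
  qed (use fR finite_new_shadow in auto)
  also have "card (shadow (A - R)) + card (\<Union>x\<in>R. new_shadow L x)
      = card (shadow (A - R) \<union> (\<Union>x\<in>R. new_shadow L x))"
  proof (rule card_Un_disjoint[symmetric])
    show "shadow (A - R) \<inter> (\<Union>x\<in>R. new_shadow L x) = {}"
    proof (rule Int_emptyI)
      fix G assume "G \<in> shadow (A - R)" "G \<in> (\<Union>x\<in>R. new_shadow L x)"
      then obtain a x where ax: "a \<in> A - R" "G \<in> shadow {a}" "x \<in> R" "G \<in> new_shadow L x"
        unfolding in_shadow[of G "A - R"] by blast
      then have "a < x" "a \<in> L" using below A by blast+
      then show False using ax by (auto simp: new_shadow_def)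
    qed
  qed (use A fR finite_new_shadow in \<open>auto intro: finite_shadow\<close>)
  also have "\<dots> \<le> card (shadow A)"
  proof (rule card_mono)
    show "finite (shadow A)" using A by (simp add: finite_shadow)
    have "new_shadow L x \<subseteq> shadow A" if "x \<in> R" for x
      using that R shadow_mono[of "{x}" A] by (auto simp: new_shadow_def)
    then show "shadow (A - R) \<union> (\<Union>x\<in>R. new_shadow L x) \<subseteq> shadow A"
      using shadow_mono[of "A - R" A] by blast
  qed
  finally show ?thesis .
qed

text \<open>Every new member is smaller than every removed one, so an exchange that does not enlarge
  the shadow would produce a smaller competitor.\<close>

lemma (in colored) minimal_family_exchange:
  assumes A: "minimal_family C k A" and T: "T \<subseteq> A" "T \<noteq> {}"
    and Q: "finite Q" "Q \<subseteq> level C k - A" "card Q = card T"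
    and below: "\<And>a x. a \<in> A - T \<Longrightarrow> x \<in> T \<Longrightarrow> a < x"
    and fill: "\<And>q w. q \<in> Q \<Longrightarrow> w \<in> level C k \<Longrightarrow> w < q \<Longrightarrow> w \<in> (A - T) \<union> Q"
    and lt: "\<And>q x. q \<in> Q \<Longrightarrow> x \<in> T \<Longrightarrow> q < x"
    and cost: "(\<Sum>q\<in>Q. card (new_shadow (level C k) q)) \<le> (\<Sum>x\<in>T. card (new_shadow (level C k) x))"
  shows False
proof -
  let ?B = "(A - T) \<union> Q"
  have fin: "finite A" "A \<subseteq> level C k" using A by (auto simp: minimal_family_def)
  then have fR: "finite T" using T finite_subset by blast
  have "card ?B = card (A - T) + card Q" using fin Q by (intro card_Un_disjoint) auto
  also have "\<dots> = card A" using fin fR T Q card_mono[OF fin(1) T(1)] by (simp add: card_Diff_subset)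
  finally have "card ?B = card A" .
  moreover have "card (shadow ?B) \<le> card (shadow A)"
  proof (rule exchange_card[OF fin T(1) Q(1) _ below fill cost])
    show "Q \<subseteq> level C k" using Q(2) by blast
  qed
  moreover have "mset_set ?B < mset_set A"
  proof (rule mset_set_lessI)
    obtain x where x: "x \<in> T" using T by blast
    then show "?B \<noteq> A" using T Q by blast
    fix y assume "y \<in> ?B - A"
    then have "y \<in> Q" by blast
    then show "\<exists>x\<in>A - ?B. y < x" using lt[of y x] x T Q by (intro bexI[of _ x]) auto
  qed (use fin Q in auto)
  moreover have "finite ?B" "?B \<subseteq> level C k" using fin Q by auto
  ultimately show False using A by (simp add: minimal_family_def)
qed

section \<open>Sets with pairwise distinct residues\<close>

locale cyclic =
  fixes n :: nat
  assumes n_pos: "0 < n"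
begin

sublocale colored "\<lambda>q. q mod n" "\<lambda>s. s < 2"
  by standard simp_all

definition col :: "nat multiset \<Rightarrow> nat set" where
  "col m = (\<lambda>q. q mod n) ` set_mset m"

lemma col_simps [simp]: "col {#} = {}" "col (add_mset q m) = insert (q mod n) (col m)"
  by (auto simp: col_def)

lemma finite_col [simp]: "finite (col m)"
  by (simp add: col_def)

lemma level_0: "level C 0 = {{#}}"
  by (auto simp: level_def part_def)

lemma lt_2_Suc: "Suc s < 2 \<longleftrightarrow> s = 0"
  by auto

lemma level_add: "add_mset q G \<in> level C (Suc k) \<longleftrightarrow> G \<in> level C k \<and> q mod n \<in> C \<and> q mod n \<notin> col G"
proof -
  have "size (part c (add_mset q G)) = (if q mod n = c then Suc (size (part c G)) else size (part c G))" for c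
    by (simp add: part_def)
  moreover have "size (part c G) = 0 \<longleftrightarrow> c \<notin> col G" for c
    by (auto simp: part_def col_def)
  ultimately have "size (part c (add_mset q G)) < 2 \<longleftrightarrow> size (part c G) < 2 \<and> (c = q mod n \<longrightarrow> c \<notin> col G)" for c
    by (metis lt_2_Suc zero_less_numeral)
  then show ?thesis
    by (auto simp: level_def col_def)
qed

lemma level_col: "m \<in> level C k \<Longrightarrow> col m \<subseteq> C \<and> card (col m) = k"
proof (induction k arbitrary: m)
  case 0
  then show ?case by (simp add: level_0)
next
  case (Suc k)
  then have "size m = Suc k" by (simp add: level_def)
  then obtain q G where "m = add_mset q G" by (metis size_eq_Suc_imp_eq_union)
  then show ?case using Suc by (auto simp: level_add card_insert_if)
qed

lemma level_split:
  assumes "m \<in> level C k" "p \<in># m"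
  obtains G j where "m = add_mset p G" "k = Suc j" "G \<in> level C j" "p mod n \<in> C" "p mod n \<notin> col G"
    "G = m - {#p#}"
proof -
  obtain G where G: "m = add_mset p G" using assms(2) by (metis insert_DiffM)
  then obtain j where "k = Suc j" using assms(1) by (auto simp: level_def)
  then show ?thesis using that G assms(1) by (auto simp: level_add)
qed

lemma level_unique:
  assumes "m \<in> level C k" "p \<in># m" "q \<in># m" "p mod n = q mod n"
  shows "p = q"
proof (rule ccontr)
  assume "p \<noteq> q"
  obtain G j where "m = add_mset p G" "p mod n \<notin> col G" using level_split[OF assms(1,2)] by metis
  then show False using \<open>p \<noteq> q\<close> assms by (auto simp: col_def)
qed

lemma level_count: "m \<in> level C k \<Longrightarrow> count m p \<le> 1"
proof (rule ccontr)
  assume m: "m \<in> level C k" "\<not> count m p \<le> 1"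
  then have "p \<in># m" by (intro count_inI) auto
  then obtain G j where "m = add_mset p G" "p mod n \<notin> col G" using level_split[OF m(1)] by metis
  then show False using m(2) by (auto simp: col_def count_eq_zero_iff)
qed

lemma level_swap:
  assumes "m \<in> level C k" "p \<in># m" "q mod n \<in> C" "q mod n = p mod n \<or> q mod n \<notin> col m"
  shows "add_mset q (m - {#p#}) \<in> level C k"
    "col (add_mset q (m - {#p#})) = insert (q mod n) (col m - {p mod n})"
proof -
  obtain G j where G: "m = add_mset p G" "k = Suc j" "G \<in> level C j" "p mod n \<in> C" "p mod n \<notin> col G"
    "G = m - {#p#}" using level_split[OF assms(1,2)] by metis
  show "add_mset q (m - {#p#}) \<in> level C k"
  proof -
    have "col m = insert (p mod n) (col G)" using G(1) by simp
    then show ?thesis unfolding G(6)[symmetric] unfolding G(2) level_add using G(3,5) assms(3,4) by auto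
  qed
  show "col (add_mset q (m - {#p#})) = insert (q mod n) (col m - {p mod n})"
    unfolding G(6)[symmetric] using G(1,5) by auto
qed

lemma col_elem: "d \<in> col m \<Longrightarrow> \<exists>p\<in>#m. p mod n = d"
  by (auto simp: col_def)

lemma col_I: "p \<in># m \<Longrightarrow> p mod n \<in> col m"
  by (auto simp: col_def)

text \<open>Together with \<open>part_missing\<close> this says when compression applies: a shared
  variable or a common missing colour gives equal parts in that colour.\<close>

lemma part_shared:
  assumes "m \<in> level C k" "q \<in># m"
  shows "part (q mod n) m = {#q#}"
proof -
  obtain G where "m = add_mset q G" "q mod n \<notin> col G" using level_split[OF assms] by metis
  then show ?thesis by (auto simp: part_def dest: col_I)
qed

lemma part_missing: "d \<notin> col m \<Longrightarrow> part d m = {#}"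
  by (auto simp: part_def col_def)

text \<open>For \<open>H'\<close> below a shadow element \<open>H\<close>, the cheapest extension of
  \<open>H'\<close> is compared with a member \<open>H + q\<close>. If it were larger, the
  comparison of \<open>H\<close> and \<open>H'\<close> would already have been decided
  differently.\<close>

lemma cyclic_shadow_init:
  assumes C: "C \<subseteq> {..<n}"
  shows "shadow_init C"
  unfolding shadow_init_def
proof (intro allI impI)
  fix k S assume S: "init (level C (Suc k)) S"
  have "H' \<in> shadow S" if H: "H \<in> shadow S" and H': "H' \<in> level C k" "H' < H" for H H'
  proof -
    obtain q where q: "add_mset q H \<in> S" using H by (auto simp: shadow_def)
    then have L: "add_mset q H \<in> level C (Suc k)" using S by (auto simp: init_def)
    then have HL: "H \<in> level C k" by (simp add: level_add)
    have "card (col H') < card (col (add_mset q H))" using level_col[OF H'(1)] level_col[OF L] by simp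
    moreover have "finite C" using C finite_subset by blast
    moreover have "card (col (add_mset q H)) \<le> card C"
      using level_col[OF L] \<open>finite C\<close> by (intro card_mono) auto
    ultimately have "\<not> C \<subseteq> col H'" using card_mono[of "col H'" C] by auto
    then have "C - col H' \<noteq> {}" by blast
    then have ex: "\<exists>t. t \<in> C - col H'" by blast
    define t where "t = (LEAST t. t \<in> C - col H')"
    have t: "t \<in> C" "t \<notin> col H'" using LeastI_ex[OF ex] by (auto simp: t_def)
    have least: "d \<in> col H'" if "d \<in> C" "d < t" for d
      using not_less_Least[of d "\<lambda>t. t \<in> C - col H'"] that by (auto simp: t_def)
    have tn: "t mod n = t" "t < n" using t C by auto
    have TL: "add_mset t H' \<in> level C (Suc k)" using H'(1) t tn by (simp add: level_add)
    obtain w where w: "count H' w < count H w" "\<And>y. w < y \<Longrightarrow> count H' y = count H y"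
      using H'(2) by (rule mset_lessE) blast
    have wH: "w \<in># H" "w \<notin># H'" using w(1) level_count[OF HL, of w]
      by (auto intro: count_inI simp: count_eq_zero_iff[symmetric])
    have agree: "p \<in># H' \<longleftrightarrow> p \<in># H" if "w < p" for p
      using w(2)[OF that] by (metis count_eq_zero_iff)
    have "add_mset t H' \<le> add_mset q H"
    proof (cases "t < w \<or> w < q \<and> t = w")
      case True
      then show ?thesis
      proof
        assume "t < w"
        then have "add_mset t H' < add_mset q H"
          using w by (intro mset_lessI[of _ w]) auto
        then show ?thesis by simp
      next
        assume *: "w < q \<and> t = w"
        then have "add_mset t H' < add_mset q H"
          using w by (intro mset_lessI[of _ q]) auto
        then show ?thesis by simp
      qed
    next
      case False
      \<comment> \<open>Colours below \<open>t\<close> occur in \<open>H'\<close>. If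
        \<open>w < t\<close>, the variable of colour \<open>w\<close> in \<open>H'\<close> would lie
        above \<open>w\<close> and so belong to \<open>H\<close> too, giving \<open>H\<close> two
        variables of one colour.\<close>
      have "\<not> w < t"
      proof
        assume "w < t"
        then have wn: "w mod n = w" using tn by simp
        have "w \<in> C" using HL wH level_col[OF HL] col_I[OF wH(1)] wn by auto
        then obtain p where p: "p \<in># H'" "p mod n = w" using least[of w] \<open>w < t\<close> col_elem by blast
        then have "w < p" using wH(2) by (metis le_neq_implies_less mod_less_eq_dividend)
        then have "p \<in># H" using agree p by blast
        then show False using level_unique[OF HL _ wH(1), of p] p wn \<open>w < p\<close> by simp
      qed
      then have tw: "t = w" using False by simp
      have "q \<noteq> w" using L wH(1) by (auto simp: level_add col_def)
      then have qw: "q < w" using False tw by simp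
      \<comment> \<open>Below \<open>w\<close> all variables have index 0, and \<open>H'\<close> has
        every colour there, necessarily through these variables. The two extensions therefore
        coincide.\<close>
      have "add_mset q H \<subseteq># add_mset t H'"
      proof (rule mset_subset_eqI)
        fix p
        show "count (add_mset q H) p \<le> count (add_mset t H') p"
        proof (cases "p \<in># add_mset q H")
          case True
          have "p \<in># add_mset t H'"
          proof (cases "p < w")
            case True
            then have pn: "p mod n = p" using tn tw by simp
            have "p \<in> C" using \<open>p \<in># add_mset q H\<close> L level_col[OF L] col_I pn by (metis subsetD)
            then obtain p' where p': "p' \<in># H'" "p' mod n = p" using least[of p] True tw col_elem by blast
            have "\<not> w < p'"
            proof
              assume "w < p'"
              then have "p' \<in># add_mset q H" using agree p' by simp
              then show False using level_unique[OF L _ \<open>p \<in># add_mset q H\<close>, of p'] p' pn \<open>w < p'\<close> True by simp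
            qed
            moreover have "p' \<noteq> w" using p' wH by auto
            ultimately have "p' < n" using tn tw by simp
            then show ?thesis using p' by simp
          next
            case False
            then show ?thesis using \<open>p \<in># add_mset q H\<close> agree[of p] qw tw by (cases "p = w") auto
          qed
          then show ?thesis using level_count[OF L, of p] by (metis count_greater_eq_one_iff order_trans)
        qed (simp add: not_in_iff)
      qed
      moreover have "size (add_mset q H) = size (add_mset t H')" using L TL by (simp add: level_def)
      ultimately have "add_mset q H = add_mset t H'"
        by (metis mset_subset_size order_less_irrefl subset_mset.le_less)
      then show ?thesis by simp
    qed
    then have "add_mset t H' \<in> S" using S TL q unfolding init_def by (metis le_less)
    then show ?thesis by (auto simp: shadow_def)
  qed
  then show "init (level C k) (shadow S)"
    using S shadow_level[of S C k] finite_shadow by (auto simp: init_def)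
qed

text \<open>The variable of colour \<open>e < n\<close> and index 0 is the number \<open>e\<close>. Removing it creates a new element
  of the shadow exactly if no smaller variable can be put in its place.\<close>

definition new_at :: "nat set \<Rightarrow> nat multiset \<Rightarrow> nat set" where
  "new_at C w = {e. e \<in># w \<and> e < n \<and> (\<forall>d\<in>C. d < e \<longrightarrow> d \<in> col w)}"

lemma finite_new_at [simp]: "finite (new_at C w)"
  unfolding new_at_def by (rule finite_subset[of _ "{..<n}"]) auto

lemma card_new_shadow:
  assumes C: "C \<subseteq> {..<n}" and w: "w \<in> level C k"
  shows "card (new_shadow (level C k) w) = card (new_at C w)"
proof -
  have "new_shadow (level C k) w = (\<lambda>e. w - {#e#}) ` new_at C w"
  proof (intro equalityI subsetI)
    fix G assume G: "G \<in> new_shadow (level C k) w"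
    then obtain e where e: "w = add_mset e G" by (auto simp: new_shadow_def shadow_def)
    have min: "e \<le> e'" if "add_mset e' G \<in> level C k" for e'
    proof (rule ccontr)
      assume "\<not> e \<le> e'"
      then have "add_mset e' G < w" using e by (simp add: add_mset_lt_left_lt)
      then show False using G that by (auto simp: new_shadow_def shadow_def)
    qed
    have swap: "e \<le> e'" if "e' mod n \<in> C" "e' mod n = e mod n \<or> e' mod n \<notin> col w" for e'
      using min level_swap(1)[OF w _ that] e by simp
    have "e \<le> e mod n" using swap[of "e mod n"] w e level_col[OF w] by simp
    then have "e < n" using n_pos by (metis le_less_trans mod_less_divisor)
    moreover have "d \<in> col w" if "d \<in> C" "d < e" for d
    proof -
      have "d mod n = d" using that C by auto
      then show ?thesis using swap[of d] that by auto
    qed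
    ultimately have "e \<in> new_at C w" using e by (auto simp: new_at_def)
    then show "G \<in> (\<lambda>e. w - {#e#}) ` new_at C w" using e by (intro image_eqI[of _ _ e]) auto
  next
    fix G assume "G \<in> (\<lambda>e. w - {#e#}) ` new_at C w"
    then obtain e where e: "e \<in># w" "e < n" "\<And>d. d \<in> C \<Longrightarrow> d < e \<Longrightarrow> d \<in> col w" "G = w - {#e#}"
      by (auto simp: new_at_def)
    then have w_eq: "w = add_mset e G" by simp
    have "G \<notin> shadow {w'}" if w': "w' \<in> level C k" "w' < w" for w'
    proof
      assume "G \<in> shadow {w'}"
      then obtain e' where e': "w' = add_mset e' G" by (auto simp: shadow_def)
      then have lt: "e' < e" using w'(2) w_eq by (metis add_mset_le_left_le linorder_not_less)
      then have en: "e' mod n = e'" using e(2) by simp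
      obtain j where "k = Suc j" using w'(1) e' by (auto simp: level_def)
      then have "e' \<in> C" "e' \<notin> col G" using w'(1) en unfolding e' by (auto simp: level_add)
      moreover have "e' \<in> col w" using e(3) lt \<open>e' \<in> C\<close> by blast
      ultimately show False using w_eq lt e(2) by simp
    qed
    then show "G \<in> new_shadow (level C k) w" using w_eq by (auto simp: new_shadow_def shadow_def)
  qed
  moreover have "inj_on (\<lambda>e. w - {#e#}) (new_at C w)"
  proof (rule inj_onI)
    fix x y assume xy: "x \<in> new_at C w" "y \<in> new_at C w" "w - {#x#} = w - {#y#}"
    have "add_mset x (w - {#x#}) = w" "add_mset y (w - {#y#}) = w"
      using xy(1,2) by (auto simp: new_at_def)
    then have "count (add_mset x (w - {#x#})) x = count (add_mset y (w - {#x#})) x" using xy(3) by simp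
    then show "x = y" by (simp split: if_splits)
  qed
  ultimately show ?thesis by (simp add: card_image)
qed


text \<open>The edges of the complete multipartite graph on \<open>W\<close> whose parts are the
  residue classes.\<close>

definition full_pairs :: "nat set \<Rightarrow> nat set \<Rightarrow> nat multiset set" where
  "full_pairs C W = {m \<in> level C 2. set_mset m \<subseteq> W}"

lemma level_2: "{#p, q#} \<in> level C 2 \<longleftrightarrow> p mod n \<in> C \<and> q mod n \<in> C \<and> p mod n \<noteq> q mod n"
proof -
  have "level C 2 = level C (Suc (Suc 0))" by (rule arg_cong) simp
  then show ?thesis
    using level_add[of p "{#q#}" C "Suc 0"] level_add[of q "{#}" C 0] by (auto simp: level_0)
qed

lemma full_pairs_insert:
  assumes "w \<notin> W" "finite W" "insert w W \<subseteq> {q. q mod n \<in> C}"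
  shows "card (full_pairs C (insert w W)) = card (full_pairs C W) + card {q \<in> W. q mod n \<noteq> w mod n}"
    and "finite (full_pairs C W)"
proof -
  have fin: "finite (full_pairs C W)" if "finite W" for W
    by (rule finite_subset[OF _ finite_multisets_of_size[OF that, of 2]])
      (auto simp: full_pairs_def multisets_of_size_def level_def)
  show "finite (full_pairs C W)" using fin assms(2) by simp
  have "full_pairs C (insert w W) = full_pairs C W \<union> (\<lambda>q. {#w, q#}) ` {q \<in> W. q mod n \<noteq> w mod n}"
  proof (intro equalityI subsetI)
    fix m assume m: "m \<in> full_pairs C (insert w W)"
    then have L: "m \<in> level C 2" "set_mset m \<subseteq> insert w W" by (auto simp: full_pairs_def)
    show "m \<in> full_pairs C W \<union> (\<lambda>q. {#w, q#}) ` {q \<in> W. q mod n \<noteq> w mod n}"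
    proof (cases "w \<in># m")
      case True
      then obtain G j where G: "m = add_mset w G" "2 = Suc j" "G \<in> level C j" "w mod n \<notin> col G"
        using level_split[OF L(1) True] by metis
      then have "size G = 1" by (auto simp: level_def)
      then obtain q where "G = {#q#}" by (metis size_1_singleton_mset)
      then show ?thesis using G L(2) by auto
    next
      case False
      then show ?thesis using L by (auto simp: full_pairs_def)
    qed
  next
    fix m assume "m \<in> full_pairs C W \<union> (\<lambda>q. {#w, q#}) ` {q \<in> W. q mod n \<noteq> w mod n}"
    then show "m \<in> full_pairs C (insert w W)"
      using assms(3) by (auto simp: full_pairs_def level_2)
  qed
  then have "card (full_pairs C (insert w W))
      = card (full_pairs C W) + card ((\<lambda>q. {#w, q#}) ` {q \<in> W. q mod n \<noteq> w mod n})"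
    using assms fin[OF assms(2)] by (simp, subst card_Un_disjoint) (auto simp: full_pairs_def)
  also have "card ((\<lambda>q. {#w, q#}) ` {q \<in> W. q mod n \<noteq> w mod n}) = card {q \<in> W. q mod n \<noteq> w mod n}"
    by (rule card_image) (auto simp: inj_on_def)
  finally show "card (full_pairs C (insert w W)) = card (full_pairs C W) + card {q \<in> W. q mod n \<noteq> w mod n}" .
qed

lemma card_by_class:
  assumes "finite W" "finite C" "W \<subseteq> {q. q mod n \<in> C}"
  shows "card W = (\<Sum>c\<in>C. card {q \<in> W. q mod n = c})"
proof -
  have "W = (\<Union>c\<in>C. {q \<in> W. q mod n = c})" using assms by auto
  then have "card W = card (\<Union>c\<in>C. {q \<in> W. q mod n = c})" by simp
  also have "\<dots> = (\<Sum>c\<in>C. card {q \<in> W. q mod n = c})"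
    using assms by (intro card_UN_disjoint) auto
  finally show ?thesis .
qed

text \<open>An initial segment of vertices is spread evenly over the classes. Its last vertex
  \<open>z\<close> is removed together with a vertex \<open>w\<close> of \<open>W\<close> from a
  class of at least the same size; then \<open>w\<close> has at most as many neighbours as
  \<open>z\<close>, and the remainder is covered by induction.\<close>

lemma turan:
  assumes C: "C \<subseteq> {..<n}"
  shows "finite W \<Longrightarrow> W \<subseteq> {q. q mod n \<in> C} \<Longrightarrow> init {q. q mod n \<in> C} W0 \<Longrightarrow> card W0 = card W \<Longrightarrow>
    card (full_pairs C W) \<le> card (full_pairs C W0)"
proof (induction "card W" arbitrary: W W0)
  case 0
  then have "W = {}" "W0 = {}" by (auto simp: init_def)
  then show ?case by simp
next
  case (Suc N)
  have finC: "finite C" using C finite_subset by blast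
  let ?V = "{q. q mod n \<in> C}"
  have W0: "finite W0" "W0 \<subseteq> ?V" "W0 \<noteq> {}"
    using Suc.prems Suc.hyps(2) by (auto simp: init_def)
  define z where "z = Max W0"
  have z: "z \<in> W0" "\<And>q. q \<in> W0 \<Longrightarrow> q \<le> z" using W0 by (auto simp: z_def)
  have below: "q \<in> W0" if "q \<in> ?V" "q < z" for q
    using Suc.prems(3) z(1) that by (auto simp: init_def)
  define j where "j = z div n"
  have zj: "z = j * n + z mod n" by (simp add: j_def)
  have zC: "z mod n \<in> C" using z(1) W0 by auto
  have class_le: "card {q \<in> W0. q mod n = z mod n} \<le> Suc j"
  proof -
    have "{q \<in> W0. q mod n = z mod n} \<subseteq> (\<lambda>i. i * n + z mod n) ` {..j}"
    proof
      fix q assume q: "q \<in> {q \<in> W0. q mod n = z mod n}"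
      then have "q div n \<le> j" using z(2)[of q] by (auto simp: j_def div_le_mono)
      moreover have "q = q div n * n + z mod n" using q by (metis (mono_tags, lifting) div_mult_mod_eq mem_Collect_eq)
      ultimately show "q \<in> (\<lambda>i. i * n + z mod n) ` {..j}" by blast
    qed
    then have "card {q \<in> W0. q mod n = z mod n} \<le> card ((\<lambda>i. i * n + z mod n) ` {..j})"
      by (intro card_mono) auto
    also have "\<dots> \<le> Suc j" by (metis card_atMost card_image_le finite_atMost)
    finally show ?thesis .
  qed
  have inj: "inj_on (\<lambda>i. i * n + c) A" for c A using n_pos by (auto simp: inj_on_def)
  have class_ge: "j \<le> card {q \<in> W0. q mod n = c}" if "c \<in> C" for c
  proof -
    have "(\<lambda>i. i * n + c) ` {..<j} \<subseteq> {q \<in> W0. q mod n = c}"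
    proof
      fix q assume "q \<in> (\<lambda>i. i * n + c) ` {..<j}"
      then obtain i where i: "i < j" "q = i * n + c" by auto
      have "c < n" using that C by auto
      then have "q < Suc i * n" "q mod n = c" using i by auto
      moreover have "Suc i * n \<le> j * n" using i by (intro mult_le_mono1) simp
      ultimately show "q \<in> {q \<in> W0. q mod n = c}" using below[of q] that zj by auto
    qed
    then have "card ((\<lambda>i. i * n + c) ` {..<j}) \<le> card {q \<in> W0. q mod n = c}"
      using W0 by (intro card_mono) auto
    then show ?thesis by (simp add: card_image[OF inj])
  qed
  have class_z: "Suc j \<le> card {q \<in> W0. q mod n = z mod n}"
  proof -
    have "(\<lambda>i. i * n + z mod n) ` {..j} \<subseteq> {q \<in> W0. q mod n = z mod n}"
    proof
      fix q assume "q \<in> (\<lambda>i. i * n + z mod n) ` {..j}"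
      then obtain i where i: "i \<le> j" "q = i * n + z mod n" by auto
      then have "q = z \<or> q < z" using zj by (metis add_le_mono1 le_neq_implies_less mult_le_mono1)
      then show "q \<in> {q \<in> W0. q mod n = z mod n}" using below[of q] z(1) zC i by auto
    qed
    then have "card ((\<lambda>i. i * n + z mod n) ` {..j}) \<le> card {q \<in> W0. q mod n = z mod n}"
      using W0 by (intro card_mono) auto
    then show ?thesis by (simp add: card_image[OF inj])
  qed
  \<comment> \<open>Every class of \<open>W0\<close> has at least \<open>j\<close> vertices and that
    of \<open>z\<close> has one more, so not all classes of \<open>W\<close> can have at most
    \<open>j\<close>.\<close>
  have "\<exists>c\<in>C. Suc j \<le> card {q \<in> W. q mod n = c}"
  proof (rule ccontr)
    assume "\<not> ?thesis"
    then have "(\<Sum>c\<in>C. card {q \<in> W. q mod n = c}) \<le> (\<Sum>c\<in>C. j)"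
      by (intro sum_mono) auto
    also have "\<dots> < (\<Sum>c\<in>C. card {q \<in> W0. q mod n = c})"
      using class_ge class_z zC finC by (intro sum_strict_mono_ex1) (auto intro!: bexI[of _ "z mod n"])
    finally show False
      using card_by_class[OF Suc.prems(1) finC Suc.prems(2)] card_by_class[OF W0(1) finC W0(2)] Suc.prems(4)
      by simp
  qed
  then obtain c where c: "c \<in> C" "Suc j \<le> card {q \<in> W. q mod n = c}" by blast
  then have "{q \<in> W. q mod n = c} \<noteq> {}" by force
  then obtain w where w: "w \<in> W" "w mod n = c" by blast
  have other: "card {q \<in> X - {x}. q mod n \<noteq> x mod n} = card X - card {q \<in> X. q mod n = x mod n}"
    if "finite X" "x \<in> X" for X x
  proof -
    have "{q \<in> X - {x}. q mod n \<noteq> x mod n} = X - {q \<in> X. q mod n = x mod n}" by auto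
    then show ?thesis using that by (simp add: card_Diff_subset)
  qed
  have "card (full_pairs C (W - {w})) \<le> card (full_pairs C (W0 - {z}))"
  proof (rule Suc.hyps(1))
    show "init ?V (W0 - {z})" using Suc.prems(3) z(2) unfolding init_def by (auto simp: leD)
  qed (use Suc w W0 z in auto)
  moreover have "card {q \<in> W - {w}. q mod n \<noteq> w mod n} \<le> card {q \<in> W0 - {z}. q mod n \<noteq> z mod n}"
    using other[OF Suc.prems(1) w(1)] other[OF W0(1) z(1)] c(2) w(2) class_le Suc.prems(4) by simp
  moreover have "card (full_pairs C W) = card (full_pairs C (W - {w})) + card {q \<in> W - {w}. q mod n \<noteq> w mod n}"
    using full_pairs_insert(1)[of w "W - {w}" C] Suc.prems w by (simp add: insert_absorb)
  moreover have "card (full_pairs C W0) = card (full_pairs C (W0 - {z})) + card {q \<in> W0 - {z}. q mod n \<noteq> z mod n}"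
    using full_pairs_insert(1)[of z "W0 - {z}" C] W0 z by (simp add: insert_absorb)
  ultimately show ?case by linarith
qed

text \<open>The shadow of a family of pairs is its vertex set. By Turan's theorem an initial segment
  on as many vertices has room for at least \<open>card A\<close> pairs, so \<open>S\<close> fits on
  these vertices.\<close>

lemma shadow_min_2:
  assumes C: "C \<subseteq> {..<n}" and A: "finite A" "A \<subseteq> level C 2" and S: "init (level C 2) S" and cd: "card S \<le> card A"
  shows "card (shadow S) \<le> card (shadow A)"
proof -
  let ?V = "{q. q mod n \<in> C}"
  define W where "W = \<Union> (set_mset ` A)"
  have W: "finite W" "W \<subseteq> ?V" using A by (auto simp: W_def level_def)
  obtain W0 where W0: "init ?V W0" "card W0 = card W" using init_exists[OF W order_refl] by blast
  have "init (level C 2) (full_pairs C W0)"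
    unfolding init_def
  proof (intro conjI ballI impI)
    show "finite (full_pairs C W0)"
      by (rule finite_subset[OF _ finite_multisets_of_size[of W0 2]])
        (use W0 in \<open>auto simp: full_pairs_def multisets_of_size_def level_def init_def\<close>)
    show "full_pairs C W0 \<subseteq> level C 2" by (auto simp: full_pairs_def)
    fix x y assume x: "x \<in> full_pairs C W0" "y \<in> level C 2" "y < x"
    have "p \<in> W0" if p: "p \<in># y" for p
    proof -
      obtain q where "q \<in># x" "p \<le> q" using mset_less_bound[OF x(3) p] by blast
      moreover have "p \<in> ?V" using x(2) p by (auto simp: level_def)
      ultimately show ?thesis using W0(1) x(1) unfolding init_def full_pairs_def
        by (cases "p = q") auto
    qed
    then show "y \<in> full_pairs C W0" using x(2) by (auto simp: full_pairs_def)
  qed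
  moreover have "card S \<le> card (full_pairs C W0)"
  proof -
    have "A \<subseteq> full_pairs C W" using A by (auto simp: full_pairs_def W_def)
    then have "card A \<le> card (full_pairs C W)"
      by (intro card_mono finite_subset[OF _ finite_multisets_of_size[OF W(1), of 2]])
        (auto simp: full_pairs_def multisets_of_size_def level_def)
    then show ?thesis using cd turan[OF C W W0] by linarith
  qed
  ultimately have "S \<subseteq> full_pairs C W0" using S init_card_subset by blast
  then have "shadow S \<subseteq> (\<lambda>q. {#q#}) ` W0"
  proof -
    assume sub: "S \<subseteq> full_pairs C W0"
    show ?thesis
    proof
      fix G assume "G \<in> shadow S"
      then obtain q where q: "add_mset q G \<in> full_pairs C W0" using sub by (auto simp: shadow_def)
      then have "size G = 1" by (auto simp: full_pairs_def level_def)
      then obtain p where "G = {#p#}" by (metis size_1_singleton_mset)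
      then show "G \<in> (\<lambda>q. {#q#}) ` W0" using q by (auto simp: full_pairs_def)
    qed
  qed
  then have "card (shadow S) \<le> card ((\<lambda>q. {#q#}) ` W0)"
    using W0(1) by (intro card_mono) (auto simp: init_def)
  also have "\<dots> \<le> card W" using W0 card_image_le[of W0] by (simp add: init_def)
  also have "card W = card ((\<lambda>q. {#q#}) ` W)" by (intro card_image[symmetric]) (simp add: inj_on_def)
  also have "\<dots> \<le> card (shadow A)"
  proof (intro card_mono finite_shadow A subsetI)
    fix G assume "G \<in> (\<lambda>q. {#q#}) ` W"
    then obtain m q where m: "m \<in> A" "q \<in># m" "G = {#q#}" by (auto simp: W_def)
    have "size (m - {#q#}) = 1" using m A by (auto simp: level_def size_Diff_singleton)
    then obtain p where "m - {#q#} = {#p#}" by (metis size_1_singleton_mset)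
    then have "add_mset p G = m" using m by (metis add_mset_commute insert_DiffM)
    then show "G \<in> shadow A" using m by (auto simp: shadow_def)
  qed
  finally show ?thesis .
qed

lemma shadow_min_1:
  assumes A: "finite A" "A \<subseteq> level C 1" and S: "init (level C 1) S" and cd: "card S \<le> card A"
  shows "card (shadow S) \<le> card (shadow A)"
proof (cases "S = {}")
  case False
  then have "A \<noteq> {}" using cd S by (auto simp: init_def)
  then obtain m where m: "m \<in> A" by blast
  then have "size m = 1" using A by (auto simp: level_def)
  then obtain q where "m = {#q#}" by (metis size_1_singleton_mset)
  then have "{{#}} \<subseteq> shadow A" using m by (auto simp: shadow_def)
  moreover have "shadow S \<subseteq> {{#}}" using S by (auto simp: shadow_def init_def level_def)
  ultimately have "shadow S \<subseteq> shadow A" by blast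
  then show ?thesis using A by (intro card_mono finite_shadow)
qed (simp add: shadow_def)

end

section \<open>Sets of size at least three: the critical configuration\<close>

text \<open>A hypothetical minimal family that is not an initial segment. With \<open>z\<close> the top variable of its
  largest member, the gap consists of the missing sets below \<open>z\<close>. By compression a set in the gap
  shares neither a variable nor a missing colour with any member containing \<open>z\<close>, in particular with the
  smallest such set \<open>V\<close>, which consists of \<open>z\<close> and of the first variables \<open>E\<close> of the smallest colours.\<close>

locale critical = cyclic +
  fixes C :: "nat set" and k :: nat and B :: "nat multiset set"
  assumes C: "C \<subseteq> {..<n}" and k: "3 \<le> k"
    and minimal: "minimal_family C k B"
    and smaller: "\<And>c. c \<in> C \<Longrightarrow> shadow_min (C - {c})"
    and not_init: "\<not> init (level C k) B"
begin

abbreviation "L \<equiv> level C k"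

lemma B_fin: "finite B" and B_L: "B \<subseteq> L"
  using minimal by (auto simp: minimal_family_def)

lemma C_fin: "finite C"
  using C finite_subset by blast

lemma mod_C: "d \<in> C \<Longrightarrow> d mod n = d" "d \<in> C \<Longrightarrow> d < n"
  using C by auto

lemma closed_part: "F \<in> B \<Longrightarrow> G \<in> L \<Longrightarrow> G < F \<Longrightarrow> c \<in> C \<Longrightarrow> part c G = part c F \<Longrightarrow> G \<in> B"
  using minimal_family_closed[OF minimal smaller] cyclic_shadow_init[of "C - {c}"] C by blast

lemma closed_elem:
  assumes "F \<in> B" "G \<in> L" "G < F" "q \<in># F" "q \<in># G"
  shows "G \<in> B"
proof (rule closed_part[OF assms(1-3)])
  show "part (q mod n) G = part (q mod n) F" using part_shared assms B_L by (metis subsetD)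
  show "q mod n \<in> C" using assms(2,5) level_col col_I by blast
qed

lemma closed_miss:
  assumes "F \<in> B" "G \<in> L" "G < F" "d \<in> C" "d \<notin> col F" "d \<notin> col G"
  shows "G \<in> B"
  using closed_part[OF assms(1-4)] part_missing assms(5,6) by simp

definition "v = Max B"
definition "z = Max (set_mset v)"
definition "c = z mod n"
definition "u = (LEAST w. w \<in> L - B)"

lemma B_ne: "B \<noteq> {}"
  using not_init by (auto simp: init_def)

lemma v_B: "v \<in> B" and v_max: "a \<in> B \<Longrightarrow> a \<le> v"
  using B_ne B_fin by (auto simp: v_def)

lemma v_L: "v \<in> L"
  using v_B B_L by blast

lemma size_L: "w \<in> L \<Longrightarrow> size w = k"
  by (simp add: level_def)

lemma v_ne: "v \<noteq> {#}"
  using size_L[OF v_L] k by auto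

lemma z_v: "z \<in># v" and z_max: "q \<in># v \<Longrightarrow> q \<le> z"
  using v_ne by (auto simp: z_def)

lemma c_C: "c \<in> C"
  using level_col[OF v_L] col_I[OF z_v] by (auto simp: c_def)

lemma u_missing: "u \<in> L" "u \<notin> B" and u_least: "w \<in> L \<Longrightarrow> w < u \<Longrightarrow> w \<in> B" and u_less: "u < v"
proof -
  obtain x y where xy: "x \<in> B" "y \<in> L" "y < x" "y \<notin> B" using not_init B_fin B_L by (auto simp: init_def)
  then have y: "y \<in> L - B" by blast
  then have u: "u \<in> L - B" unfolding u_def by (rule LeastI)
  have uy: "u \<le> y" unfolding u_def using y by (rule Least_le)
  show "u \<in> L" "u \<notin> B" using u by auto
  show "u < v" using uy xy v_max[OF xy(1)] by order
  show "w \<in> B" if "w \<in> L" "w < u" for w using that not_less_Least[of w "\<lambda>w. w \<in> L - B"] by (auto simp: u_def)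
qed

text \<open>By \<open>gapI\<close> this contains every missing set below \<open>v\<close>. The
  description by \<open>z\<close> alone allows modified sets to be checked variable by
  variable.\<close>

definition gap :: "nat multiset set" where
  "gap = {w \<in> L - B. \<forall>q\<in>#w. q < z}"

lemma gapI: "w \<in> L \<Longrightarrow> w \<notin> B \<Longrightarrow> w < v \<Longrightarrow> w \<in> gap"
proof -
  assume w: "w \<in> L" "w \<notin> B" "w < v"
  have "z \<notin># w" using closed_elem[OF v_B w(1,3) z_v] w(2) by blast
  moreover have "q \<le> z" if "q \<in># w" for q
    using mset_less_bound[OF w(3) that] z_max by (meson order_trans)
  ultimately show "w \<in> gap" using w by (auto simp: gap_def le_less)
qed

lemma less_z: "(\<And>q. q \<in># w \<Longrightarrow> q < z) \<Longrightarrow> z \<in># F \<Longrightarrow> w < F"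
  using ex_gt_imp_less_multiset by blast

lemma u_gap: "u \<in> gap"
  using gapI u_missing u_less by blast

lemma gap_L: "w \<in> gap \<Longrightarrow> w \<in> L" "w \<in> gap \<Longrightarrow> w \<notin> B" "w \<in> gap \<Longrightarrow> q \<in># w \<Longrightarrow> q < z"
  by (auto simp: gap_def)

lemma gap_disjoint: "w \<in> gap \<Longrightarrow> F \<in> B \<Longrightarrow> z \<in># F \<Longrightarrow> q \<in># w \<Longrightarrow> q \<notin># F"
  using closed_elem less_z gap_L by meson

lemma gap_cover: "w \<in> gap \<Longrightarrow> F \<in> B \<Longrightarrow> z \<in># F \<Longrightarrow> d \<in> C \<Longrightarrow> d \<notin> col F \<Longrightarrow> d \<in> col w"
  using closed_miss less_z gap_L by meson

text \<open>If \<open>w'\<close> were a member, compression would turn the smaller set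
  \<open>w\<close> into a member as well.\<close>

lemma gap_upward:
  assumes "w \<in> gap" "w' \<in> L" "w < w'" "\<And>q. q \<in># w' \<Longrightarrow> q < z"
    and "(\<exists>q. q \<in># w \<and> q \<in># w') \<or> (\<exists>d\<in>C. d \<notin> col w \<and> d \<notin> col w')"
  shows "w' \<in> gap"
proof -
  have "w' \<notin> B" using closed_elem closed_miss assms gap_L by meson
  then show ?thesis using assms(2,4) by (simp add: gap_def)
qed

definition "V = (LEAST w. w \<in> L \<and> z \<in># w)"
definition "E = set_mset V - {z}"

lemma V_L: "V \<in> L" and z_V: "z \<in># V" and V_least: "w \<in> L \<Longrightarrow> z \<in># w \<Longrightarrow> V \<le> w"
proof -
  have "v \<in> L \<and> z \<in># v" using v_L z_v by simp
  then have "V \<in> L \<and> z \<in># V" unfolding V_def by (rule LeastI)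
  then show "V \<in> L" "z \<in># V" by auto
  show "w \<in> L \<Longrightarrow> z \<in># w \<Longrightarrow> V \<le> w" unfolding V_def by (rule Least_le) simp
qed

lemma V_B: "V \<in> B"
  using V_least[OF v_L z_v] closed_elem[OF v_B V_L _ z_v z_V] v_B by (cases "V = v") auto

lemma E_not_c: "e \<in> E \<Longrightarrow> e mod n \<noteq> c"
  using level_unique[OF V_L _ z_V] by (auto simp: E_def c_def)

text \<open>Otherwise replacing \<open>e\<close> by \<open>e'\<close> would give a smaller set of
  the level that still contains \<open>z\<close>, against the choice of \<open>V\<close>.\<close>

lemma V_swap:
  assumes "e \<in> E" "e' mod n \<in> C" "e' mod n = e mod n \<or> e' mod n \<notin> col V"
  shows "e \<le> e'"
proof (rule ccontr)
  assume "\<not> e \<le> e'"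
  have e: "e \<in># V" "e \<noteq> z" using assms(1) by (auto simp: E_def)
  then have V: "add_mset e (V - {#e#}) = V" by simp
  have "add_mset e' (V - {#e#}) < add_mset e (V - {#e#})"
    using \<open>\<not> e \<le> e'\<close> by (intro add_mset_lt_left_lt) simp
  then have "add_mset e' (V - {#e#}) < V" unfolding V .
  moreover have "z \<in># add_mset e' (V - {#e#})" using z_V e(2) by (simp add: in_diff_count)
  ultimately show False using V_least[OF level_swap(1)[OF V_L e(1) assms(2,3)]] by simp
qed

lemma E_small: "e \<in> E \<Longrightarrow> e < n" "e \<in> E \<Longrightarrow> e \<in> C"
proof -
  assume e: "e \<in> E"
  then have eC: "e mod n \<in> C" using level_col[OF V_L] col_I[of e V] by (auto simp: E_def)
  then have "e \<le> e mod n" using V_swap[OF e, of "e mod n"] by simp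
  then show "e < n" using n_pos by (metis le_less_trans mod_less_divisor)
  then show "e \<in> C" using eC by simp
qed

lemma col_V: "col V = insert c E"
proof -
  have "set_mset V = insert z E" using z_V by (auto simp: E_def)
  then have "col V = insert c ((\<lambda>q. q mod n) ` E)" by (simp add: col_def c_def)
  also have "(\<lambda>q. q mod n) ` E = E" using E_small(1) by force
  finally show ?thesis .
qed

lemma c_notin_E: "c \<notin> E"
  using E_not_c mod_C(1)[OF c_C] by auto

lemma E_down: "e \<in> E \<Longrightarrow> d \<in> C \<Longrightarrow> d \<noteq> c \<Longrightarrow> d < e \<Longrightarrow> d \<in> E"
  using V_swap[of e d] mod_C(1)[of d] col_V by auto

lemma card_E: "card E = k - 1" and fin_E: "finite E"
proof -
  show f: "finite E" by (simp add: E_def)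
  have "Suc (card E) = k" using level_col[OF V_L] c_notin_E f by (simp add: col_V)
  then show "card E = k - 1" by linarith
qed

lemma E_ne: "E \<noteq> {}"
  using card_E k by auto

lemma gap_E: "w \<in> gap \<Longrightarrow> e \<in> E \<Longrightarrow> e \<notin># w"
  using gap_disjoint[OF _ V_B z_V] by (auto simp: E_def)

lemma gap_D: "w \<in> gap \<Longrightarrow> d \<in> C \<Longrightarrow> d \<noteq> c \<Longrightarrow> d \<notin> E \<Longrightarrow> d \<in> col w"
  using gap_cover[OF _ V_B z_V] col_V by auto

text \<open>The gap is closed under going up, but never meets \<open>E\<close>.\<close>

lemma gap_push:
  assumes "w \<in> gap" "w' \<in> L" "w < w'" "\<And>q. q \<in># w' \<Longrightarrow> q < z" "f \<in> E" "f \<in># w'"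
    and "(\<exists>q. q \<in># w \<and> q \<in># w') \<or> (\<exists>d\<in>C. d \<notin> col w \<and> d \<notin> col w')"
  shows False
  using gap_upward[OF assms(1-4,7)] gap_E assms(5,6) by blast

text \<open>If \<open>z \<le> f < n\<close>, then \<open>z\<close> is the number \<open>c\<close>,
  and every variable of a gap set is a colour below \<open>f\<close> different from
  \<open>c\<close>. By \<open>E_down\<close> it would lie in \<open>E\<close>, which the gap
  avoids.\<close>

lemma less_z_E: "f \<in> E \<Longrightarrow> w \<in> gap \<Longrightarrow> f < z"
proof -
  assume f: "f \<in> E" and w: "w \<in> gap"
  have k1: "size w = k" using size_L gap_L(1)[OF w] by blast
  show "f < z"
  proof (rule ccontr)
    assume "\<not> f < z"
    then have zn: "z < n" using E_small(1)[OF f] by simp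
    have "q \<in> {..<n} - E" if "q \<in># w" for q using gap_L(3)[OF w that] gap_E[OF w] that zn by auto
    then have col_eq: "col w = set_mset w" using mod_less by (force simp: col_def)
    have sub: "col w \<subseteq> C - E" using col_eq level_col[OF gap_L(1)[OF w]] gap_E[OF w] by auto
    have zc: "z = c" using zn by (simp add: c_def)
    then have "q \<in> E" if "q \<in># w" for q
      using E_down[OF f, of q] sub that col_eq gap_L(3)[OF w that] \<open>\<not> f < z\<close> by auto
    then show False using gap_E[OF w] k1 k by (metis multiset_nonemptyE not_numeral_le_zero size_empty)
  qed
qed

text \<open>If \<open>e \<noteq> c\<close> is charged, then all of \<open>E\<close> lies below
  \<open>e\<close>, so \<open>w\<close> has all colours but \<open>c\<close>; it cannot have
  \<open>c\<close> as well, because \<open>E\<close> and \<open>c\<close> already make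
  \<open>k\<close> colours different from \<open>e\<close>. Now \<open>e\<close> is raised and the
  variable \<open>p\<close> of some colour \<open>f\<close> in \<open>E\<close> is lowered to
  \<open>f\<close>. The result is larger, still lacks \<open>c\<close>, and meets \<open>E\<close>,
  contrary to \<open>gap_push\<close>.\<close>

lemma new_at_gap: 
  assumes w: "w \<in> gap"
  shows "new_at C w \<subseteq> {c}"
proof
  fix e assume e: "e \<in> new_at C w"
  have wL: "w \<in> L" using gap_L(1)[OF w] .
  have e': "e \<in># w" "e < n" "\<And>d. d \<in> C \<Longrightarrow> d < e \<Longrightarrow> d \<in> col w" using e by (auto simp: new_at_def)
  have "e \<in> C" using level_col[OF wL] col_I[OF e'(1)] e'(2) by auto
  have "e \<notin> E" using gap_E[OF w] e'(1) by blast
  show "e \<in> {c}"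
  proof (rule ccontr)
    assume "e \<notin> {c}"
    have fe: "f < e" if "f \<in> E" for f
      using E_down[OF that \<open>e \<in> C\<close>] \<open>e \<notin> {c}\<close> \<open>e \<notin> E\<close> that by (metis insertI1 linorder_neqE_nat)
    have all: "d \<in> col w" if "d \<in> C" "d \<noteq> c" for d
      using gap_D[OF w that] e'(3)[OF that(1)] fe by blast
    have cw: "c \<notin> col w"
    proof
      assume "c \<in> col w"
      then have "C \<subseteq> col w" using all by blast
      then have "card C = k" using level_col[OF wL] by (metis subset_antisym)
      moreover have "insert c E \<subseteq> C - {e}" using c_C E_small(2) \<open>e \<notin> {c}\<close> \<open>e \<notin> E\<close> by auto
      then have "card (insert c E) \<le> card (C - {e})" using C_fin by (intro card_mono) auto
      then have "k \<le> card C - 1" using card_E fin_E c_notin_E k \<open>e \<in> C\<close> by simp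
      ultimately show False using k by simp
    qed
    then have ec: "e < c" using e'(3)[OF c_C] \<open>e \<notin> {c}\<close> by (metis insertI1 linorder_neqE_nat)
    obtain f where f: "f \<in> E" using E_ne by blast
    have fC: "f \<in> C" "f \<noteq> c" "f mod n = f" using E_small[OF f] f c_notin_E by auto
    obtain p where p: "p \<in># w" "p mod n = f" using col_elem[OF all[OF fC(1,2)]] by blast
    define i where "i = p div n"
    have pi: "p = n * i + f" using p(2) by (metis i_def mult_div_mod_eq)
    have i: "0 < i" using gap_E[OF w f] p(1) pi by (metis add_0 mult_0_right neq0_conv)
    define j where "j = z div n"
    have zj: "z = n * j + c" by (simp add: j_def c_def)
    have pz: "p < z" using gap_L(3)[OF w p(1)] .
    have "i \<le> j"
    proof (rule ccontr)
      assume "\<not> i \<le> j"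
      then have "n * Suc j \<le> n * i" by (intro mult_le_mono2) simp
      then show False using pz pi zj mod_C(2)[OF c_C] by simp
    qed
    then have ij: "n * i \<le> n * j" by simp
    \<comment> \<open>The variable of colour \<open>e\<close> with the index of \<open>p\<close>: it
      lies above \<open>p\<close> because \<open>f < e\<close>, and below \<open>z\<close> because
      \<open>z\<close> has at least this index and \<open>e < c\<close>.\<close>
    define e1 where "e1 = n * i + e"
    have e1: "e1 mod n = e" "p < e1" "e < e1" "f < e1"
      using e'(2) fe[OF f] pi i n_pos by (auto simp: e1_def)
    have e1z: "e1 < z" unfolding e1_def zj using ij ec by linarith
    define w1 where "w1 = add_mset e1 (w - {#e#})"
    define w2 where "w2 = add_mset f (w1 - {#p#})"
    have "p \<noteq> e" using p(2) fe[OF f] e'(2) by auto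
    have w1: "w1 \<in> L" "col w1 = col w"
      unfolding w1_def using level_swap[OF wL e'(1), of e1] e1(1) \<open>e \<in> C\<close> e'(2) col_I[OF e'(1)] by auto
    have p1: "p \<in># w1" using p(1) \<open>p \<noteq> e\<close> by (simp add: w1_def in_diff_count)
    have w2: "w2 \<in> L" "col w2 = col w"
      unfolding w2_def using level_swap[OF w1(1) p1, of f] fC p w1(2) col_I[OF p(1)] by auto
    have "count w e1 = 0"
    proof (rule ccontr)
      assume "count w e1 \<noteq> 0"
      then have "e1 \<in># w" by (intro count_inI) simp
      then show False using level_unique[OF wL _ e'(1), of e1] e1 e'(2) by simp
    qed
    then have "w < w2"
      using e1 by (intro mset_lessI[of _ e1]) (auto simp: w1_def w2_def)
    moreover have "q < z" if "q \<in># w2" for q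
      using that gap_L(3)[OF w, of q] e1z less_z_E[OF f w] by (auto simp: w1_def w2_def dest!: in_diffD)
    moreover have "f \<in># w2" by (simp add: w2_def)
    ultimately show False using gap_push[OF w w2(1) _ _ f] cw w2(2) c_C by blast
  qed
qed

text \<open>Colours in a set of the level are distinct, so it has \<open>k\<close> different
  variables. After two of them have been touched, the third is a variable in common with the old
  set.\<close>

lemma third_element:
  assumes "w \<in> L" 
  obtains s where "s \<in># w" "s \<noteq> x" "s \<noteq> y"
proof -
  have "card (set_mset w) = k"
    using level_col[OF assms] level_unique[OF assms] card_image[of "\<lambda>q. q mod n" "set_mset w"]
    by (auto simp: col_def inj_on_def)
  then have "\<not> set_mset w \<subseteq> {x, y}" using k card_mono[of "{x, y}" "set_mset w"] card_insert_le_m1[of 2 "{y}" x]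
    by fastforce
  then show ?thesis using that by blast
qed

text \<open>Some element of \<open>w2\<close> below the deciding position \<open>x\<close> is
  replaced by \<open>f\<close>. The result still exceeds \<open>w1\<close> and shares a variable
  with it, so it would be a gap set that meets \<open>E\<close>.\<close>

lemma new_at_unique_case1:
  assumes w: "w1 \<in> gap" "w2 \<in> gap" and c1: "c \<in># w1" and c2: "c \<in># w2" "\<And>d. d \<in> C \<Longrightarrow> d < c \<Longrightarrow> d \<in> col w2"
    and x: "count w1 x < count w2 x" "\<And>y. x < y \<Longrightarrow> count w1 y = count w2 y"
    and f: "f \<in> E" "\<And>p. p \<in># w2 \<Longrightarrow> x \<le> p \<Longrightarrow> p mod n \<noteq> f"
  shows False
proof -
  have L1: "w1 \<in> L" and L2: "w2 \<in> L" using w gap_L by auto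
  have x2: "x \<in># w2" using x(1) by (intro count_inI) simp
  have x1: "x \<notin># w1" using x(1) level_count[OF L2, of x] by (simp add: not_in_iff)
  have cn: "c < n" "c mod n = c" using mod_C[OF c_C] by auto
  have fC: "f \<in> C" "f \<noteq> c" "f mod n = f" "f < n" using E_small[OF f(1)] f(1) c_notin_E by auto
  have xc: "x \<noteq> c" using x1 c1 by auto
  have f2: "f \<notin># w2" using gap_E[OF w(2) f(1)] .
  \<comment> \<open>Otherwise \<open>x\<close> would be an index-0 variable below \<open>f\<close>,
    hence itself in \<open>E\<close>.\<close>
  have fx: "f < x"
  proof (rule ccontr)
    assume "\<not> f < x"
    moreover have "x \<noteq> f" using f2 x2 by auto
    ultimately have "x < f" by simp
    then have "x mod n = x" using fC by simp
    then have "x \<in> C" using col_I[OF x2] level_col[OF L2] by auto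
    then have "x \<in> E" using E_down[OF f(1)] xc \<open>x < f\<close> by blast
    then show False using gap_E[OF w(2)] x2 by blast
  qed
  have push: False if p: "p \<in># w2" "p < x \<or> p = c \<and> c < x" "p mod n = f \<or> f \<notin> col w2"
    and s: "s \<in># w1" "s \<in># w2" "s \<noteq> p" for p s
  proof -
    let ?w = "add_mset f (w2 - {#p#})"
    have wL: "?w \<in> L" using level_swap(1)[OF L2 p(1), of f] fC p(3) by auto
    have px: "p < x" using p(2) by auto
    have "w1 < ?w" using x px fx by (intro mset_lessI[of _ x]) auto
    moreover have "q < z" if "q \<in># ?w" for q
      using that gap_L(3)[OF w(2), of q] less_z_E[OF f(1) w(2)] by (auto dest!: in_diffD)
    moreover have "s \<in># ?w" using s by (simp add: in_diff_count)
    ultimately show False using gap_push[OF w(1) wL _ _ f(1)] s(1) by auto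
  qed
  show False
  proof (cases "f \<in> col w2")
    case True
    then obtain p where p: "p \<in># w2" "p mod n = f" using col_elem by blast
    then have "p < x" using f(2)[OF p(1)] by (auto simp: not_le[symmetric])
    moreover have "c \<noteq> p" using p(2) fC cn by auto
    ultimately show False using push[of p c] p c1 c2(1) by blast
  next
    case nf: False
    show False
    proof (cases "\<exists>p\<in>#w2. p < x \<and> p \<noteq> c")
      case True
      then show False using push[of _ c] nf c1 c2(1) by blast
    next
      case False
      \<comment> \<open>Here \<open>c\<close> is the only variable of \<open>w2\<close> that can lie
        below \<open>x\<close>, so it has to be given up; any third variable lies above
        \<open>x\<close> and is therefore shared with \<open>w1\<close>.\<close>
      have fc: "c < f" using c2(2)[OF fC(1)] nf fC(2) by (metis linorder_neqE_nat)
      have cx: "c < x"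
      proof (rule ccontr)
        assume "\<not> c < x"
        then have "x < c" using xc by simp
        then show False using fc fx by simp
      qed
      obtain s where s: "s \<in># w2" "s \<noteq> c" "s \<noteq> x" using third_element[OF L2] by metis
      then have "x < s" using False by (metis linorder_neqE_nat)
      then have "s \<in># w1" using x(2) s(1) by (metis count_eq_zero_iff)
      then show False using push[of c s] c2(1) cx nf s by blast
    qed
  qed
qed

text \<open>Now \<open>w2\<close> has all colours of \<open>E\<close> and \<open>c\<close>, so these
  exhaust \<open>C\<close>, and \<open>w1\<close> has all colours too. With \<open>f\<close> the
  colour of \<open>x\<close>, the variable \<open>p\<close> of colour \<open>f\<close> in
  \<open>w1\<close> is lowered to \<open>f\<close> and \<open>c\<close> is raised just past
  \<open>p\<close>. This gives a larger set that shares a third variable with \<open>w1\<close> but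
  meets \<open>E\<close>.\<close>

lemma new_at_unique_case2:
  assumes w: "w1 \<in> gap" "w2 \<in> gap" and c1: "c \<in># w1" and c2: "c \<in># w2"
    and x: "count w1 x < count w2 x" "\<And>y. x < y \<Longrightarrow> count w1 y = count w2 y"
    and all: "\<And>f. f \<in> E \<Longrightarrow> \<exists>p. p \<in># w2 \<and> x \<le> p \<and> p mod n = f"
  shows False
proof -
  have L1: "w1 \<in> L" and L2: "w2 \<in> L" using w gap_L by auto
  have x2: "x \<in># w2" using x(1) by (intro count_inI) simp
  have x1: "x \<notin># w1" using x(1) level_count[OF L2, of x] by (simp add: not_in_iff)
  have cn: "c < n" "c mod n = c" using mod_C[OF c_C] by auto
  have xc: "x \<noteq> c" using x1 c1 by auto
  have "E \<subseteq> col w2" using all by (auto simp: col_def)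
  moreover have "c \<in> col w2" using col_I[OF c2] cn by simp
  ultimately have "insert c E \<subseteq> col w2" by simp
  moreover have "card (insert c E) = card (col w2)"
    using level_col[OF L2] card_E fin_E c_notin_E k by simp
  ultimately have col2: "col w2 = insert c E" by (metis card_subset_eq finite_col)
  have "C \<subseteq> insert c E" using gap_D[OF w(2)] col2 by auto
  then have CE: "C = insert c E" using c_C E_small(2) by auto
  have col1: "col w1 = C"
    using level_col[OF L1] level_col[OF L2] CE col2 C_fin by (metis card_subset_eq)
  define f where "f = x mod n"
  have fE: "f \<in> E"
  proof -
    have "f \<noteq> c" using level_unique[OF L2 x2 c2] xc cn by (auto simp: f_def)
    then show ?thesis using col_I[OF x2] col2 by (auto simp: f_def)
  qed
  then have fC: "f \<in> C" "f \<noteq> c" "f mod n = f" "f < n" using E_small[OF fE] c_notin_E by auto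
  obtain p where p: "p \<in># w1" "p mod n = f" using col1 fC(1) col_elem by blast
  have px: "p < x"
  proof (rule ccontr)
    assume "\<not> p < x"
    moreover have "p \<noteq> x" using p x1 by auto
    ultimately have "x < p" by simp
    then have "p \<in># w2" using x(2) p(1) by (metis count_eq_zero_iff)
    then show False using level_unique[OF L2 _ x2, of p] p(2) \<open>p \<noteq> x\<close> by (simp add: f_def)
  qed
  define i where "i = p div n"
  define j where "j = x div n"
  have pi: "p = n * i + f" using p(2) by (metis i_def mult_div_mod_eq)
  have xj: "x = n * j + f" by (simp add: j_def f_def)
  have "p \<noteq> f" using gap_E[OF w(1) fE] p(1) by auto
  then have i: "0 < i" using pi by (cases i) auto
  have ij: "n * Suc i \<le> n * j"
  proof (rule mult_le_mono2)
    show "Suc i \<le> j" using px pi xj by (metis Suc_leI add_less_cancel_right mult_less_cancel1)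
  qed
  \<comment> \<open>The first variable of colour \<open>c\<close> above \<open>p\<close>. It is
    below \<open>x\<close> because \<open>x\<close> has the colour of \<open>p\<close> and a greater
    index.\<close>
  define q where "q = (if f < c then n * i + c else n * Suc i + c)"
  have q0: "q mod n = c" using cn(2) by (simp add: q_def del: mult_Suc_right)
  have q: "p < q" "q < x" "c < q" "f < q"
    using cn fC pi xj ij i n_pos by (auto simp: q_def)
  have qz: "q < z" using q(2) gap_L(3)[OF w(2) x2] by simp
  let ?a = "add_mset f (w1 - {#p#})"
  let ?w = "add_mset q (?a - {#c#})"
  have a: "?a \<in> L" "col ?a = col w1"
    using level_swap[OF L1 p(1), of f] fC p col_I[OF p(1)] by auto
  have ca: "c \<in># ?a" using c1 p(2) fC(2) cn by (auto simp: in_diff_count)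
  have wL: "?w \<in> L" using level_swap(1)[OF a(1) ca, of q] q0 c_C cn by simp
  have "count w1 q = 0"
  proof (rule ccontr)
    assume "count w1 q \<noteq> 0"
    then have "q \<in># w1" by (intro count_inI) simp
    then show False using level_unique[OF L1 _ c1, of q] q0 q cn by simp
  qed
  then have "w1 < ?w" using q by (intro mset_lessI[of _ q]) auto
  moreover have "y < z" if "y \<in># ?w" for y
    using that gap_L(3)[OF w(1), of y] less_z_E[OF fE w(1)] qz by (auto dest!: in_diffD)
  moreover have "f \<in># ?w" using fC(2) by (simp add: in_diff_count)
  moreover obtain s where "s \<in># w1" "s \<noteq> p" "s \<noteq> c" using third_element[OF L1] by metis
  then have "s \<in># w1" "s \<in># ?w" by (auto simp: in_diff_count)
  ultimately show False using gap_push[OF w(1) wL _ _ fE] by blast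
qed

lemma new_at_unique:
  assumes w: "w1 \<in> gap" "w2 \<in> gap" and c: "c \<in> new_at C w1" "c \<in> new_at C w2"
  shows "w1 = w2"
proof (rule ccontr)
  have False if w: "a \<in> gap" "b \<in> gap" and c: "c \<in> new_at C a" "c \<in> new_at C b" and lt: "a < b" for a b
  proof -
    obtain x where x: "count a x < count b x" "\<And>y. x < y \<Longrightarrow> count a y = count b y"
      using lt by (rule mset_lessE) blast
    have ca: "c \<in># a" and cb: "c \<in># b" "\<And>d. d \<in> C \<Longrightarrow> d < c \<Longrightarrow> d \<in> col b"
      using c by (auto simp: new_at_def)
    show False
    proof (cases "\<exists>f\<in>E. \<forall>p. p \<in># b \<longrightarrow> x \<le> p \<longrightarrow> p mod n \<noteq> f")
      case True
      then obtain f where f: "f \<in> E" "\<And>p. p \<in># b \<Longrightarrow> x \<le> p \<Longrightarrow> p mod n \<noteq> f" by blast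
      from new_at_unique_case1[OF w ca cb x f] show False .
    next
      case False
      then have all: "\<And>f. f \<in> E \<Longrightarrow> \<exists>p. p \<in># b \<and> x \<le> p \<and> p mod n = f" by blast
      from new_at_unique_case2[OF w ca cb(1) x all] show False .
    qed
  qed
  moreover assume "w1 \<noteq> w2"
  ultimately show False using w c by (metis linorder_neqE)
qed


lemma card_new_at_gap: "w \<in> gap \<Longrightarrow> card (new_at C w) \<le> 1"
  using card_mono[OF _ new_at_gap] by fastforce

text \<open>The last member \<open>v\<close> could be exchanged for the first gap \<open>u\<close>
  as soon as \<open>u\<close> costs no more than \<open>v\<close>. Since gaps cost at most 1, the
  cost of \<open>u\<close> is 1 and that of \<open>v\<close> is 0.\<close>

lemma exchange_single: "\<not> card (new_at C u) \<le> card (new_at C v)"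
proof
  assume le: "card (new_at C u) \<le> card (new_at C v)"
  show False
  proof (rule minimal_family_exchange[OF minimal, of "{v}" "{u}"])
    show "{u} \<subseteq> level C k - B" using u_missing by simp
    show "a < x" if "a \<in> B - {v}" "x \<in> {v}" for a x using that v_max[of a] by (simp add: le_less)
    show "w \<in> B - {v} \<union> {u}" if "q \<in> {u}" "w \<in> level C k" "w < q" for q w
      using that u_least u_less by auto
    show "(\<Sum>q\<in>{u}. card (new_shadow (level C k) q)) \<le> (\<Sum>x\<in>{v}. card (new_shadow (level C k) x))"
      using le card_new_shadow[OF C] u_missing(1) v_L by simp
  qed (use v_B u_less in auto)
qed

lemma new_at_v: "new_at C v = {}" and new_at_u: "c \<in> new_at C u"
proof -
  have "card (new_at C v) = 0" "card (new_at C u) \<noteq> 0"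
    using exchange_single card_new_at_gap[OF u_gap] by linarith+
  then show "new_at C v = {}" "c \<in> new_at C u" using new_at_gap[OF u_gap] by auto
qed

lemma c_u: "c \<in># u" and u_below_c: "d \<in> C \<Longrightarrow> d < c \<Longrightarrow> d \<in> col u"
  using new_at_u by (auto simp: new_at_def)

text \<open>Otherwise \<open>u\<close> misses a colour \<open>m\<close>, and by
  \<open>gap_cover\<close> every member containing \<open>z\<close> has this colour. From
  \<open>v\<close> a smaller set with \<open>z\<close> but without colour \<open>m\<close> is built,
  using the least element \<open>e\<close> of \<open>E\<close> or a colour \<open>f\<close> missing
  in \<open>v\<close>, or both.\<close>

lemma all_colors: "card C = k"
proof (rule ccontr)
  assume "card C \<noteq> k"
  have "k \<le> card C" using level_col[OF v_L] card_mono[OF C_fin] by metis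
  then have kC: "k < card C" using \<open>card C \<noteq> k\<close> by simp
  have ex: "\<exists>d\<in>C. d \<notin> col w" if "w \<in> L" for w
    using level_col[OF that] kC card_mono[of "col w" C] by (metis finite_col leD subsetI)
  obtain m where m: "m \<in> C" "m \<notin> col u" using ex u_missing(1) by blast
  have cu: "c \<in> col u" using col_I[OF c_u] mod_C[OF c_C] by simp
  have mE: "m \<in> E" using gap_D[OF u_gap m(1)] m cu by blast
  have cm: "c < m" using u_below_c[OF m(1)] m cu by (metis linorder_neqE_nat)
  have has_m: "m \<in> col F" if "F \<in> B" "z \<in># F" for F
    using gap_cover[OF u_gap that m(1)] m(2) by blast
  obtain f where f: "f \<in> C" "f \<notin> col v" using ex v_L by blast
  have fm: "f \<noteq> m" using has_m[OF v_B z_v] f by blast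
  have fn: "f mod n = f" "f < n" using mod_C[OF f(1)] by auto
  define e where "e = Min E"
  have e: "e \<in> E" "\<And>d. d \<in> E \<Longrightarrow> e \<le> d" using E_ne fin_E by (auto simp: e_def)
  have eC: "e \<in> C" "e mod n = e" "e < n" "e \<noteq> c" using E_small[OF e(1)] e(1) c_notin_E by auto
  have cv: "c \<in> col v" using col_I[OF z_v] by (simp add: c_def)
  \<comment> \<open>Only \<open>c\<close> can precede \<open>e\<close> among the colours of
    \<open>C\<close>, and \<open>v\<close> has colour \<open>c\<close>; so \<open>e\<close> in
    \<open>v\<close> would contribute to the shadow, whereas \<open>v\<close> costs nothing.\<close>
  have e_v: "e \<notin># v"
  proof
    assume "e \<in># v"
    have "d \<in> col v" if "d \<in> C" "d < e" for d
    proof -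
      have "d \<notin> E" using e(2)[of d] that by auto
      then have "d = c" using E_down[OF e(1) that(1) _ that(2)] by blast
      then show ?thesis using cv by simp
    qed
    then have "e \<in> new_at C v" using \<open>e \<in># v\<close> eC by (auto simp: new_at_def)
    then show False using new_at_v by simp
  qed
  have contra: False if "w \<in> L" "z \<in># w" "w < v" "m \<notin> col w" for w
    using has_m closed_elem[OF v_B that(1,3) z_v that(2)] that by blast
  obtain p where p: "p \<in># v" "p mod n = m" using has_m[OF v_B z_v] col_elem by blast
  have pz: "p \<noteq> z" using p(2) cm by (auto simp: c_def)
  have mp: "m \<le> p" using p(2) by (metis mod_less_eq_dividend)
  have less: "add_mset y (v - {#x#}) < v" if "x \<in># v" "y < x" for x y
  proof -
    have "add_mset x (v - {#x#}) = v" using that(1) by simp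
    then show ?thesis using add_mset_lt_left_lt[OF that(2)] by metis
  qed
  show False
  proof (cases "e \<in> col v")
    case False
    then have "m \<noteq> e" using has_m[OF v_B z_v] by blast
    then have "e < p" using e(2)[OF mE] mp by simp
    let ?w = "add_mset e (v - {#p#})"
    show False
    proof (rule contra)
      show "?w \<in> L" using level_swap(1)[OF v_L p(1), of e] eC False by simp
      show "z \<in># ?w" using z_v pz by (simp add: in_diff_count)
      show "?w < v" using less[OF p(1) \<open>e < p\<close>] .
      show "m \<notin> col ?w" using level_swap(2)[OF v_L p(1), of e] eC False p(2) \<open>m \<noteq> e\<close> by simp
    qed
  next
    case True
    then obtain r where r: "r \<in># v" "r mod n = e" using col_elem by blast
    have "r \<noteq> e" using e_v r by auto
    then have "n \<le> r" using r(2) by (metis mod_less not_less)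
    have rz: "r \<noteq> z" using r(2) eC by (auto simp: c_def)
    show False
    proof (cases "m = e")
      case True
      let ?w = "add_mset f (v - {#r#})"
      show False
      proof (rule contra)
        show "?w \<in> L" using level_swap(1)[OF v_L r(1), of f] f fn by simp
        show "z \<in># ?w" using z_v rz by (simp add: in_diff_count)
        show "?w < v" using less[OF r(1)] fn(2) \<open>n \<le> r\<close> by simp
        show "m \<notin> col ?w" using level_swap(2)[OF v_L r(1), of f] f fn fm r(2) True by simp
      qed
    next
      case False
      then have "e < p" using e(2)[OF mE] mp by simp
      let ?a = "add_mset e (v - {#r#})"
      let ?w = "add_mset f (?a - {#p#})"
      have a: "?a \<in> L" "col ?a = col v"
        using level_swap[OF v_L r(1), of e] eC r col_I[OF r(1)] by auto
      have "p \<noteq> r" using p(2) r(2) False by auto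
      then have pa: "p \<in># ?a" using p(1) by (simp add: in_diff_count)
      have fa: "f mod n \<in> C" "f mod n = p mod n \<or> f mod n \<notin> col ?a"
        unfolding a(2) using f fn by simp_all
      show False
      proof (rule contra)
        show "?w \<in> L" by (rule level_swap(1)[OF a(1) pa fa])
        show "z \<in># ?w" using z_v rz pz by (simp add: in_diff_count)
        show "m \<notin> col ?w" unfolding level_swap(2)[OF a(1) pa fa] using fn fm p(2) by simp
        \<comment> \<open>The larger of the two removed variables decides; \<open>e\<close> is below
          both, and \<open>f < n \<le> r\<close>.\<close>
        show "?w < v"
          using fn(2) \<open>n \<le> r\<close> \<open>e < p\<close> \<open>p \<noteq> r\<close> p(1) r(1) \<open>r \<noteq> e\<close> count_greater_zero_iff[of v r] count_greater_zero_iff[of v p]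
          by (cases "p < r") (intro mset_lessI[of _ r] mset_lessI[of _ p]; auto)+
      qed
    qed
  qed
qed

lemma col_full: "w \<in> L \<Longrightarrow> col w = C"
  using level_col all_colors C_fin by (metis card_subset_eq)

text \<open>When all colours are present, every index-0 variable contributes to the shadow, so
  \<open>v\<close> has none. Lowering the least variable of \<open>v\<close> to index 0 yields a
  member that does contribute; the whole block from it up to \<open>v\<close> is therefore
  exchanged, and its contribution pays for the one gap that costs.\<close>

lemma contradiction: False
proof -
  have no_small: "n \<le> e" if "e \<in># v" for e
  proof (rule ccontr)
    assume "\<not> n \<le> e"
    then have "e \<in> new_at C v" using that col_full[OF v_L] by (auto simp: new_at_def)
    then show False using new_at_v by simp
  qed
  define p where "p = Min (set_mset v)"
  have p: "p \<in># v" "\<And>q. q \<in># v \<Longrightarrow> p \<le> q" using v_ne by (auto simp: p_def)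
  obtain s where s: "s \<in># v" "s \<noteq> z" using third_element[OF v_L] by metis
  have pz: "p < z" using p(2)[OF s(1)] z_max[OF s(1)] s(2) by simp
  define e where "e = p mod n"
  define i where "i = p div n"
  have pi: "p = e + n * i" by (simp add: e_def i_def)
  have en: "e < n" "e mod n = e" using n_pos by (simp_all add: e_def)
  have eC: "e \<in> C" using col_I[OF p(1)] col_full[OF v_L] by (simp add: e_def)
  have "e \<noteq> c" using level_unique[OF v_L p(1) z_v] pz by (auto simp: e_def c_def)
  obtain G k' where G: "v = add_mset p G" "k = Suc k'" "G \<in> level C k'" "p mod n \<notin> col G"
    using level_split[OF v_L p(1)] by metis
  have eG: "e \<notin> col G" using G(4) by (simp add: e_def)
  have colG: "C = insert e (col G)" using col_full[OF v_L] G(1) by (simp add: e_def)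
  have Gp: "p < q" if "q \<in># G" for q
  proof -
    have "p \<le> q" using p(2) G(1) that by simp
    moreover have "p \<noteq> q" using eG col_I[OF that] by (auto simp: e_def)
    ultimately show ?thesis by simp
  qed
  have zG: "z \<in># G" using z_v G(1) pz by auto
  define x where "x t = add_mset (e + n * t) G" for t
  define R' where "R' = x ` {..i}"
  have modx: "(e + n * t) mod n = e" for t using en(2) by simp
  have xL: "x t \<in> L" for t unfolding x_def G(2) level_add using G(3) modx eC eG by simp
  have xz: "z \<in># x t" for t using zG by (simp add: x_def)
  have x_le: "x t \<le> v" if "t \<le> i" for t
    using that G(1) pi by (auto simp: x_def intro!: add_mset_le_left_le)
  have xB: "x t \<in> B" if "t \<le> i" for t
    using x_le[OF that] closed_elem[OF v_B xL _ z_v xz] v_B by (cases "x t = v") auto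
  have injx: "inj_on x A" for A using n_pos by (auto simp: x_def inj_on_def)
  have cardR: "card R' = Suc i" by (simp add: R'_def card_image[OF injx])
  \<comment> \<open>A member between the block and \<open>v\<close> would agree with
    \<open>v\<close> above \<open>p\<close>, hence contain \<open>G\<close>; its remaining variable
    has the only colour left, that of \<open>p\<close>, which puts it into the block.\<close>
  have topR: "a < x t" if a: "a \<in> B - R'" and t: "t \<le> i" for a t
  proof (rule ccontr)
    assume "\<not> a < x t"
    then have xa: "x t \<le> a" by simp
    have aL: "a \<in> L" using a B_L by blast
    have "v = x i" using G(1) pi by (simp add: x_def)
    then have "v \<in> R'" by (auto simp: R'_def)
    then have "a < v" using v_max[of a] a by (auto simp: le_less)
    then obtain y where y: "count a y < count v y" "\<And>q. y < q \<Longrightarrow> count a q = count v q"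
      by (rule mset_lessE) blast
    have yv: "y \<in># v" using y(1) by (intro count_inI) simp
    have "y = p"
    proof (rule ccontr)
      assume "y \<noteq> p"
      then have py: "p < y" using p(2)[OF yv] by simp
      have tp: "e + n * t \<le> p" using pi t by simp
      have "a < x t"
        using y py tp G(1) by (intro mset_lessI[of _ y]) (auto simp: x_def)
      then show False using xa by simp
    qed
    have "G \<subseteq># a"
    proof (rule mset_subset_eqI)
      fix q
      show "count G q \<le> count a q"
      proof (cases "q \<in># G")
        case True
        then have "count a q = count v q" using y(2) Gp \<open>y = p\<close> by blast
        then show ?thesis using G(1) by simp
      qed (simp add: not_in_iff)
    qed
    moreover have "size a = Suc (size G)" using size_L[OF aL] G(2,3) by (simp add: level_def)
    ultimately have "size (a - G) = 1" by (simp add: size_Diff_submset)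
    then obtain r where "a - G = {#r#}" by (metis size_1_singleton_mset)
    then have ar: "a = add_mset r G" using \<open>G \<subseteq># a\<close> by (metis add_mset_add_single subset_mset.diff_add add.commute)
    have "r mod n \<in> C" "r mod n \<notin> col G" using aL unfolding ar G(2) level_add by auto
    then have re: "r mod n = e" using colG by blast
    have "r \<le> p" using \<open>a < v\<close> unfolding ar G(1) by (metis add_mset_lt_left_lt linorder_not_less order_less_asym)
    then have "r div n \<le> i" by (simp add: i_def div_le_mono)
    moreover have "r = e + n * (r div n)" using re by (metis add.commute mult_div_mod_eq)
    ultimately have "a \<in> R'" using ar by (auto simp: R'_def x_def)
    then show False using a by blast
  qed
  \<comment> \<open>The \<open>i + 1\<close> last members \<open>x 0, \<dots>, x i\<close> are exchanged for the first \<open>i + 1\<close> gaps; the sets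
    \<open>y 0, \<dots>, y i\<close> show that there are that many gaps below \<open>z\<close>.\<close>
  obtain H where H: "u = add_mset c H" "H \<in> level C k'" "c \<notin> col H"
    using level_split[OF u_missing(1) c_u] mod_C(1)[OF c_C] G(2) by (metis nat.inject)
  define j where "j = z div n"
  have zj: "z = n * j + c" by (simp add: j_def c_def)
  \<comment> \<open>The variable of colour \<open>e\<close> in \<open>u\<close> occurs in none of
    the members \<open>x 0, ..., x i\<close>, since these contain \<open>z\<close>. Its index
    therefore exceeds \<open>i\<close>, and it lies below \<open>z\<close>.\<close>
  have ij: "Suc i \<le> j"
  proof -
    obtain r where r: "r \<in># u" "r mod n = e" using col_full[OF u_missing(1)] eC col_elem by blast
    define l where "l = r div n"
    have rl: "r = e + n * l" using r(2) by (metis add.commute l_def mult_div_mod_eq)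
    have "\<not> l \<le> i"
    proof
      assume "l \<le> i"
      then have "r \<notin># x l" using gap_disjoint[OF u_gap xB xz r(1)] by blast
      then show False using rl by (simp add: x_def)
    qed
    then have "n * Suc i \<le> n * l" by (intro mult_le_mono2) simp
    moreover have "e + n * l < n * j + c" using gap_L(3)[OF u_gap r(1)] unfolding rl zj .
    ultimately have "n * Suc i < n * Suc j" using mod_C(2)[OF c_C] unfolding mult_Suc_right by linarith
    then show ?thesis using mult_less_cancel1 by (metis Suc_leI Suc_less_SucD)
  qed
  define y where "y t = add_mset (c + n * t) H" for t
  define W where "W = y ` {..i}"
  have mody: "(c + n * t) mod n = c" for t using mod_C(1)[OF c_C] by simp
  have yL: "y t \<in> L" for t unfolding y_def G(2) level_add using H mody c_C by simp
  have y_less: "q < z" if "q \<in># y t" "t \<le> i" for q t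
  proof -
    have "n * t < n * j" using that(2) ij n_pos by simp
    then have "c + n * t < z" using zj by simp
    moreover have "q < z" if "q \<in># H" for q using gap_L(3)[OF u_gap, of q] H(1) that by simp
    ultimately show ?thesis using that(1) by (auto simp: y_def)
  qed
  have ygap: "y t \<in> gap" if "t \<le> i" for t
  proof (cases "t = 0")
    case True
    then show ?thesis using u_gap H(1) by (simp add: y_def)
  next
    case False
    then have "u < y t" using n_pos unfolding H(1) y_def by (intro add_mset_lt_left_lt) simp
    moreover obtain s where s: "s \<in># u" "s \<noteq> c" using third_element[OF u_missing(1)] by metis
    moreover have "s \<in># y t" using s H(1) by (simp add: y_def)
    ultimately show ?thesis using gap_upward[OF u_gap yL] y_less that by blast
  qed
  have W: "finite W" "W \<subseteq> L - B" using ygap gap_L by (auto simp: W_def)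
  have "inj_on y {..i}" using n_pos by (auto simp: y_def inj_on_def)
  then have cardW: "card W = Suc i" by (simp add: W_def card_image)
  obtain Q where Q: "init (L - B) Q" "card Q = Suc i" using init_exists[OF W] cardW by (metis order_refl)
  have Qgap: "q \<in> gap" if q: "q \<in> Q" for q
  proof -
    obtain w where w: "w \<in> W" "q \<le> w" using init_bound[OF Q(1) W _ q] Q(2) cardW by auto
    have "w \<in> gap" using w(1) ygap by (auto simp: W_def)
    have "r < z" if r: "r \<in># q" for r
    proof (cases "q = w")
      case True
      then show ?thesis using gap_L(3)[OF \<open>w \<in> gap\<close>] r by simp
    next
      case False
      then have "q < w" using w(2) by simp
      then obtain r' where "r' \<in># w" "r \<le> r'" using mset_less_bound r by blast
      then show ?thesis using gap_L(3)[OF \<open>w \<in> gap\<close>] by fastforce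
    qed
    then show ?thesis using Q(1) q by (auto simp: gap_def init_def)
  qed
  have costQ: "(\<Sum>q\<in>Q. card (new_at C q)) \<le> 1"
  proof -
    have fQ: "finite Q" using Q(1) by (simp add: init_def)
    have "card (new_at C q) = (if c \<in> new_at C q then 1 else 0)" if "q \<in> Q" for q
    proof -
      have "new_at C q = {} \<or> new_at C q = {c}" using new_at_gap[OF Qgap[OF that]] by blast
      then show ?thesis by auto
    qed
    then have "(\<Sum>q\<in>Q. card (new_at C q)) = (\<Sum>q\<in>Q. if c \<in> new_at C q then 1 else 0)"
      by (rule sum.cong[OF refl])
    also have "\<dots> = card {q \<in> Q. c \<in> new_at C q}" using fQ by (simp add: sum.If_cases Int_def)
    also have "\<dots> \<le> 1"
      using fQ new_at_unique Qgap by (simp add: card_le_Suc0_iff_eq)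
    finally show ?thesis .
  qed
  have costR: "1 \<le> (\<Sum>r\<in>R'. card (new_at C r))"
  proof -
    have "e \<in> new_at C (x 0)" using col_full[OF xL] en by (auto simp: new_at_def x_def)
    then have "1 \<le> card (new_at C (x 0))" by (metis One_nat_def Suc_leI card_gt_0_iff empty_iff finite_new_at)
    also have "\<dots> \<le> (\<Sum>r\<in>R'. card (new_at C r))" by (rule member_le_sum) (auto simp: R'_def)
    finally show ?thesis .
  qed
  have QL: "Q \<subseteq> L - B" using Q(1) by (simp add: init_def)
  have RL: "R' \<subseteq> L" using xL by (auto simp: R'_def)
  show False
  proof (rule minimal_family_exchange[OF minimal, of R' Q])
    show "R' \<subseteq> B" using xB by (auto simp: R'_def)
    show "R' \<noteq> {}" by (simp add: R'_def)
    show "finite Q" using Q(1) by (simp add: init_def)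
    show "Q \<subseteq> L - B" by (rule QL)
    show "card Q = card R'" using Q(2) cardR by simp
    show "a < r" if "a \<in> B - R'" "r \<in> R'" for a r using that topR by (auto simp: R'_def)
    show lt: "q < r" if "q \<in> Q" "r \<in> R'" for q r
      using less_z[of q r] gap_L(3)[OF Qgap[OF that(1)]] that(2) xz by (auto simp: R'_def)
    show "w \<in> B - R' \<union> Q" if "q \<in> Q" "w \<in> L" "w < q" for q w
    proof (cases "w \<in> B")
      case True
      then show ?thesis using lt[OF that(1)] that(3) by (metis DiffI UnI1 less_asym)
    next
      case False
      then show ?thesis using Q(1) that by (auto simp: init_def)
    qed
    show "(\<Sum>q\<in>Q. card (new_shadow L q)) \<le> (\<Sum>r\<in>R'. card (new_shadow L r))"
    proof -
      have "(\<Sum>q\<in>Q. card (new_shadow L q)) = (\<Sum>q\<in>Q. card (new_at C q))"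
        by (rule sum.cong) (use QL card_new_shadow[OF C] in auto)
      moreover have "(\<Sum>r\<in>R'. card (new_shadow L r)) = (\<Sum>r\<in>R'. card (new_at C r))"
        by (rule sum.cong) (use RL card_new_shadow[OF C] in auto)
      ultimately show ?thesis using costQ costR by linarith
    qed
  qed
qed

end

lemma (in cyclic) cyclic_shadow_min:
  "C \<subseteq> {..<n} \<Longrightarrow> shadow_min C"
proof (induction "card C" arbitrary: C rule: less_induct)
  case less
  show ?case
    unfolding shadow_min_def
  proof (intro allI impI, elim conjE)
    fix k A S
    assume A: "finite A" "A \<subseteq> level C k" and S: "init (level C k) S" and cd: "card S \<le> card A"
    consider "k = 0" | "k = 1" | "k = 2" | "3 \<le> k" by linarith
    then show "card (shadow S) \<le> card (shadow A)"
    proof cases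
      case 1
      then have "shadow S = {}" using S by (auto simp: shadow_def init_def level_0)
      then show ?thesis by simp
    next
      case 2
      then show ?thesis using shadow_min_1 A S cd by blast
    next
      case 3
      then show ?thesis using shadow_min_2[OF less.prems] A S cd by blast
    next
      case 4
      show ?thesis
      proof (rule shadow_min_via_minimal[OF A S cd])
        fix B assume B: "minimal_family C k B" and cdB: "card S \<le> card B"
        have "init (level C k) B"
        proof (rule ccontr)
          assume "\<not> init (level C k) B"
          then interpret critical n C k B
          proof unfold_locales
            show "shadow_min (C - {c})" if "c \<in> C" for c
              using less.prems that finite_subset[OF less.prems]
              by (intro less.hyps card_Diff1_less) auto
          qed (use less.prems 4 B in auto)
          show False by (rule contradiction)
        qed
        then have "S \<subseteq> B" using S cdB init_card_subset by blast
        then show "card (shadow S) \<le> card (shadow B)"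
          using B by (intro card_mono shadow_mono finite_shadow) (auto simp: minimal_family_def)
      qed
    qed
  qed
qed

section \<open>Reverse-lexicographic complexes with a prescribed f-vector\<close>

definition divisor_closed :: "'a multiset set \<Rightarrow> bool" where
  "divisor_closed M \<longleftrightarrow> finite M \<and> {#} \<in> M \<and> (\<forall>m\<in>M. \<forall>m'. m' \<subseteq># m \<longrightarrow> m' \<in> M)"

definition degree_part :: "'a multiset set \<Rightarrow> nat \<Rightarrow> 'a multiset set" where
  "degree_part M d = {m \<in> M. size m = d}"

lemma divisor_closedI:
  assumes "finite M" "{#} \<in> M" "\<And>q m. add_mset q m \<in> M \<Longrightarrow> m \<in> M"
  shows "divisor_closed M"
proof -
  have "m' \<in> M" if "m' + X \<in> M" for m' X
    using that by (induction X) (auto dest: assms(3))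
  then show ?thesis using assms(1,2) unfolding divisor_closed_def by (metis subset_mset.less_eqE)
qed

lemma inverse_image_mset:
  assumes "inj_on f W" "set_mset m \<subseteq> W"
  shows "image_mset (inv_into W f) (image_mset f m) = m"
  using assms by (simp add: image_mset.compositionality) (metis (no_types, lifting) comp_apply image_mset_cong_pair inv_into_f_f multiset.map_ident_strong subsetD)

lemma inverse_image_mset':
  assumes "set_mset m \<subseteq> f ` W"
  shows "image_mset f (image_mset (inv_into W f) m) = m"
  using assms by (simp add: image_mset.compositionality) (metis (no_types, lifting) comp_apply f_inv_into_f multiset.map_ident_strong subsetD)

lemma embed_multicomplex:
  assumes f: "inj_on f W" and M: "divisor_closed M" "\<And>m. m \<in> M \<Longrightarrow> set_mset m \<subseteq> W"
  shows "divisor_closed (image_mset f ` M)"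
    and "card (degree_part (image_mset f ` M) d) = card (degree_part M d)"
proof -
  let ?g = "inv_into W f"
  have inv: "image_mset ?g (image_mset f m) = m" if "m \<in> M" for m
    using inverse_image_mset[OF f M(2)[OF that]] .
  show "divisor_closed (image_mset f ` M)"
    unfolding divisor_closed_def
  proof (intro conjI ballI allI impI)
    show "finite (image_mset f ` M)" using M(1) by (simp add: divisor_closed_def)
    show "{#} \<in> image_mset f ` M" using M(1) by (auto simp: divisor_closed_def intro: image_eqI[of _ _ "{#}"])
    fix m m' assume "m \<in> image_mset f ` M" and sub: "m' \<subseteq># m"
    then obtain m0 where m0: "m0 \<in> M" "m = image_mset f m0" by blast
    have "image_mset ?g m' \<subseteq># image_mset ?g m" using sub by (rule image_mset_subseteq_mono)
    then have "image_mset ?g m' \<subseteq># m0" using inv[OF m0(1)] m0(2) by simp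
    then have "image_mset ?g m' \<in> M" using M(1) m0(1) unfolding divisor_closed_def by blast
    moreover have "set_mset m' \<subseteq> f ` W"
      using set_mset_mono[OF sub] m0(2) M(2)[OF m0(1)] by auto
    then have "image_mset f (image_mset ?g m') = m'" by (rule inverse_image_mset')
    ultimately show "m' \<in> image_mset f ` M" by (metis image_eqI)
  qed
  have "degree_part (image_mset f ` M) d = image_mset f ` degree_part M d"
    by (auto simp: degree_part_def)
  moreover have "inj_on (image_mset f) (degree_part M d)"
    by (rule inj_on_inverseI[of _ "image_mset ?g"]) (simp add: inv degree_part_def)
  ultimately show "card (degree_part (image_mset f ` M) d) = card (degree_part M d)"
    by (simp add: card_image)
qed

text \<open>Each degree is replaced by the initial segment of the same size. The shadow of the
  segment in degree \<open>d + 1\<close> is initial and no larger than the degree \<open>d\<close>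
  part of \<open>M\<close>, hence contained in the segment of degree \<open>d\<close>.\<close>

lemma (in colored) init_multicomplex:
  assumes min: "shadow_min C" and ini: "shadow_init C" and M: "divisor_closed M"
    and L: "\<And>m. m \<in> M \<Longrightarrow> m \<in> level C (size m)"
  obtains S where "divisor_closed S" "\<And>d. card (degree_part S d) = card (degree_part M d)"
    "\<And>d. init (level C d) (degree_part S d)"
proof -
  have fin: "finite (degree_part M d)" "degree_part M d \<subseteq> level C d" for d
    using M L by (auto simp: degree_part_def divisor_closed_def)
  define I where "I d = init_seg (level C d) (card (degree_part M d))" for d
  have I: "init (level C d) (I d)" "card (I d) = card (degree_part M d)" for d
    using init_seg[OF fin] by (auto simp: I_def)
  have IL: "I d \<subseteq> level C d" "finite (I d)" for d using I(1) by (auto simp: init_def)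
  define S where "S = {m. m \<in> I (size m)}"
  have part: "degree_part S d = I d" for d
    using IL[of d] by (auto simp: degree_part_def S_def level_def)
  define K where "K = Max (size ` M)"
  have fM: "finite M" using M by (simp add: divisor_closed_def)
  have "finite S"
  proof (rule finite_subset)
    show "S \<subseteq> (\<Union>d\<le>K. I d)"
    proof
      fix m assume m: "m \<in> S"
      then have "card (degree_part M (size m)) \<noteq> 0"
        using I(2) IL(2) unfolding S_def by (metis card_0_eq emptyE mem_Collect_eq)
      then obtain m' where "m' \<in> M" "size m' = size m"
        unfolding degree_part_def by (metis (mono_tags, lifting) card.empty empty_Collect_eq)
      then have "size m \<le> K" using fM by (metis Max_ge K_def finite_imageI imageI)
      then show "m \<in> (\<Union>d\<le>K. I d)" using m by (auto simp: S_def)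
    qed
  qed (use IL in auto)
  moreover have "{#} \<in> S"
  proof -
    have "degree_part M 0 = {{#}}" using M by (auto simp: degree_part_def divisor_closed_def)
    then have "card (I 0) = 1" using I(2)[of 0] by simp
    then obtain m where "I 0 = {m}" by (rule card_1_singletonE)
    moreover then have "m = {#}" using IL(1)[of 0] by (simp add: level_def)
    ultimately show ?thesis by (simp add: S_def)
  qed
  moreover have "m \<in> S" if q: "add_mset q m \<in> S" for q m
  proof -
    let ?k = "size m"
    have q': "add_mset q m \<in> I (Suc ?k)" using q by (simp add: S_def)
    have "card (shadow (I (Suc ?k))) \<le> card (shadow (degree_part M (Suc ?k)))"
      using min fin[of "Suc ?k"] I[of "Suc ?k"] unfolding shadow_min_def by (metis order_refl)
    also have "\<dots> \<le> card (degree_part M ?k)"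
    proof (rule card_mono[OF fin(1)])
      show "shadow (degree_part M (Suc ?k)) \<subseteq> degree_part M ?k"
      proof
        fix G assume "G \<in> shadow (degree_part M (Suc ?k))"
        then obtain p where p: "add_mset p G \<in> M" "size G = ?k" by (auto simp: shadow_def degree_part_def)
        moreover have "G \<subseteq># add_mset p G" by simp
        ultimately show "G \<in> degree_part M ?k" using M unfolding divisor_closed_def degree_part_def by blast
      qed
    qed
    also have "\<dots> = card (I ?k)" using I(2) by simp
    finally have "shadow (I (Suc ?k)) \<subseteq> I ?k"
      using ini I(1) init_card_subset unfolding shadow_init_def by blast
    then show ?thesis using q' by (auto simp: S_def shadow_def)
  qed
  ultimately have "divisor_closed S" by (rule divisor_closedI)
  then show ?thesis using that part I by metis
qed

section \<open>From numbers back to variables\<close>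

text \<open>The reversal of the colours accounts for \<open>x\<^sub>s\<^sub>,\<^sub>j > x\<^sub>t\<^sub>,\<^sub>j\<close> if \<open>s < t\<close>.\<close>

definition to_var :: "nat \<Rightarrow> nat \<Rightarrow> var" where
  "to_var n q = (n - 1 - q mod n, q div n)"

context
  fixes n :: nat
  assumes n: "0 < n"
begin

lemma to_var_less: "var_less (to_var n p) (to_var n q) \<longleftrightarrow> p < q"
proof -
  have m: "p mod n < n" "q mod n < n" using n by simp_all
  have "p < q \<longleftrightarrow> p div n < q div n \<or> (p div n = q div n \<and> p mod n < q mod n)"
  proof
    assume "p < q"
    then have "p div n \<le> q div n" by (simp add: div_le_mono)
    moreover have "p mod n < q mod n" if "p div n = q div n"
      using \<open>p < q\<close> that by (metis add_less_cancel_left div_mult_mod_eq)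
    ultimately show "p div n < q div n \<or> (p div n = q div n \<and> p mod n < q mod n)"
      using le_neq_implies_less by blast
  next
    assume "p div n < q div n \<or> (p div n = q div n \<and> p mod n < q mod n)"
    then show "p < q"
    proof
      assume "p div n < q div n"
      then show ?thesis using div_le_mono[of q p n] by (metis leD leI)
    next
      assume "p div n = q div n \<and> p mod n < q mod n"
      then show ?thesis using div_mult_mod_eq[of p n] div_mult_mod_eq[of q n] by (metis add_less_cancel_left)
    qed
  qed
  then show ?thesis using m by (auto simp: var_less_def to_var_def)
qed

lemma to_var_inj: "inj (to_var n)"
proof (rule injI)
  fix p q assume "to_var n p = to_var n q"
  then have "\<not> var_less (to_var n p) (to_var n q)" "\<not> var_less (to_var n q) (to_var n p)"
    by (simp_all add: var_less_def)
  then show "p = q" by (simp add: to_var_less)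
qed

lemma to_var_fst: "t < n \<Longrightarrow> fst (to_var n q) = t \<longleftrightarrow> q mod n = n - 1 - t"
proof -
  assume "t < n"
  then have "n - 1 - r = t \<longleftrightarrow> r = n - 1 - t" if "r < n" for r using that by arith
  moreover have "q mod n < n" using n by simp
  ultimately show ?thesis by (simp only: to_var_def fst_conv)
qed

lemma to_var_range: "range (to_var n) = all_vars n"
proof (intro equalityI subsetI)
  fix x assume "x \<in> range (to_var n)"
  then show "x \<in> all_vars n" using n by (auto simp: to_var_def all_vars_def var_class_def)
next
  fix x assume "x \<in> all_vars n"
  then have x: "fst x < n" by (auto simp: all_vars_def var_class_def)
  define r where "r = n - 1 - fst x"
  have "r < n" "n - 1 - r = fst x" using x by (auto simp: r_def)
  then have "to_var n (n * snd x + r) = x" by (simp add: to_var_def prod_eq_iff)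
  then show "x \<in> range (to_var n)" by (metis rangeI)
qed

lemma count_to_var: "count (image_mset (to_var n) m) (to_var n q) = count m q"
  by (induction m) (auto simp: inj_eq[OF to_var_inj])

lemma count_to_var_outside: "y \<notin> all_vars n \<Longrightarrow> count (image_mset (to_var n) m) y = 0"
  using to_var_range by (auto simp: count_eq_zero_iff)

text \<open>\<open>to_var\<close> is an order isomorphism onto the variables, and both orders are
  decided at the greatest variable with different exponents. Closure under reverse-lexicographically
  greater monomials thus becomes closure under smaller multisets.\<close>

lemma lex_to_var:
  "lex_less (image_mset (to_var n) m) (image_mset (to_var n) m') \<longleftrightarrow> size m = size m' \<and> m < m'"
proof
  assume "lex_less (image_mset (to_var n) m) (image_mset (to_var n) m')"
  then obtain x where s: "size m = size m'"
    and x: "count (image_mset (to_var n) m) x < count (image_mset (to_var n) m') x"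
      "\<And>y. var_less x y \<Longrightarrow> count (image_mset (to_var n) m) y = count (image_mset (to_var n) m') y"
    by (auto simp: lex_less_def)
  have "x \<in> all_vars n" using x(1) count_to_var_outside by fastforce
  then obtain q where q: "x = to_var n q" using to_var_range by blast
  have "m < m'"
  proof (rule mset_lessI[of _ q])
    show "count m q < count m' q" using x(1) q count_to_var by simp
    show "count m y \<le> count m' y" if "q < y" for y
      using x(2)[of "to_var n y"] that q count_to_var to_var_less by simp
  qed
  then show "size m = size m' \<and> m < m'" using s by simp
next
  assume a: "size m = size m' \<and> m < m'"
  then obtain q where q: "count m q < count m' q" "\<And>y. q < y \<Longrightarrow> count m y = count m' y"
    using mset_lessE by metis
  show "lex_less (image_mset (to_var n) m) (image_mset (to_var n) m')"
    unfolding lex_less_def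
  proof (intro conjI exI[of _ "to_var n q"] allI impI)
    show "count (image_mset (to_var n) m) (to_var n q) < count (image_mset (to_var n) m') (to_var n q)"
      using q(1) count_to_var by simp
    fix y assume y: "var_less (to_var n q) y"
    show "count (image_mset (to_var n) m) y = count (image_mset (to_var n) m') y"
    proof (cases "y \<in> all_vars n")
      case True
      then obtain p where "y = to_var n p" using to_var_range by blast
      then show ?thesis using y q(2) count_to_var to_var_less by simp
    qed (simp add: count_to_var_outside)
  qed (use a in simp)
qed

lemma to_var_surj: "set_mset m \<subseteq> all_vars n \<Longrightarrow> \<exists>m0. m = image_mset (to_var n) m0"
  using inverse_image_mset'[of m "to_var n" UNIV] to_var_range by metis

lemma size_part_to_var:
  assumes "t < n"
  shows "size (monomial_part (image_mset (to_var n) m) (var_class t)) = size (filter_mset (\<lambda>q. q mod n = n - 1 - t) m)"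
proof -
  have "(\<lambda>q. to_var n q \<in> var_class t) = (\<lambda>q. q mod n = n - 1 - t)"
    using to_var_fst[OF assms] by (simp only: var_class_def mem_Times_iff) simp
  then show ?thesis by (simp add: monomial_part_def filter_mset_image_mset comp_def)
qed

lemma revlex_image:
  assumes S: "divisor_closed S" and N: "\<And>m. image_mset (to_var n) m \<in> N \<longleftrightarrow> m \<in> N0"
    and NV: "\<And>m. m \<in> N \<Longrightarrow> set_mset m \<subseteq> all_vars n" and SN: "S \<subseteq> N0"
    and down: "\<And>m m'. m \<in> S \<Longrightarrow> m' \<in> N0 \<Longrightarrow> size m' = size m \<Longrightarrow> m' < m \<Longrightarrow> m' \<in> S"
  defines "M \<equiv> image_mset (to_var n) ` S"
  shows "finite M" "multicomplex_on (all_vars n) M" "M \<subseteq> N" "revlex_closed_in N M"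
    "card (degree_part M d) = card (degree_part S d)"
proof -
  have inj: "inj_on (to_var n) UNIV" using to_var_inj .
  have dc: "divisor_closed M" and cd: "card (degree_part M d) = card (degree_part S d)"
    unfolding M_def using embed_multicomplex[OF inj S] by auto
  show "finite M" using dc by (simp add: divisor_closed_def)
  show MN: "M \<subseteq> N" using SN N by (auto simp: M_def)
  have "all_vars n \<noteq> {}" using to_var_range by blast
  then show "multicomplex_on (all_vars n) M"
    using dc MN NV unfolding multicomplex_on_def divisor_closed_def by blast
  show "revlex_closed_in N M"
    unfolding revlex_closed_in_def
  proof (intro allI ballI impI)
    fix d m m' assume a: "m \<in> M" "m' \<in> N" "size m = d \<and> size m' = d \<and> revlex_less m m'"
    then obtain m0 where m0: "m0 \<in> S" "m = image_mset (to_var n) m0" by (auto simp: M_def)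
    obtain m1 where m1: "m' = image_mset (to_var n) m1" using to_var_surj NV a(2) by blast
    have "size m1 = size m0 \<and> m1 < m0" using a(3) m0 m1 lex_to_var by (simp add: revlex_less_def)
    then have "m1 \<in> S" using down m0(1) a(2) m1 N by blast
    then show "m' \<in> M" using m1 by (simp add: M_def)
  qed
  show "card (degree_part M d) = card (degree_part S d)" by (rule cd)
qed

end

lemma squarefree_mset_set: "(\<And>x. count m x \<le> 1) \<Longrightarrow> mset_set (set_mset m) = m"
  by (intro multiset_eqI)
    (metis count_greater_eq_one_iff count_mset_set(1,3) finite_set_mset le_antisym not_in_iff)

lemma squarefree_image_mset:
  assumes "inj_on f (set_mset m)" "\<And>x. count m x \<le> 1"
  shows "count (image_mset f m) y \<le> 1"
proof -
  have "card (f -` {y} \<inter> set_mset m) \<le> Suc 0"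
    using assms(1) by (auto simp: card_le_Suc0_iff_eq inj_on_def)
  moreover have "count (image_mset f m) y \<le> (\<Sum>x\<in>f -` {y} \<inter> set_mset m. 1)"
    unfolding count_image_mset using assms(2) by (intro sum_mono) simp
  ultimately show ?thesis by simp
qed

lemma multicomplex_f_vector_eq: "multicomplex_f_vector M d = card (degree_part M d)"
  by (simp add: multicomplex_f_vector_def degree_part_def)

lemma colored_multicomplex_divisor_closed:
  "colored_multicomplex a X M P \<Longrightarrow> finite M \<Longrightarrow> divisor_closed M"
  by (auto simp: colored_multicomplex_def multicomplex_on_def divisor_closed_def)

lemma init_degree_level:
  assumes "\<And>d. init (L d) (degree_part S d)" "m \<in> S"
  shows "m \<in> L (size m)"
proof -
  have "m \<in> degree_part S (size m)" using assms(2) by (simp add: degree_part_def)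
  then show ?thesis using assms(1)[of "size m"] unfolding init_def by blast
qed

lemma init_degree_down:
  assumes "\<And>d. init (L d) (degree_part S d)" "m \<in> S" "m' \<in> L (size m)" "m' < m"
  shows "m' \<in> S"
proof -
  have "m \<in> degree_part S (size m)" using assms(2) by (simp add: degree_part_def)
  then have "m' \<in> degree_part S (size m)" using assms(1)[of "size m"] assms(3,4) unfolding init_def by blast
  then show ?thesis by (simp add: degree_part_def)
qed

lemma ones_nth: "a = replicate (length a) 1 \<Longrightarrow> i < length a \<Longrightarrow> a ! i = (1::nat)"
  by (metis nth_replicate)

section \<open>Existence of reverse-lexicographic objects\<close>

lemma revlex_multicomplex_ones:
  assumes ones: "a = replicate (length a) 1" and ne: "a \<noteq> []"
    and col: "colored_multicomplex a X M P" and fin: "finite M"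
  shows "\<exists>M'. revlex_multicomplex a M' \<and> multicomplex_f_vector M' = multicomplex_f_vector M"
proof -
  define n where "n = length a"
  have n: "0 < n" using ne by (simp add: n_def)
  interpret cyclic n using n by unfold_locales
  have P: "length P = n" "\<Union> (set P) = X"
    "\<And>i j. i < n \<Longrightarrow> j < n \<Longrightarrow> i \<noteq> j \<Longrightarrow> P ! i \<inter> P ! j = {}"
    using col by (auto simp: colored_multicomplex_def ordered_partition_def n_def)
  have MX: "set_mset m \<subseteq> X" if "m \<in> M" for m
    using col that by (simp add: colored_multicomplex_def multicomplex_on_def)
  have Mp: "size (monomial_part m (P ! i)) \<le> 1" if "m \<in> M" "i < n" for m i
    using col that ones_nth[OF ones, of i] unfolding colored_multicomplex_def n_def by metis
  define W where "W = \<Union> (set_mset ` M)"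
  have "finite W" using fin by (auto simp: W_def)
  then obtain g :: "_ \<Rightarrow> nat" where g: "inj_on g W" by (metis finite_imp_inj_to_nat_seg)
  define cl where "cl x = (SOME i. i < n \<and> x \<in> P ! i)" for x
  have cl: "cl x < n \<and> x \<in> P ! cl x" if x: "x \<in> X" for x
  proof -
    obtain Y where "Y \<in> set P" "x \<in> Y" using x P(2) by blast
    then have "\<exists>i. i < n \<and> x \<in> P ! i" using P(1) by (metis in_set_conv_nth)
    then show ?thesis unfolding cl_def by (rule someI_ex)
  qed
  have cl_eq: "cl x = i \<longleftrightarrow> x \<in> P ! i" if "x \<in> X" "i < n" for x i
    using cl[OF that(1)] P(3)[of "cl x" i] that(2) by blast
  \<comment> \<open>The residue records the colour and the quotient is an index private to the
    vertex, so \<open>f\<close> is injective and respects the colouring.\<close>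
  define f where "f x = n * g x + cl x" for x
  have WX: "W \<subseteq> X" using MX by (auto simp: W_def)
  have fmod: "f x mod n = cl x" and fdiv: "f x div n = g x" if "x \<in> W" for x
    using cl[of x] WX that by (auto simp: f_def)
  have "inj_on f W"
  proof (rule inj_onI)
    fix x y assume "x \<in> W" "y \<in> W" "f x = f y"
    then show "x = y" using g fdiv by (metis inj_onD)
  qed
  note emb = embed_multicomplex[OF this colored_multicomplex_divisor_closed[OF col fin]]
  have MW: "set_mset m \<subseteq> W" if "m \<in> M" for m using that by (auto simp: W_def)
  have lev: "m \<in> level {..<n} (size m)" if m: "m \<in> image_mset f ` M" for m
  proof -
    obtain m0 where m0: "m0 \<in> M" "m = image_mset f m0" using m by blast
    have "size (part c m) < 2" for c
    proof (cases "c < n")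
      case True
      have "filter_mset (\<lambda>x. f x mod n = c) m0 = monomial_part m0 (P ! c)"
        unfolding monomial_part_def
      proof (rule filter_mset_cong[OF refl])
        fix x assume "x \<in># m0"
        then have "x \<in> W" using MW[OF m0(1)] by blast
        then have "f x mod n = cl x" "x \<in> X" using fmod WX by auto
        then show "f x mod n = c \<longleftrightarrow> x \<in> P ! c" using cl_eq[of x c] True by simp
      qed
      then show ?thesis using Mp[OF m0(1) True] m0(2) by (simp add: part_def filter_mset_image_mset comp_def)
    next
      case False
      then have "part c m = {#}" using n by (auto simp: part_def)
      then show ?thesis by simp
    qed
    then show ?thesis using n by (auto simp: level_def)
  qed
  obtain S where S: "divisor_closed S" "\<And>d. card (degree_part S d) = card (degree_part (image_mset f ` M) d)"
    "\<And>d. init (level {..<n} d) (degree_part S d)"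
    using init_multicomplex[OF cyclic_shadow_min cyclic_shadow_init emb(1) lev] MW by blast
  define N0 where "N0 = {m. \<forall>c. size (part c m) < 2}"
  have N: "image_mset (to_var n) m \<in> bounded_monomials a \<longleftrightarrow> m \<in> N0" for m
  proof -
    have "image_mset (to_var n) m \<in> bounded_monomials a \<longleftrightarrow> (\<forall>t<n. size (part (n - 1 - t) m) \<le> 1)"
      using to_var_range[OF n] size_part_to_var[OF n] ones_nth[OF ones]
      by (auto simp: bounded_monomials_def n_def[symmetric] part_def)
    also have "\<dots> \<longleftrightarrow> (\<forall>c<n. size (part c m) < 2)"
    proof (intro iffI allI impI)
      fix c assume a: "\<forall>t<n. size (part (n - 1 - t) m) \<le> 1" "c < n"
      have "n - 1 - c < n" "n - 1 - (n - 1 - c) = c" using a(2) by auto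
      then have "size (part c m) \<le> 1" using a(1)[rule_format, of "n - 1 - c"] by simp
      then show "size (part c m) < 2" by simp
    next
      fix t assume "\<forall>c<n. size (part c m) < 2" "t < n"
      then have "size (part (n - 1 - t) m) < 2" using n by auto
      then show "size (part (n - 1 - t) m) \<le> 1" by simp
    qed
    also have "\<dots> \<longleftrightarrow> m \<in> N0"
    proof -
      have "part c m = {#}" if "\<not> c < n" for c using that n by (auto simp: part_def)
      then have "size (part c m) < 2" if "\<forall>c<n. size (part c m) < 2" for c
        using that by (cases "c < n") auto
      then show ?thesis unfolding N0_def by blast
    qed
    finally show ?thesis .
  qed
  have SL: "m \<in> level {..<n} (size m)" if "m \<in> S" for m
    using init_degree_level[OF S(3) that] .
  have NV: "set_mset m \<subseteq> all_vars n" if "m \<in> bounded_monomials a" for m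
    using that by (simp add: bounded_monomials_def n_def)
  have SN: "S \<subseteq> N0" using SL by (auto simp: N0_def level_def)
  have down: "m' \<in> S" if "m \<in> S" "m' \<in> N0" "size m' = size m" "m' < m" for m m'
  proof -
    have "m' \<in> level {..<n} (size m)" using that n by (auto simp: level_def N0_def)
    then show ?thesis using init_degree_down[OF S(3) that(1) _ that(4)] by blast
  qed
  note rv = revlex_image[OF n S(1) N NV SN down]
  show ?thesis
  proof (intro exI conjI)
    show "revlex_multicomplex a (image_mset (to_var n) ` S)"
      using rv unfolding revlex_multicomplex_def n_def by simp
    show "multicomplex_f_vector (image_mset (to_var n) ` S) = multicomplex_f_vector M"
      using rv(5) S(2) emb(2) MW by (simp add: fun_eq_iff multicomplex_f_vector_eq)
  qed
qed

lemma single_color_bounded: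
  "image_mset (to_var 1) m \<in> bounded_monomials [r] \<longleftrightarrow> size m \<le> r"
proof -
  have "size (monomial_part (image_mset (to_var 1) m) (var_class 0)) = size m"
    using size_part_to_var[of 1 0 m] by simp
  moreover have "to_var 1 ` set_mset m \<subseteq> all_vars 1" using to_var_range[of 1] by auto
  ultimately show ?thesis by (auto simp: bounded_monomials_def)
qed

lemma single_color_size:
  assumes "colored_multicomplex [r] X M P" "m \<in> M"
  shows "size m \<le> r"
proof -
  have P: "P ! 0 = X" using assms(1)
    by (auto simp: colored_multicomplex_def ordered_partition_def length_Suc_conv)
  have "set_mset m \<subseteq> X" "size (monomial_part m (P ! 0)) \<le> r"
    using assms by (auto simp: colored_multicomplex_def multicomplex_on_def)
  moreover have "monomial_part m X = m"
    using calculation(1) by (auto simp: monomial_part_def filter_mset_eq_conv)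
  ultimately show ?thesis using P by simp
qed

lemma enumerate_support:
  assumes "finite M"
  obtains f :: "'v \<Rightarrow> nat" and N where "inj_on f (\<Union> (set_mset ` M))" "0 < N"
    "\<And>m. m \<in> M \<Longrightarrow> set_mset (image_mset f m) \<subseteq> {..<N}"
proof -
  have "finite (\<Union> (set_mset ` M))" using assms by auto
  then obtain f :: "'v \<Rightarrow> nat" and k where f: "f ` \<Union> (set_mset ` M) = {i. i < k}" "inj_on f (\<Union> (set_mset ` M))"
    by (metis finite_imp_inj_to_nat_seg)
  have "set_mset (image_mset f m) \<subseteq> {..<Suc k}" if "m \<in> M" for m
  proof -
    have "f ` set_mset m \<subseteq> f ` \<Union> (set_mset ` M)" using that by blast
    then show ?thesis using f(1) by auto
  qed
  then show ?thesis using that[OF f(2), of "Suc k"] by blast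
qed

lemma mset_less_below:
  fixes m m' :: "nat multiset"
  assumes "m' < m" "set_mset m \<subseteq> {..<N}"
  shows "set_mset m' \<subseteq> {..<N}"
  using mset_less_bound[OF assms(1)] assms(2) by fastforce

lemma degree_part_size_le:
  assumes "\<And>d. card (degree_part S d) = card (degree_part M d)" "divisor_closed S"
    "\<And>m. m \<in> M \<Longrightarrow> size m \<le> r" "m \<in> S"
  shows "size m \<le> r"
proof -
  have "m \<in> degree_part S (size m)" "finite (degree_part S (size m))"
    using assms(2,4) by (auto simp: degree_part_def divisor_closed_def)
  then have "card (degree_part S (size m)) \<noteq> 0" by auto
  then have "degree_part M (size m) \<noteq> {}" using assms(1) by (metis card.empty)
  then obtain m' where "m' \<in> M" "size m' = size m" by (auto simp: degree_part_def)
  then show ?thesis using assms(3)[of m'] by simp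
qed

text \<open>The initial segments are formed within \<open>N\<close> variables, yet are closed among
  all monomials, because a smaller monomial uses no larger variable. The degree bound carries over
  with the f-vector.\<close>

lemma revlex_multicomplex_single:
  assumes len: "length a = 1" and col: "colored_multicomplex a X M P" and fin: "finite M"
  shows "\<exists>M'. revlex_multicomplex a M' \<and> multicomplex_f_vector M' = multicomplex_f_vector M"
proof -
  obtain r where a: "a = [r]" using len by (auto simp: length_Suc_conv)
  obtain f :: "'a \<Rightarrow> nat" and N where f: "inj_on f (\<Union> (set_mset ` M))" "\<And>m. m \<in> M \<Longrightarrow> set_mset (image_mset f m) \<subseteq> {..<N}"
    using enumerate_support[OF fin] by metis
  note emb = embed_multicomplex[OF f(1) colored_multicomplex_divisor_closed[OF col fin]]
  have sub: "set_mset m \<subseteq> \<Union> (set_mset ` M)" if "m \<in> M" for m using that by blast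
  have below: "set_mset m \<subseteq> {..<N}" if "m \<in> image_mset f ` M" for m
    using that f(2) by (elim imageE) (simp only:)
  then have lev: "m \<in> macaulay.level {..<N} (size m)" if "m \<in> image_mset f ` M" for m
    using that by (simp add: macaulay_level)
  obtain S where S: "divisor_closed S" "\<And>d. card (degree_part S d) = card (degree_part (image_mset f ` M) d)"
    "\<And>d. init (macaulay.level {..<N} d) (degree_part S d)"
    using macaulay.init_multicomplex[OF macaulay_shadow_min macaulay_shadow_init emb(1) lev] sub by blast
  have cards: "card (degree_part S d) = card (degree_part M d)" for d using S(2) emb(2) sub by simp
  have n1: "(0::nat) < 1" by simp
  have SN: "S \<subseteq> {m. size m \<le> r}"
    using degree_part_size_le[OF cards S(1) single_color_size[OF col[unfolded a]]] by blast
  have NV: "set_mset m \<subseteq> all_vars 1" if "m \<in> bounded_monomials [r]" for m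
    using that by (simp add: bounded_monomials_def)
  have down: "m' \<in> S" if "m \<in> S" "m' \<in> {m. size m \<le> r}" "size m' = size m" "m' < m" for m m'
  proof -
    have "m \<in> macaulay.level {..<N} (size m)"
      using init_degree_level[OF S(3) that(1)] .
    then have "m' \<in> macaulay.level {..<N} (size m)"
      using mset_less_below[OF that(4)] that(3) by (simp add: macaulay_level)
    then show ?thesis using init_degree_down[OF S(3) that(1) _ that(4)] by blast
  qed
  have N: "image_mset (to_var 1) m \<in> bounded_monomials [r] \<longleftrightarrow> m \<in> {m. size m \<le> r}" for m
    using single_color_bounded by simp
  note rv = revlex_image[OF n1 S(1) N NV SN down]
  show ?thesis
  proof (intro exI conjI)
    show "revlex_multicomplex a (image_mset (to_var 1) ` S)"
      using rv unfolding revlex_multicomplex_def a by simp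
    show "multicomplex_f_vector (image_mset (to_var 1) ` S) = multicomplex_f_vector M"
      using rv(5) cards by (simp add: fun_eq_iff multicomplex_f_vector_eq)
  qed
qed

lemma (in cyclic) squarefree_level:
  assumes "set_mset m \<subseteq> {..<n}" "\<And>x. count m x \<le> 1"
  shows "m \<in> level {..<n} (size m)"
proof -
  have "size (part c m) < 2" for c
  proof -
    have "part c m = replicate_mset (count m c) c"
      using assms(1) by (auto simp: part_def multiset_eq_iff not_in_iff[symmetric] subset_iff)
    then show ?thesis using assms(2)[of c] by simp
  qed
  then show ?thesis using n_pos by (auto simp: level_def)
qed

text \<open>The modulus \<open>n\<close> is at least the number of vertices, so having distinct residues is no restriction.\<close>

lemma revlex_squarefree_single:
  assumes len: "length a = 1" and col: "colored_multicomplex a X M P" and fin: "finite M"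
    and sqf: "\<And>m x. m \<in> M \<Longrightarrow> count m x \<le> 1"
  shows "\<exists>M'. revlex_complex a M' \<and> multicomplex_f_vector M' = multicomplex_f_vector M"
proof -
  obtain r where a: "a = [r]" using len by (auto simp: length_Suc_conv)
  obtain f :: "'a \<Rightarrow> nat" and n where f: "inj_on f (\<Union> (set_mset ` M))" "0 < n"
      "\<And>m. m \<in> M \<Longrightarrow> set_mset (image_mset f m) \<subseteq> {..<n}"
    using enumerate_support[OF fin] by metis
  interpret cyclic n using f(2) by unfold_locales
  note emb = embed_multicomplex[OF f(1) colored_multicomplex_divisor_closed[OF col fin]]
  have sub: "set_mset m \<subseteq> \<Union> (set_mset ` M)" if "m \<in> M" for m using that by blast
  have fsq: "count (image_mset f m) y \<le> 1" if m: "m \<in> M" for m y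
    using inj_on_subset[OF f(1) sub[OF m]] sqf[OF m] by (rule squarefree_image_mset)
  have below: "set_mset m \<subseteq> {..<n}" "count m x \<le> 1" if "m \<in> image_mset f ` M" for m x
    using that f(3) fsq by (elim imageE; simp only:)+
  have lev: "m \<in> level {..<n} (size m)" if "m \<in> image_mset f ` M" for m
    using squarefree_level below that by blast
  obtain S where S: "divisor_closed S" "\<And>d. card (degree_part S d) = card (degree_part (image_mset f ` M) d)"
    "\<And>d. init (level {..<n} d) (degree_part S d)"
    using init_multicomplex[OF cyclic_shadow_min cyclic_shadow_init emb(1) lev] sub by blast
  have cards: "card (degree_part S d) = card (degree_part M d)" for d using S(2) emb(2) sub by simp
  \<comment> \<open>The squarefree monomials in the variables below \<open>n\<close> are an initial
    segment of the level that is large enough for each degree of \<open>M\<close>; hence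
    \<open>S\<close> stays inside it. On these variables distinct residues mean just
    squarefree.\<close>
  define Q where "Q d = {m \<in> level {..<n} d. set_mset m \<subseteq> {..<n}}" for d
  have Q: "init (level {..<n} d) (Q d)" for d
    unfolding init_def
  proof (intro conjI ballI impI)
    show "finite (Q d)"
      by (rule finite_subset[OF _ finite_multisets_of_size[of "{..<n}" d]])
        (auto simp: Q_def multisets_of_size_def level_def)
    show "Q d \<subseteq> level {..<n} d" by (auto simp: Q_def)
    show "m' \<in> Q d" if "m \<in> Q d" "m' \<in> level {..<n} d" "m' < m" for m m'
      using that mset_less_below[OF that(3)] by (simp add: Q_def)
  qed
  have SQ: "degree_part S d \<subseteq> Q d" for d
  proof (rule init_card_subset[OF S(3) Q])
    have "degree_part (image_mset f ` M) d \<subseteq> Q d"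
      using lev below(1) unfolding degree_part_def Q_def by blast
    then show "card (degree_part S d) \<le> card (Q d)"
      unfolding S(2) using Q[of d] by (intro card_mono) (auto simp: init_def)
  qed
  define N0 where "N0 = {m :: nat multiset. size m \<le> r \<and> (\<forall>x. count m x \<le> 1)}"
  have SN: "S \<subseteq> N0"
  proof
    fix m assume m: "m \<in> S"
    then have "m \<in> level {..<n} (size m)" using SQ[of "size m"] by (auto simp: degree_part_def Q_def)
    then have "\<forall>x. count m x \<le> 1" using level_count by blast
    then show "m \<in> N0"
      using degree_part_size_le[OF cards S(1) single_color_size[OF col[unfolded a]] m] by (simp add: N0_def)
  qed
  have NV: "set_mset m \<subseteq> all_vars 1" if "m \<in> bounded_squarefree_monomials [r]" for m
    using that by (simp add: bounded_squarefree_monomials_def bounded_monomials_def)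
  have down: "m' \<in> S" if "m \<in> S" "m' \<in> N0" "size m' = size m" "m' < m" for m m'
  proof -
    have "set_mset m \<subseteq> {..<n}" using SQ[of "size m"] that(1) by (auto simp: degree_part_def Q_def)
    then have "m' \<in> level {..<n} (size m)"
      using squarefree_level[OF mset_less_below[OF that(4)]] that(2,3) by (simp add: N0_def)
    then show ?thesis using init_degree_down[OF S(3) that(1) _ that(4)] by blast
  qed
  have n1: "(0::nat) < 1" by simp
  have N: "image_mset (to_var 1) m \<in> bounded_squarefree_monomials [r] \<longleftrightarrow> m \<in> N0" for m
  proof -
    have "(\<forall>x. count (image_mset (to_var 1) m) x \<le> 1) \<longleftrightarrow> (\<forall>x. count m x \<le> 1)"
    proof (intro iffI allI)
      fix x assume "\<forall>x. count (image_mset (to_var 1) m) x \<le> 1"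
      then show "count m x \<le> 1" using count_to_var[OF n1] by metis
    next
      fix x assume c: "\<forall>x. count m x \<le> 1"
      show "count (image_mset (to_var 1) m) x \<le> 1"
      proof (cases "x \<in> all_vars 1")
        case True
        then obtain q where "x = to_var 1 q" using to_var_range[OF n1] by blast
        then show ?thesis using c count_to_var[OF n1] by simp
      next
        case False
        then show ?thesis using count_to_var_outside[OF n1, of x m] by linarith
      qed
    qed
    then show ?thesis using single_color_bounded by (simp add: bounded_squarefree_monomials_def N0_def)
  qed
  note rv = revlex_image[OF n1 S(1) N NV SN down]
  show ?thesis
  proof (intro exI conjI)
    show "revlex_complex a (image_mset (to_var 1) ` S)"
      using rv unfolding revlex_complex_def a by simp
    show "multicomplex_f_vector (image_mset (to_var 1) ` S) = multicomplex_f_vector M"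
      using rv(5) cards by (simp add: fun_eq_iff multicomplex_f_vector_eq)
  qed
qed

lemma squarefree_ones:
  assumes ones: "a = replicate (length a) 1"
  shows "bounded_squarefree_monomials a = bounded_monomials a"
proof -
  have "count m x \<le> 1" if m: "m \<in> bounded_monomials a" for m x
  proof (cases "x \<in># m")
    case True
    then obtain t where t: "t < length a" "x \<in> var_class t"
      using m by (auto simp: bounded_monomials_def all_vars_def)
    then have "count m x = count (monomial_part m (var_class t)) x" by (simp add: monomial_part_def)
    also have "\<dots> \<le> size (monomial_part m (var_class t))" by (rule count_le_size)
    also have "\<dots> \<le> 1" using m t ones_nth[OF ones t(1)] by (auto simp: bounded_monomials_def)
    finally show ?thesis .
  qed (simp add: not_in_iff)
  then show ?thesis by (auto simp: bounded_squarefree_monomials_def)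
qed

lemma complex_f_vector_cong:
  assumes fin: "finite A" "finite B" and eq: "\<And>d. card {F \<in> A. card F = d} = card {F \<in> B. card F = d}"
  shows "complex_f_vector A = complex_f_vector B"
proof -
  have "card ` X = {d. card {F \<in> X. card F = d} \<noteq> 0}" if "finite X" for X :: "'c set set"
    using that by (auto simp: card_eq_0_iff)
  from this[of A] have "card ` A = {d. card {F \<in> A. card F = d} \<noteq> 0}" using fin by simp
  moreover have "card ` B = {d. card {F \<in> B. card F = d} \<noteq> 0}" using fin by (auto simp: card_eq_0_iff)
  ultimately have "card ` A = card ` B" using eq by simp
  then show ?thesis using eq by (simp add: complex_f_vector_def)
qed

text \<open>The tuple starts with the vertices, hence \<open>0 < d\<close>. Equal lengths mean equal
  dimension, beyond which neither side has faces.\<close>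

lemma complex_f_vector_nth:
  assumes "complex_f_vector A = complex_f_vector B" and fin: "finite A" "finite B" and d: "0 < d"
  shows "card {F \<in> A. card F = d} = card {F \<in> B. card F = d}"
proof (cases "d \<le> Max (card ` A)")
  case True
  have len: "Max (card ` A) = Max (card ` B)"
    using arg_cong[OF assms(1), of length] by (simp add: complex_f_vector_def)
  obtain i where "d = Suc i" using d by (cases d) auto
  then show ?thesis using True arg_cong[OF assms(1), of "\<lambda>l. l ! i"] len by (simp add: complex_f_vector_def)
next
  case False
  have len: "Max (card ` A) = Max (card ` B)"
    using arg_cong[OF assms(1), of length] by (simp add: complex_f_vector_def)
  have "card F \<le> Max (card ` X)" if "F \<in> X" "finite X" for F and X :: "'c set set"
    using that by simp
  then have "{F \<in> A. card F = d} = {}" using False fin(1) by auto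
  moreover have "card F \<le> Max (card ` B)" if "F \<in> B" for F using that fin(2) by simp
  then have "{F \<in> B. card F = d} = {}" using False len by auto
  ultimately show ?thesis by (simp only: card.empty)
qed

lemma card_faces:
  assumes "\<And>m x. m \<in> M \<Longrightarrow> count m x \<le> 1"
  shows "card {F \<in> set_mset ` M. card F = d} = card (degree_part M d)"
proof -
  have ms: "mset_set (set_mset m) = m" if "m \<in> M" for m
    using assms[OF that] by (rule squarefree_mset_set)
  then have "card (set_mset m) = size m" if "m \<in> M" for m using that by (metis size_mset_set)
  then have "{F \<in> set_mset ` M. card F = d} = set_mset ` degree_part M d" by (auto simp: degree_part_def)
  moreover have "inj_on set_mset (degree_part M d)"
    by (rule inj_on_inverseI[of _ mset_set]) (simp add: ms degree_part_def)
  ultimately show ?thesis by (simp add: card_image)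
qed

lemma complex_as_multicomplex:
  assumes "colored_complex a V \<Delta> P"
  defines "M \<equiv> mset_set ` \<Delta>"
  shows "colored_multicomplex a V M P" "finite M" "\<And>m x. m \<in> M \<Longrightarrow> count m x \<le> 1" "set_mset ` M = \<Delta>" "finite \<Delta>"
proof -
  have D: "finite V" "V \<noteq> {}" "\<Delta> \<subseteq> Pow V" "\<And>v. v \<in> V \<Longrightarrow> {v} \<in> \<Delta>" "\<And>F G. F \<in> \<Delta> \<Longrightarrow> G \<subseteq> F \<Longrightarrow> G \<in> \<Delta>"
    using assms(1) by (auto simp: colored_complex_def simplicial_complex_on_def)
  have FV: "F \<subseteq> V" if "F \<in> \<Delta>" for F using that D(3) by blast
  then have finF: "finite F" if "F \<in> \<Delta>" for F using that D(1) by (blast intro: finite_subset)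
  show fD: "finite \<Delta>" using D(1,3) finite_subset[of \<Delta> "Pow V"] by simp
  then show "finite M" by (simp add: M_def)
  show "\<And>m x. m \<in> M \<Longrightarrow> count m x \<le> 1" by (auto simp: M_def count_mset_set')
  show "set_mset ` M = \<Delta>" using finF by (force simp: M_def image_image)
  have empty: "{} \<in> \<Delta>" using D by blast
  have "multicomplex_on V M"
    unfolding multicomplex_on_def
  proof (intro conjI ballI allI impI)
    show "{#} \<in> M" using empty by (auto simp: M_def intro: image_eqI[of _ _ "{}"])
    show "set_mset m \<subseteq> V" if "m \<in> M" for m
      using that FV finF unfolding M_def by (elim imageE) simp
    fix m m' assume m: "m \<in> M" "m' \<subseteq># m"
    then obtain F where F: "F \<in> \<Delta>" "m = mset_set F" by (auto simp: M_def)
    have c: "count m' x \<le> 1" for x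
      using mset_subset_eq_count[OF m(2), of x] F by (auto simp: count_mset_set' split: if_splits)
    have "m' = mset_set (set_mset m')"
      using squarefree_mset_set[OF c] by simp
    moreover have "set_mset m' \<subseteq> F" using set_mset_mono[OF m(2)] F finF by simp
    ultimately show "m' \<in> M" using D(5)[OF F(1)] by (auto simp: M_def)
  qed (use D in auto)
  moreover have "size (monomial_part m (P ! i)) \<le> a ! i" if mi: "m \<in> M" "i < length a" for m i
  proof -
    obtain F where F: "F \<in> \<Delta>" "m = mset_set F" using mi by (auto simp: M_def)
    have "monomial_part m (P ! i) = mset_set (F \<inter> P ! i)"
      using F finF by (simp add: monomial_part_def filter_mset_mset_set Int_def)
    then show ?thesis using assms(1) F(1) mi(2) by (simp add: colored_complex_def)
  qed
  ultimately show "colored_multicomplex a V M P"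
    using assms(1) by (simp add: colored_multicomplex_def colored_complex_def)
qed

lemma revlex_complex_exists:
  assumes "length a = 1 \<or> a = replicate (length a) 1" "a \<noteq> []" and D: "colored_complex a V \<Delta> P"
  shows "\<exists>M. revlex_complex a M \<and> complex_f_vector (set_mset ` M) = complex_f_vector \<Delta>"
proof -
  define M0 where "M0 = mset_set ` \<Delta>"
  note M0 = complex_as_multicomplex[OF D, folded M0_def]
  have "\<exists>M. revlex_complex a M \<and> multicomplex_f_vector M = multicomplex_f_vector M0"
    using assms(1)
  proof
    assume "length a = 1"
    then show ?thesis using revlex_squarefree_single[OF _ M0(1-3)] by blast
  next
    assume ones: "a = replicate (length a) 1"
    then show ?thesis using revlex_multicomplex_ones[OF ones assms(2) M0(1,2)] squarefree_ones[OF ones]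
      by (simp add: revlex_complex_def revlex_multicomplex_def)
  qed
  then obtain M where M: "revlex_complex a M" "multicomplex_f_vector M = multicomplex_f_vector M0" by blast
  have sq: "count m x \<le> 1" if "m \<in> M" for m x
  proof -
    have "m \<in> bounded_squarefree_monomials a" using M(1) that by (auto simp only: revlex_complex_def)
    then show ?thesis by (simp only: bounded_squarefree_monomials_def mem_Collect_eq)
  qed
  have "complex_f_vector (set_mset ` M) = complex_f_vector (set_mset ` M0)"
  proof (rule complex_f_vector_cong)
    show "finite (set_mset ` M)" using M(1) by (simp add: revlex_complex_def)
    show "card {F \<in> set_mset ` M. card F = d} = card {F \<in> set_mset ` M0. card F = d}" for d
    proof -
      have "card (degree_part M d) = card (degree_part M0 d)"
        using M(2) by (simp add: multicomplex_f_vector_eq[symmetric])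
      moreover have "card {F \<in> set_mset ` M. card F = d} = card (degree_part M d)"
        by (rule card_faces) (rule sq)
      moreover have "card {F \<in> set_mset ` M0. card F = d} = card (degree_part M0 d)"
        by (rule card_faces) (rule M0(3))
      ultimately show ?thesis by simp
    qed
  qed (use M0 in simp)
  then show ?thesis using M(1) M0(4) by auto
qed

lemma revlex_multicomplex_exists:
  assumes "length a = 1 \<or> a = replicate (length a) 1" "a \<noteq> []" "colored_multicomplex a X M P" "finite M"
  shows "\<exists>M'. revlex_multicomplex a M' \<and> multicomplex_f_vector M' = multicomplex_f_vector M"
  using assms revlex_multicomplex_single revlex_multicomplex_ones by blast

section \<open>Counting full-degree monomials\<close>

declare split_paired_All [simp del] split_paired_Ex [simp del]

abbreviation color_part :: "nat \<Rightarrow> var multiset \<Rightarrow> var multiset" where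
  "color_part t m \<equiv> monomial_part m (var_class t)"

lemma var_class_iff: "x \<in> var_class t \<longleftrightarrow> fst x = t"
  by (simp add: var_class_def mem_Times_iff)

lemma all_vars_iff: "x \<in> all_vars n \<longleftrightarrow> fst x < n"
  by (auto simp: all_vars_def var_class_iff)

lemma count_color_part: "count (color_part t m) x = (if fst x = t then count m x else 0)"
  by (simp add: monomial_part_def var_class_iff)

lemma color_part_add: "color_part t (m + m') = color_part t m + color_part t m'"
  by (simp add: monomial_part_def)

lemma color_part_add_mset:
  "color_part t (add_mset x m) = (if fst x = t then add_mset x (color_part t m) else color_part t m)"
  by (simp add: monomial_part_def var_class_iff)

lemma color_part_mono: "m \<subseteq># m' \<Longrightarrow> color_part t m \<subseteq># color_part t m'"
  by (simp add: monomial_part_def multiset_filter_mono)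

lemma set_color_part: "set_mset (color_part t m) = {x \<in> set_mset m. fst x = t}"
  by (auto simp: monomial_part_def var_class_iff)

lemma size_color_parts:
  "set_mset m \<subseteq> all_vars n \<Longrightarrow> size m = (\<Sum>t<n. size (color_part t m))"
proof (induction m)
  case empty
  then show ?case by (simp add: monomial_part_def)
next
  case (add x m)
  have "size (color_part t (add_mset x m)) = size (color_part t m) + (if fst x = t then 1 else 0)" for t
    by (simp add: color_part_add_mset)
  then have "(\<Sum>t<n. size (color_part t (add_mset x m)))
      = (\<Sum>t<n. size (color_part t m)) + (\<Sum>t<n. if fst x = t then 1 else 0)"
    by (simp add: sum.distrib)
  moreover have "fst x < n" using add.prems by (auto simp: all_vars_iff)
  ultimately show ?case using add by simp
qed

lemma card_by_color_parts:
  assumes "\<And>t x. t < n \<Longrightarrow> x \<in> F t \<Longrightarrow> set_mset x \<subseteq> var_class t"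
  shows "card {m. set_mset m \<subseteq> all_vars n \<and> (\<forall>t<n. color_part t m \<in> F t)} = (\<Prod>t<n. card (F t))"
  using assms
proof (induction n)
  case 0
  have "{m. set_mset m \<subseteq> all_vars 0 \<and> (\<forall>t<0. color_part t m \<in> F t)} = {{#}}"
    by (auto simp: all_vars_def)
  then show ?case by simp
next
  case (Suc n)
  let ?A = "{m. set_mset m \<subseteq> all_vars n \<and> (\<forall>t<n. color_part t m \<in> F t)}"
  let ?B = "{m. set_mset m \<subseteq> all_vars (Suc n) \<and> (\<forall>t<Suc n. color_part t m \<in> F t)}"
  let ?f = "\<lambda>(m1, m2). m1 + m2"
  have own: "color_part n x = x" "t < n \<Longrightarrow> color_part t x = {#}" if "x \<in> F n" for x t
    using Suc.prems[of n x] that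
    by (auto simp: monomial_part_def filter_mset_eq_conv var_class_iff subset_iff)
  have other: "color_part n m = {#}" if "set_mset m \<subseteq> all_vars n" for m
    using that by (auto simp: monomial_part_def var_class_iff all_vars_iff subset_iff)
  have inj: "inj_on ?f (?A \<times> F n)"
  proof (rule inj_onI, clarify)
    fix m1 m2 m1' m2'
    assume a: "set_mset m1 \<subseteq> all_vars n" "set_mset m1' \<subseteq> all_vars n" "m2 \<in> F n" "m2' \<in> F n" "m1 + m2 = m1' + m2'"
    have "color_part n (m1 + m2) = m2" using own(1)[OF a(3)] other[OF a(1)] by (simp add: color_part_add)
    moreover have "color_part n (m1' + m2') = m2'" using own(1)[OF a(4)] other[OF a(2)] by (simp add: color_part_add)
    ultimately have "m2 = m2'" using a(5) by simp
    then show "m1 = m1' \<and> m2 = m2'" using a(5) by simp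
  qed
  have image: "?f ` (?A \<times> F n) = ?B"
  proof (intro equalityI subsetI)
    fix m assume "m \<in> ?f ` (?A \<times> F n)"
    then obtain m1 m2 where m: "m = m1 + m2" "m1 \<in> ?A" "m2 \<in> F n" by auto
    have "set_mset m \<subseteq> all_vars (Suc n)"
      using m Suc.prems[of n m2] by (auto simp: all_vars_iff var_class_iff subset_iff less_Suc_eq)
    moreover have "color_part t m \<in> F t" if "t < Suc n" for t
      using m own[OF m(3)] other[of m1] that by (cases "t = n") (auto simp: color_part_add)
    ultimately show "m \<in> ?B" by blast
  next
    fix m assume m: "m \<in> ?B"
    let ?m1 = "filter_mset (\<lambda>x. fst x \<noteq> n) m"
    have "m = ?m1 + color_part n m" by (simp add: multiset_eq_iff count_color_part)
    moreover have "?m1 \<in> ?A"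
    proof -
      have "set_mset ?m1 \<subseteq> all_vars n" using m by (auto simp: all_vars_iff subset_iff less_Suc_eq)
      moreover have "color_part t ?m1 = color_part t m" if "t < n" for t
        using that by (auto simp: multiset_eq_iff count_color_part)
      ultimately show ?thesis using m by auto
    qed
    moreover have "color_part n m \<in> F n" using m by blast
    ultimately show "m \<in> ?f ` (?A \<times> F n)" by (intro image_eqI[of _ _ "(?m1, color_part n m)"]) auto
  qed
  have "card ?B = card (?A \<times> F n)" unfolding image[symmetric] using inj by (rule card_image)
  then show ?case using Suc by (simp add: card_cartesian_product)
qed

text \<open>The flag \<open>sq\<close> selects complexes or multicomplexes, so that vertices and
  monomials of full degree are treated once for both.\<close>

definition bounded_kind :: "bool \<Rightarrow> nat list \<Rightarrow> var multiset set" where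
  "bounded_kind sq a = {m \<in> bounded_monomials a. sq \<longrightarrow> (\<forall>x. count m x \<le> 1)}"

definition revlex_kind :: "bool \<Rightarrow> nat list \<Rightarrow> var multiset set \<Rightarrow> bool" where
  "revlex_kind sq a M \<longleftrightarrow> finite M \<and> multicomplex_on (all_vars (length a)) M \<and>
     M \<subseteq> bounded_kind sq a \<and> revlex_closed_in (bounded_kind sq a) M"

lemma revlex_kind_True: "revlex_kind True a M \<longleftrightarrow> revlex_complex a M"
  by (simp add: revlex_kind_def revlex_complex_def bounded_kind_def bounded_squarefree_monomials_def)

lemma revlex_kind_False: "revlex_kind False a M \<longleftrightarrow> revlex_multicomplex a M"
  by (simp add: revlex_kind_def revlex_multicomplex_def bounded_kind_def)

lemma bounded_kind_iff: "m \<in> bounded_kind sq a \<longleftrightarrow> set_mset m \<subseteq> all_vars (length a) \<and>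
    (\<forall>t<length a. size (color_part t m) \<le> a ! t) \<and> (sq \<longrightarrow> (\<forall>x. count m x \<le> 1))"
  by (simp add: bounded_kind_def bounded_monomials_def)

lemma bounded_kind_down: "m \<in> bounded_kind sq a \<Longrightarrow> m' \<subseteq># m \<Longrightarrow> m' \<in> bounded_kind sq a"
  unfolding bounded_kind_iff
  using size_mset_mono[OF color_part_mono] mset_subset_eq_count set_mset_mono by (metis order_trans)

definition top_degree :: "nat list \<Rightarrow> nat" where
  "top_degree a = (\<Sum>t<length a. a ! t)"

lemma full_iff:
  assumes "m \<in> bounded_kind sq a"
  shows "size m = top_degree a \<longleftrightarrow> (\<forall>t<length a. size (color_part t m) = a ! t)"
proof -
  have s: "size m = (\<Sum>t<length a. size (color_part t m))"
    using assms by (intro size_color_parts) (simp add: bounded_kind_iff)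
  have le: "size (color_part t m) \<le> a ! t" if "t < length a" for t
    using assms that by (simp add: bounded_kind_iff)
  show ?thesis
  proof
    assume "size m = top_degree a"
    then have eq: "(\<Sum>t<length a. size (color_part t m)) = (\<Sum>t<length a. a ! t)"
      using s by (simp add: top_degree_def)
    show "\<forall>t<length a. size (color_part t m) = a ! t"
    proof (intro allI impI, rule ccontr)
      fix t assume "t < length a" "size (color_part t m) \<noteq> a ! t"
      then have "(\<Sum>t<length a. size (color_part t m)) < (\<Sum>t<length a. a ! t)"
        using le by (intro sum_strict_mono_ex1) (auto intro!: bexI[of _ t] simp: le_neq_implies_less)
      then show False using eq by simp
    qed
  qed (use s in \<open>simp add: top_degree_def\<close>)
qed

definition monomials_in :: "bool \<Rightarrow> nat \<Rightarrow> nat \<Rightarrow> nat \<Rightarrow> var multiset set" where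
  "monomials_in sq t v k = {m. set_mset m \<subseteq> {t} \<times> {..<v} \<and> size m = k \<and> (sq \<longrightarrow> (\<forall>x. count m x \<le> 1))}"

definition monomial_count :: "bool \<Rightarrow> nat \<Rightarrow> nat \<Rightarrow> nat" where
  "monomial_count sq v k = (if sq then v choose k else (v + k - 1) choose k)"

lemma card_monomials_in: "card (monomials_in sq t v k) = monomial_count sq v k"
proof -
  have c: "card ({t} \<times> {..<v}) = v" by (simp add: card_cartesian_product)
  show ?thesis
  proof (cases sq)
    case True
    have "monomials_in sq t v k = mset_set ` {B. B \<subseteq> {t} \<times> {..<v} \<and> card B = k}"
    proof (intro equalityI subsetI)
      fix m assume m: "m \<in> monomials_in sq t v k"
      then have "mset_set (set_mset m) = m" using True by (intro squarefree_mset_set) (simp add: monomials_in_def)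
      then show "m \<in> mset_set ` {B. B \<subseteq> {t} \<times> {..<v} \<and> card B = k}"
        using m by (intro image_eqI[of _ _ "set_mset m"]) (auto simp: monomials_in_def size_mset_set[symmetric] simp del: size_mset_set)
    next
      fix m assume "m \<in> mset_set ` {B. B \<subseteq> {t} \<times> {..<v} \<and> card B = k}"
      then obtain B where B: "m = mset_set B" "B \<subseteq> {t} \<times> {..<v}" "card B = k" by blast
      then have "finite B" by (auto intro: finite_subset)
      then have "set_mset m = B" "size m = k" "\<And>x. count m x \<le> 1" using B by (simp_all add: count_mset_set')
      then show "m \<in> monomials_in sq t v k" using B(2) by (simp add: monomials_in_def)
    qed
    moreover have "inj_on mset_set {B. B \<subseteq> {t} \<times> {..<v} \<and> card B = k}"
    proof (rule inj_on_inverseI[of _ set_mset])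
      fix B assume "B \<in> {B. B \<subseteq> {t} \<times> {..<v} \<and> card B = k}"
      then have "finite B" by (auto intro: finite_subset)
      then show "set_mset (mset_set B) = B" by simp
    qed
    ultimately show ?thesis
      using True n_subsets[of "{t} \<times> {..<v}" k] c by (simp add: card_image monomial_count_def)
  next
    case False
    then have "monomials_in sq t v k = multisets_of_size ({t} \<times> {..<v}) k"
      by (auto simp: monomials_in_def multisets_of_size_def)
    then show ?thesis using False card_multisets_of_size[of "{t} \<times> {..<v}" k] c
      by (simp add: monomial_count_def)
  qed
qed

definition grid :: "nat \<Rightarrow> (nat \<Rightarrow> nat) \<Rightarrow> var set" where
  "grid n v = (SIGMA t:{..<n}. {..<v t})"

lemma grid_iff: "x \<in> grid n v \<longleftrightarrow> fst x < n \<and> snd x < v (fst x)"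
  by (cases x) (simp add: grid_def)

lemma finite_grid: "finite (grid n v)"
  by (simp add: grid_def)

lemma card_grid: "card (grid n v) = (\<Sum>t<n. v t)"
  by (simp add: grid_def card_SigmaI)

lemma grid_color_part: "set_mset m \<subseteq> grid n v \<Longrightarrow> set_mset (color_part t m) \<subseteq> {t} \<times> {..<v t}"
  by (auto simp: set_color_part grid_def)

lemma full_grid:
  "{m \<in> bounded_kind sq a. set_mset m \<subseteq> grid (length a) v \<and> size m = top_degree a}
    = {m. set_mset m \<subseteq> all_vars (length a) \<and> (\<forall>t<length a. color_part t m \<in> monomials_in sq t (v t) (a ! t))}"
proof (intro equalityI subsetI)
  fix m assume m: "m \<in> {m \<in> bounded_kind sq a. set_mset m \<subseteq> grid (length a) v \<and> size m = top_degree a}"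
  then show "m \<in> {m. set_mset m \<subseteq> all_vars (length a) \<and> (\<forall>t<length a. color_part t m \<in> monomials_in sq t (v t) (a ! t))}"
    using full_iff[of m sq a] grid_color_part[of m "length a" v]
    by (auto simp: monomials_in_def bounded_kind_iff count_color_part)
next
  fix m assume m: "m \<in> {m. set_mset m \<subseteq> all_vars (length a) \<and> (\<forall>t<length a. color_part t m \<in> monomials_in sq t (v t) (a ! t))}"
  have sq: "count m x \<le> 1" if sq for x
  proof (cases "x \<in># m")
    case True
    then have "fst x < length a" using m by (auto simp: all_vars_iff)
    then have "count (color_part (fst x) m) x \<le> 1" using m that by (auto simp: monomials_in_def)
    then show ?thesis by (simp add: count_color_part)
  qed (simp add: not_in_iff)
  have "x \<in> grid (length a) v" if "x \<in># m" for x
  proof -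
    have x: "fst x < length a" using m that by (auto simp: all_vars_iff)
    then have "x \<in># color_part (fst x) m" using that by (simp add: set_color_part)
    then have "x \<in> {fst x} \<times> {..<v (fst x)}" using m x unfolding monomials_in_def by blast
    then show ?thesis using x by (cases x) (simp add: grid_iff)
  qed
  moreover have b: "m \<in> bounded_kind sq a" using m sq by (auto simp: bounded_kind_iff monomials_in_def)
  moreover have "size m = top_degree a" using m full_iff[OF b] by (simp add: monomials_in_def)
  ultimately show "m \<in> {m \<in> bounded_kind sq a. set_mset m \<subseteq> grid (length a) v \<and> size m = top_degree a}" by blast
qed

lemma card_full_grid:
  "card {m \<in> bounded_kind sq a. set_mset m \<subseteq> grid (length a) v \<and> size m = top_degree a}
    = (\<Prod>t<length a. monomial_count sq (v t) (a ! t))"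
  unfolding full_grid
proof (subst card_by_color_parts)
  show "set_mset x \<subseteq> var_class t" if "x \<in> monomials_in sq t (v t) (a ! t)" for t x
    using that by (auto simp: monomials_in_def var_class_iff)
qed (simp add: card_monomials_in)

lemma finite_bounded_grid:
  "finite {m \<in> bounded_kind sq a. set_mset m \<subseteq> grid n v}"
proof (rule finite_subset)
  show "{m \<in> bounded_kind sq a. set_mset m \<subseteq> grid n v} \<subseteq> (\<Union>k\<le>top_degree a. multisets_of_size (grid n v) k)"
  proof
    fix m assume m: "m \<in> {m \<in> bounded_kind sq a. set_mset m \<subseteq> grid n v}"
    have "size m = (\<Sum>t<length a. size (color_part t m))"
      using m by (intro size_color_parts) (simp add: bounded_kind_iff)
    also have "\<dots> \<le> top_degree a" unfolding top_degree_def using m by (intro sum_mono) (simp add: bounded_kind_iff)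
    finally show "m \<in> (\<Union>k\<le>top_degree a. multisets_of_size (grid n v) k)"
      using m by (auto simp: multisets_of_size_def)
  qed
qed (use finite_grid in auto)

section \<open>Vertices of reverse-lexicographic objects and transfer of counterexamples\<close>

lemma lex_single: "lex_less {#y#} {#x#} \<longleftrightarrow> var_less y x"
proof
  assume "lex_less {#y#} {#x#}"
  then obtain w where w: "count {#y#} w < count {#x#} w" "\<And>u. var_less w u \<Longrightarrow> count {#y#} u = count {#x#} u"
    by (auto simp: lex_less_def)
  then have "w = x" "x \<noteq> y" by (auto split: if_splits)
  moreover have "\<not> var_less x y" using w(2)[of y] \<open>w = x\<close> \<open>x \<noteq> y\<close> by auto
  ultimately show "var_less y x" by (auto simp: var_less_def prod_eq_iff)
next
  assume a: "var_less y x"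
  then have "x \<noteq> y" by (auto simp: var_less_def)
  moreover have "u \<noteq> x \<and> u \<noteq> y" if "var_less x u" for u using a that by (auto simp: var_less_def)
  ultimately show "lex_less {#y#} {#x#}" unfolding lex_less_def by (auto intro!: exI[of _ x])
qed

lemma single_bounded:
  "\<forall>t<length a. 0 < a ! t \<Longrightarrow> {#x#} \<in> bounded_kind sq a \<longleftrightarrow> x \<in> all_vars (length a)"
  by (auto simp: bounded_kind_iff monomial_part_def var_class_iff Suc_le_eq)

lemma single_degree_part: "degree_part M 1 = (\<lambda>x. {#x#}) ` {x. {#x#} \<in> M}"
  by (auto simp: degree_part_def size_1_singleton_mset image_iff) (metis size_1_singleton_mset One_nat_def)

lemma card_degree_part_1: "card (degree_part M 1) = card {x. {#x#} \<in> M}"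
  unfolding single_degree_part by (rule card_image) (simp add: inj_on_def)

lemma revlex_closedD:
  assumes "revlex_kind sq a M" "m \<in> M" "m' \<in> bounded_kind sq a" "lex_less m' m"
  shows "m' \<in> M"
  using assms unfolding revlex_kind_def revlex_closed_in_def revlex_less_def lex_less_def by blast

text \<open>Positive bounds admit every variable in degree 1. The vertices therefore form an initial
  segment of the variables, and such a segment is determined by its size.\<close>

lemma revlex_vertices:
  assumes pos: "\<forall>t<length a. 0 < a ! t" and M: "revlex_kind sq a M"
    and W: "finite W" "W \<subseteq> all_vars (length a)"
      "\<And>x y. x \<in> W \<Longrightarrow> y \<in> all_vars (length a) \<Longrightarrow> var_less y x \<Longrightarrow> y \<in> W"
    and cd: "card (degree_part M 1) = card W"
  shows "{x. {#x#} \<in> M} = W" and "\<And>m. m \<in> M \<Longrightarrow> set_mset m \<subseteq> W"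
proof -
  let ?D = "{x. {#x#} \<in> M}"
  have Mb: "M \<subseteq> bounded_kind sq a" using M by (simp add: revlex_kind_def)
  then have DV: "?D \<subseteq> all_vars (length a)" using single_bounded[OF pos] by blast
  have closed: "y \<in> ?D" if "x \<in> ?D" "y \<in> all_vars (length a)" "var_less y x" for x y
    using revlex_closedD[OF M] that single_bounded[OF pos] lex_single by blast
  have finD: "finite ?D"
  proof (rule finite_imageD[of "\<lambda>x. {#x#}"])
    show "finite ((\<lambda>x. {#x#}) ` ?D)"
      using M by (auto simp: revlex_kind_def intro: finite_subset[of _ M])
  qed (simp add: inj_on_def)
  have "?D \<subseteq> W \<or> W \<subseteq> ?D"
  proof (rule ccontr)
    assume "\<not> ?thesis"
    then obtain x y where xy: "x \<in> ?D" "x \<notin> W" "y \<in> W" "y \<notin> ?D" by blast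
    then have "x \<noteq> y" by blast
    then have "var_less x y \<or> var_less y x" by (auto simp: var_less_def prod_eq_iff)
    then show False using xy closed[of x y] W(2,3) DV by blast
  qed
  then show D: "?D = W"
    using cd W(1) finD card_degree_part_1[of M] by (metis card_subset_eq)
  have mc: "multicomplex_on (all_vars (length a)) M" using M by (simp add: revlex_kind_def)
  show "set_mset m \<subseteq> W" if "m \<in> M" for m
  proof
    fix x assume "x \<in># m"
    then have "{#x#} \<subseteq># m" by simp
    then have "{#x#} \<in> M" using mc that unfolding multicomplex_on_def by blast
    then show "x \<in> W" using D by blast
  qed
qed

lemma lex_total:
  assumes "set_mset m \<subseteq> all_vars n" "set_mset m' \<subseteq> all_vars n" "0 < n" "size m = size m'" "m \<noteq> m'"
  shows "lex_less m m' \<or> lex_less m' m"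
proof -
  obtain k k' where k: "m = image_mset (to_var n) k" "m' = image_mset (to_var n) k'"
    using to_var_surj[OF assms(3)] assms(1,2) by metis
  then have "k \<noteq> k'" using assms(5) by auto
  then have "k < k' \<or> k' < k" by (metis linorder_neqE)
  then show ?thesis using lex_to_var[OF assms(3)] k assms(4) by simp
qed

text \<open>Counterexamples are built from variables, but the theorem quantifies over sets of one
  arbitrary infinite type; an injection on the finite set \<open>W\<close> moves them there. Each
  colour must occur in \<open>W\<close> because the classes of an ordered partition are nonempty.
  The last two conclusions are implications meant for complexes.\<close>

lemma transport_multicomplex:
  fixes a :: "nat list"
  assumes inf: "infinite (UNIV :: 'v set)" and ne: "a \<noteq> []" and M: "divisor_closed M" "M \<subseteq> bounded_monomials a"
    and W: "finite W" "W \<subseteq> all_vars (length a)" "\<And>t. t < length a \<Longrightarrow> \<exists>x\<in>W. fst x = t"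
      "\<And>m. m \<in> M \<Longrightarrow> set_mset m \<subseteq> W"
  obtains X :: "'v set" and M' P where "colored_multicomplex a X M' P" "finite M'" "finite X"
    "\<And>d. card (degree_part M' d) = card (degree_part M d)"
    "\<And>y. y \<in> X \<Longrightarrow> (\<And>x. x \<in> W \<Longrightarrow> {#x#} \<in> M) \<Longrightarrow> {#y#} \<in> M'"
    "\<And>m y. m \<in> M' \<Longrightarrow> (\<And>m x. m \<in> M \<Longrightarrow> count m x \<le> 1) \<Longrightarrow> count m y \<le> 1"
proof -
  obtain Y :: "'v set" where Y: "finite Y" "card Y = card W"
    using infinite_arbitrarily_large[OF inf] by blast
  then obtain f where "bij_betw f W Y" using finite_same_card_bij[OF W(1) Y(1)] by auto
  then have f: "inj_on f W" by (rule bij_betw_imp_inj_on)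
  note emb = embed_multicomplex[OF f M(1) W(4)]
  define n where "n = length a"
  define V where "V t = f ` {x \<in> W. fst x = t}" for t
  define P where "P = map V [0..<n]"
  define X where "X = f ` W"
  define M' where "M' = image_mset f ` M"
  have n: "0 < n" using ne by (simp add: n_def)
  have op: "ordered_partition X P"
    unfolding ordered_partition_def
  proof (intro conjI allI impI ballI)
    show "X \<noteq> {}" using W(3)[of 0] n by (auto simp: X_def n_def)
    have "X \<subseteq> (\<Union>t<n. V t)"
    proof
      fix y assume "y \<in> X"
      then obtain x where x: "x \<in> W" "y = f x" by (auto simp: X_def)
      then have "fst x < n" using W(2) by (auto simp: all_vars_iff n_def)
      then show "y \<in> (\<Union>t<n. V t)" using x by (intro UN_I[of "fst x"]) (auto simp: V_def)
    qed
    moreover have "(\<Union>t<n. V t) \<subseteq> X" by (auto simp: V_def X_def)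
    moreover have "\<Union> (set P) = (\<Union>t<n. V t)" by (simp add: P_def atLeast0LessThan)
    ultimately show "\<Union> (set P) = X" by blast
    show "B \<noteq> {}" if "B \<in> set P" for B
    proof -
      have "\<exists>t<n. B = V t" using that by (auto simp: P_def)
      then obtain t where t: "t < n" "B = V t" by blast
      then obtain x where "x \<in> W" "fst x = t" using W(3) n_def by blast
      then have "f x \<in> B" using t(2) by (simp add: V_def)
      then show ?thesis by blast
    qed
    fix i j assume "i < length P" "j < length P" "i \<noteq> j"
    then show "P ! i \<inter> P ! j = {}" using f by (auto simp: P_def V_def inj_on_def)
  qed
  have part: "size (monomial_part (image_mset f m) (P ! t)) = size (color_part t m)" if "m \<in> M" "t < n" for m t
  proof -
    have "filter_mset (\<lambda>x. f x \<in> P ! t) m = filter_mset (\<lambda>x. fst x = t) m"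
    proof (rule filter_mset_cong[OF refl])
      fix x assume "x \<in># m"
      then have "x \<in> W" using W(4)[OF that(1)] by blast
      then show "f x \<in> P ! t \<longleftrightarrow> fst x = t" using that(2) f by (auto simp: P_def V_def inj_on_def)
    qed
    then show ?thesis by (simp add: monomial_part_def filter_mset_image_mset comp_def var_class_iff)
  qed
  have "set_mset m \<subseteq> X" if "m \<in> M'" for m
    using that image_mono[OF W(4), of _ f] unfolding M'_def X_def by (elim imageE) simp
  moreover have "divisor_closed M'" using emb(1) by (simp add: M'_def)
  ultimately have "multicomplex_on X M'"
    using op by (simp add: multicomplex_on_def divisor_closed_def ordered_partition_def)
  have "\<forall>m\<in>M'. \<forall>i<length a. size (monomial_part m (P ! i)) \<le> a ! i"
    using part M(2) by (auto simp: M'_def n_def bounded_monomials_def)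
  with \<open>multicomplex_on X M'\<close> have "colored_multicomplex a X M' P"
    using op by (simp add: colored_multicomplex_def P_def n_def)
  moreover have "finite M'" using emb(1) by (simp add: M'_def divisor_closed_def)
  moreover have "finite X" using W(1) by (simp add: X_def)
  moreover have "card (degree_part M' d) = card (degree_part M d)" for d using emb(2) by (simp add: M'_def)
  moreover have "{#y#} \<in> M'" if y: "y \<in> X" and s: "\<And>x. x \<in> W \<Longrightarrow> {#x#} \<in> M" for y
  proof -
    obtain x where "x \<in> W" "y = f x" using y by (auto simp: X_def)
    then show ?thesis using s[of x] unfolding M'_def by (intro image_eqI[of _ _ "{#x#}"]) auto
  qed
  moreover have "count m y \<le> 1" if m: "m \<in> M'" and sq: "\<And>m x. m \<in> M \<Longrightarrow> count m x \<le> 1" for m y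
  proof -
    obtain m0 where m0: "m0 \<in> M" "m = image_mset f m0" using m by (auto simp: M'_def)
    have "inj_on f (set_mset m0)" using f W(4)[OF m0(1)] by (rule inj_on_subset)
    then show ?thesis unfolding m0(2) using sq[OF m0(1)] by (rule squarefree_image_mset)
  qed
  ultimately show ?thesis by (rule that)
qed

lemma card_set_mset_le_size: "card (set_mset m) \<le> size m"
proof -
  have "card (set_mset m) = (\<Sum>x\<in>set_mset m. 1)" by simp
  also have "\<dots> \<le> (\<Sum>x\<in>set_mset m. count m x)" by (intro sum_mono) (simp add: Suc_le_eq)
  finally show ?thesis by (simp add: size_multiset_overloaded_eq)
qed

lemma multicomplex_obstruction:
  fixes a :: "nat list"
  assumes inf: "infinite (UNIV :: 'v set)" and ne: "a \<noteq> []" and M: "divisor_closed M" "M \<subseteq> bounded_kind False a"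
    and W: "finite W" "W \<subseteq> all_vars (length a)" "\<And>t. t < length a \<Longrightarrow> \<exists>x\<in>W. fst x = t"
      "\<And>m. m \<in> M \<Longrightarrow> set_mset m \<subseteq> W"
    and ex: "\<forall>(X :: 'v set) M P. colored_multicomplex a X M P \<and> finite M \<longrightarrow>
         (\<exists>M'. revlex_multicomplex a M' \<and> multicomplex_f_vector M' = multicomplex_f_vector M)"
  obtains M' where "revlex_kind False a M'" "\<And>d. card (degree_part M' d) = card (degree_part M d)"
proof -
  have Mb: "M \<subseteq> bounded_monomials a" using M(2) by (auto simp: bounded_kind_def)
  obtain X :: "'v set" and M1 P where 1: "colored_multicomplex a X M1 P" "finite M1"
    "\<And>d. card (degree_part M1 d) = card (degree_part M d)"
    using transport_multicomplex[OF inf ne M(1) Mb W] by metis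
  then obtain M' where M': "revlex_multicomplex a M'" "multicomplex_f_vector M' = multicomplex_f_vector M1"
    using ex by metis
  have "card (degree_part M' d) = card (degree_part M d)" for d
    using M'(2) 1(3) by (simp add: multicomplex_f_vector_eq[symmetric])
  then show ?thesis using that M'(1) revlex_kind_False by blast
qed

text \<open>The assumption \<open>single\<close> makes all of \<open>W\<close> vertices, as a
  simplicial complex demands. Degree 0 is excluded because the f-vector of a complex does not count
  the empty face.\<close>

lemma complex_obstruction:
  fixes a :: "nat list"
  assumes inf: "infinite (UNIV :: 'v set)" and ne: "a \<noteq> []" and M: "divisor_closed M" "M \<subseteq> bounded_kind True a"
    and W: "finite W" "W \<subseteq> all_vars (length a)" "\<And>t. t < length a \<Longrightarrow> \<exists>x\<in>W. fst x = t"
      "\<And>m. m \<in> M \<Longrightarrow> set_mset m \<subseteq> W" and single: "\<And>x. x \<in> W \<Longrightarrow> {#x#} \<in> M"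
    and ex: "\<forall>(V :: 'v set) \<Delta> P. colored_complex a V \<Delta> P \<longrightarrow>
         (\<exists>M. revlex_complex a M \<and> complex_f_vector (set_mset ` M) = complex_f_vector \<Delta>)"
  obtains M' where "revlex_kind True a M'" "\<And>d. 0 < d \<Longrightarrow> card (degree_part M' d) = card (degree_part M d)"
proof -
  have Mb: "M \<subseteq> bounded_monomials a" using M(2) by (auto simp: bounded_kind_def)
  have sq: "count m x \<le> 1" if "m \<in> M" for m x using M(2) that by (auto simp only: bounded_kind_def)
  obtain X :: "'v set" and M1 P where 1: "colored_multicomplex a X M1 P" "finite M1" "finite X"
    "\<And>d. card (degree_part M1 d) = card (degree_part M d)"
    "\<And>y. y \<in> X \<Longrightarrow> {#y#} \<in> M1" "\<And>m y. m \<in> M1 \<Longrightarrow> count m y \<le> 1"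
  proof -
    assume *: "\<And>(X :: 'v set) M1 P. colored_multicomplex a X M1 P \<Longrightarrow> finite M1 \<Longrightarrow> finite X \<Longrightarrow>
      (\<And>d. card (degree_part M1 d) = card (degree_part M d)) \<Longrightarrow> (\<And>y. y \<in> X \<Longrightarrow> {#y#} \<in> M1) \<Longrightarrow>
      (\<And>m y. m \<in> M1 \<Longrightarrow> count m y \<le> 1) \<Longrightarrow> thesis"
    show thesis
    proof (rule transport_multicomplex[OF inf ne M(1) Mb W])
      fix X :: "'v set" and M1 P
      assume t: "colored_multicomplex a X M1 P" "finite M1" "finite X"
        "\<And>d. card (degree_part M1 d) = card (degree_part M d)"
        "\<And>y. y \<in> X \<Longrightarrow> (\<And>x. x \<in> W \<Longrightarrow> {#x#} \<in> M) \<Longrightarrow> {#y#} \<in> M1"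
        "\<And>m y. m \<in> M1 \<Longrightarrow> (\<And>m x. m \<in> M \<Longrightarrow> count m x \<le> 1) \<Longrightarrow> count m y \<le> 1"
      show thesis by (rule *[OF t(1-4)]) (use t(5,6) single sq in blast)+
    qed
  qed
  let ?D = "set_mset ` M1"
  have ms: "mset_set (set_mset m) = m" if "m \<in> M1" for m using 1(6)[OF that] by (rule squarefree_mset_set)
  have mc: "multicomplex_on X M1" using 1(1) by (simp add: colored_multicomplex_def)
  have "simplicial_complex_on X ?D"
    unfolding simplicial_complex_on_def
  proof (intro conjI ballI allI impI)
    show "finite X" by (rule 1(3))
    show "X \<noteq> {}" "?D \<subseteq> Pow X" using mc by (auto simp: multicomplex_on_def)
    show "{v} \<in> ?D" if "v \<in> X" for v using 1(5)[OF that] by (intro image_eqI[of _ _ "{#v#}"]) auto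
    fix F G assume "F \<in> ?D" "G \<subseteq> F"
    then obtain m where m: "m \<in> M1" "F = set_mset m" by blast
    have "finite G" using \<open>G \<subseteq> F\<close> m(2) by (auto intro: finite_subset)
    have "mset_set G \<subseteq># mset_set (set_mset m)" using \<open>G \<subseteq> F\<close> m(2) by (intro subset_imp_msubset_mset_set) auto
    then have "mset_set G \<in> M1" using mc m(1) ms unfolding multicomplex_on_def by metis
    then show "G \<in> ?D" using \<open>finite G\<close> by (intro image_eqI[of _ _ "mset_set G"]) auto
  qed
  moreover have "card (F \<inter> P ! i) \<le> a ! i" if "F \<in> ?D" "i < length a" for F i
  proof -
    have "\<exists>m\<in>M1. F = set_mset m" using that(1) by blast
    then obtain m where m: "m \<in> M1" "F = set_mset m" by blast
    have "F \<inter> P ! i = set_mset (monomial_part m (P ! i))" using m(2) by (auto simp: monomial_part_def)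
    then have "card (F \<inter> P ! i) \<le> size (monomial_part m (P ! i))" by (simp add: card_set_mset_le_size)
    also have "\<dots> \<le> a ! i" using 1(1) m(1) that(2) by (simp add: colored_multicomplex_def)
    finally show ?thesis .
  qed
  ultimately have "colored_complex a X ?D P"
    using 1(1) by (simp add: colored_complex_def colored_multicomplex_def)
  then obtain M' where M': "revlex_complex a M'" "complex_f_vector (set_mset ` M') = complex_f_vector ?D"
    using ex by blast
  have "card (degree_part M' d) = card (degree_part M d)" if "0 < d" for d
  proof -
    have sq': "count m x \<le> 1" if "m \<in> M'" for m x
    proof -
      have "m \<in> bounded_squarefree_monomials a" using M'(1) that by (auto simp only: revlex_complex_def)
      then show ?thesis by (simp only: bounded_squarefree_monomials_def mem_Collect_eq)
    qed
    have "card {F \<in> set_mset ` M'. card F = d} = card {F \<in> ?D. card F = d}"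
      using complex_f_vector_nth[OF M'(2) _ _ that] M'(1) 1(2) by (simp add: revlex_complex_def)
    moreover have "card {F \<in> set_mset ` M'. card F = d} = card (degree_part M' d)"
      by (rule card_faces) (rule sq')
    moreover have "card {F \<in> ?D. card F = d} = card (degree_part M1 d)"
      by (rule card_faces) (rule 1(6))
    ultimately show ?thesis using 1(4) by simp
  qed
  then show ?thesis using that M'(1) revlex_kind_True by blast
qed

section \<open>Unequal bounds\<close>

definition grid_monomials :: "bool \<Rightarrow> nat list \<Rightarrow> (nat \<Rightarrow> nat) \<Rightarrow> var multiset set" where
  "grid_monomials sq a v = {m \<in> bounded_kind sq a. set_mset m \<subseteq> grid (length a) v}"

lemma divisor_closed_restrict:
  assumes "finite M" "M = {m \<in> bounded_kind sq a. Q m}" "Q {#}" "\<And>m m'. Q m \<Longrightarrow> m' \<subseteq># m \<Longrightarrow> Q m'"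
  shows "divisor_closed M"
proof -
  have "{#} \<in> bounded_kind sq a" by (simp add: bounded_kind_iff monomial_part_def)
  then show ?thesis using assms bounded_kind_down unfolding divisor_closed_def by blast
qed

lemma grid_monomials_divisor_closed: "divisor_closed (grid_monomials sq a v)"
proof (rule divisor_closed_restrict)
  show "finite (grid_monomials sq a v)" unfolding grid_monomials_def by (rule finite_bounded_grid)
  show "grid_monomials sq a v = {m \<in> bounded_kind sq a. set_mset m \<subseteq> grid (length a) v}"
    by (simp add: grid_monomials_def)
qed (auto dest: set_mset_mono)

lemma grid_subset: "grid n v \<subseteq> all_vars n"
  by (auto simp: grid_iff all_vars_iff)

lemma card_grid_monomials_1:
  assumes "\<forall>t<length a. 0 < a ! t"
  shows "card (degree_part (grid_monomials sq a v) 1) = card (grid (length a) v)"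
proof -
  have "{x. {#x#} \<in> grid_monomials sq a v} = grid (length a) v"
    using single_bounded[OF assms] grid_subset[of "length a" v] by (auto simp: grid_monomials_def)
  then show ?thesis by (simp only: card_degree_part_1)
qed

lemma card_grid_monomials_top:
  "card (degree_part (grid_monomials sq a v) (top_degree a)) = (\<Prod>t<length a. monomial_count sq (v t) (a ! t))"
proof -
  have "degree_part (grid_monomials sq a v) (top_degree a)
      = {m \<in> bounded_kind sq a. set_mset m \<subseteq> grid (length a) v \<and> size m = top_degree a}"
    by (auto simp: degree_part_def grid_monomials_def)
  then show ?thesis by (simp only: card_full_grid)
qed

text \<open>Moving one variable from the smaller bound \<open>b\<close> to the larger bound \<open>A\<close> pays off once both
  colours have \<open>A + 1\<close> variables.\<close>

lemma monomial_count_shift: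
  assumes "0 < b" "b < A"
  shows "monomial_count sq (A + 1) A * monomial_count sq (A + 1) b
    < monomial_count sq (A + 2) A * monomial_count sq A b"
proof (cases sq)
  case True
  define x where "x = (A + 1) choose A"
  define y where "y = A choose b"
  have x: "2 * ((A + 2) choose A) = (A + 2) * x"
    using binomial_absorb_comp[of "A + 2" A] by (simp add: x_def)
  have y: "(A + 1 - b) * ((A + 1) choose b) = (A + 1) * y"
    using binomial_absorb_comp[of "A + 1" b] by (simp add: y_def)
  have "0 < x" "0 < y" using assms by (simp_all add: x_def y_def)
  \<comment> \<open>From \<open>b < A\<close> the factor \<open>A + 1 - b\<close> in
    \<open>y\<close> is at least 2; the gain is then that of \<open>A + 2\<close> over
    \<open>A + 1\<close>.\<close>
  have "2 * ((A + 1) choose b) \<le> (A + 1) * y"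
    unfolding y[symmetric] using assms by (intro mult_le_mono1) simp
  then have "x * (2 * ((A + 1) choose b)) \<le> x * ((A + 1) * y)" by (rule mult_le_mono2)
  also have "\<dots> < (A + 2) * x * y" using \<open>0 < x\<close> \<open>0 < y\<close> by (simp add: algebra_simps)
  also have "\<dots> = 2 * ((A + 2) choose A) * y" by (simp only: x)
  finally have "x * ((A + 1) choose b) < ((A + 2) choose A) * y" by simp
  then show ?thesis using True by (simp add: monomial_count_def x_def y_def)
next
  case False
  define x where "x = (2 * A) choose A"
  define y where "y = (A + b - 1) choose b"
  have x: "(A + 1) * ((2 * A + 1) choose A) = (2 * A + 1) * x"
    using binomial_absorb_comp[of "2 * A + 1" A] by (simp add: x_def)
  have y: "A * ((A + b) choose b) = (A + b) * y"
    using binomial_absorb_comp[of "A + b" b] by (simp add: y_def)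
  have "0 < x" "0 < y" using assms by (simp_all add: x_def y_def)
  have "(A + b) * (A + 1) < (2 * A + 1) * A"
  proof -
    \<comment> \<open>With \<open>b\<close> at most \<open>A - 1\<close> both sides are compared
      through \<open>2 A^2 + A - 1 < 2 A^2 + A\<close>.\<close>
    have "(A + b) * (A + 1) \<le> (2 * A - 1) * (A + 1)" using assms by (intro mult_le_mono1) simp
    also have "\<dots> < (2 * A + 1) * A"
    proof -
      obtain k where "A = Suc k" using assms by (cases A) auto
      then show ?thesis by (simp add: algebra_simps)
    qed
    finally show ?thesis .
  qed
  then have "((A + b) * (A + 1)) * (x * y) < ((2 * A + 1) * A) * (x * y)"
    using \<open>0 < x\<close> \<open>0 < y\<close> by (intro mult_strict_right_mono) auto
  then have "(A * (A + 1)) * (x * ((A + b) choose b)) < (A * (A + 1)) * (((2 * A + 1) choose A) * y)"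
  proof -
    have "(A * (A + 1)) * (x * ((A + b) choose b)) = (A * ((A + b) choose b)) * ((A + 1) * x)"
      by (simp only: ac_simps)
    also have "\<dots> = ((A + b) * (A + 1)) * (x * y)" unfolding y by (simp only: ac_simps)
    also have "\<dots> < ((2 * A + 1) * A) * (x * y)" by fact
    also have "\<dots> = (A * y) * ((2 * A + 1) * x)" by (simp only: ac_simps)
    also have "\<dots> = (A * (A + 1)) * (((2 * A + 1) choose A) * y)" unfolding x[symmetric] by (simp only: ac_simps)
    finally show ?thesis .
  qed
  then have "x * ((A + b) choose b) < ((2 * A + 1) choose A) * y" by simp
  moreover have "A + 2 + A - 1 = 2 * A + 1" "A + 1 + A - 1 = 2 * A" "A + 1 + b - 1 = A + b" by simp_all
  ultimately show ?thesis using False by (simp add: monomial_count_def x_def y_def mult_2)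
qed

lemma monomial_count_pos: "k \<le> v \<Longrightarrow> 0 < v \<Longrightarrow> 0 < monomial_count sq v k"
  by (auto simp: monomial_count_def)

text \<open>Despite the name these are numbers of variables per colour. Their total is that of the
  balanced choice \<open>A + 1\<close>, which is large enough for every colour to reach its
  bound.\<close>

definition shifted_bounds :: "nat \<Rightarrow> nat \<Rightarrow> nat \<Rightarrow> nat \<Rightarrow> nat" where
  "shifted_bounds A c e t = (if t = c then A + 2 else if t = e then A else A + 1)"

lemma unequal_no_revlex:
  assumes pos: "\<forall>t<length a. 0 < a ! t" and c: "c < length a" "a ! c = A" "\<forall>t<length a. a ! t \<le> A"
    and e: "e < length a" "a ! e < A" and M: "revlex_kind sq a M"
    and f: "\<And>d. 0 < d \<Longrightarrow> card (degree_part M d) = card (degree_part (grid_monomials sq a (shifted_bounds A c e)) d)"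
  shows False
proof -
  let ?v = "shifted_bounds A c e"
  let ?n = "length a"
  have ce: "c \<noteq> e" using c e by auto
  have rm: "{..<?n} = insert c (insert e ({..<?n} - {c, e}))" using c(1) e(1) by auto
  have v: "?v c = A + 2" "?v e = A" "\<And>t. t \<in> {..<?n} - {c, e} \<Longrightarrow> ?v t = A + 1"
    using ce by (auto simp: shifted_bounds_def)
  have "(\<Sum>t<?n. ?v t) = (\<Sum>t<?n. A + 1)"
  proof -
    have "(\<Sum>t<?n. ?v t) = ?v c + (?v e + (\<Sum>t\<in>{..<?n} - {c, e}. ?v t))"
      by (subst rm) (use ce in simp)
    also have "\<dots> = (A + 1) + ((A + 1) + (\<Sum>t\<in>{..<?n} - {c, e}. A + 1))" using v by simp
    also have "(A + 1) + ((A + 1) + (\<Sum>t\<in>{..<?n} - {c, e}. A + 1)) = (\<Sum>t<?n. A + 1)"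
      by (subst (2) rm) (use ce in simp)
    finally show ?thesis .
  qed
  then have "card (degree_part M 1) = card (grid ?n (\<lambda>_. A + 1))"
    using f[of 1] card_grid_monomials_1[OF pos] by (simp add: card_grid)
  moreover have "y \<in> grid ?n (\<lambda>_. A + 1)"
    if "x \<in> grid ?n (\<lambda>_. A + 1)" "y \<in> all_vars ?n" "var_less y x" for x y
    using that by (auto simp: grid_iff all_vars_iff var_less_def)
  \<comment> \<open>The balanced grid is an initial segment of the variables with the prescribed
    number of vertices, so \<open>M\<close> lives on it.\<close>
  ultimately have "M \<subseteq> grid_monomials sq a (\<lambda>_. A + 1)"
    using revlex_vertices(2)[OF pos M finite_grid grid_subset, of "\<lambda>_. A + 1"] M
    unfolding grid_monomials_def revlex_kind_def by blast
  then have "card (degree_part M (top_degree a)) \<le> card (degree_part (grid_monomials sq a (\<lambda>_. A + 1)) (top_degree a))"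
    using grid_monomials_divisor_closed[of sq a] by (intro card_mono) (auto simp: degree_part_def divisor_closed_def)
  also have "\<dots> = (\<Prod>t<?n. monomial_count sq (A + 1) (a ! t))" by (rule card_grid_monomials_top)
  also have "\<dots> < (\<Prod>t<?n. monomial_count sq (?v t) (a ! t))"
  proof -
    let ?R = "\<Prod>t\<in>{..<?n} - {c, e}. monomial_count sq (A + 1) (a ! t)"
    \<comment> \<open>No factor vanishes, because \<open>A\<close> bounds all entries and each
      colour has \<open>A + 1\<close> variables.\<close>
    have "0 < ?R" using c(3) by (intro prod_pos ballI monomial_count_pos) (auto simp: le_SucI)
    have "(\<Prod>t<?n. monomial_count sq (A + 1) (a ! t))
        = (monomial_count sq (A + 1) A * monomial_count sq (A + 1) (a ! e)) * ?R"
      by (subst rm) (use ce c(2) in simp)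
    also have "\<dots> < (monomial_count sq (A + 2) A * monomial_count sq A (a ! e)) * ?R"
      using monomial_count_shift[of "a ! e" A sq] pos e \<open>0 < ?R\<close> by (intro mult_strict_right_mono) auto
    also have "\<dots> = (\<Prod>t<?n. monomial_count sq (?v t) (a ! t))"
    proof -
      have "?R = (\<Prod>t\<in>{..<?n} - {c, e}. monomial_count sq (?v t) (a ! t))"
        using v(3) by (intro prod.cong) auto
      then show ?thesis by (subst (2) rm) (use ce c(2) v in simp)
    qed
    finally show ?thesis .
  qed
  also have "\<dots> = card (degree_part (grid_monomials sq a ?v) (top_degree a))"
    by (rule card_grid_monomials_top[symmetric])
  also have "\<dots> = card (degree_part M (top_degree a))"
  proof -
    have "a ! c \<le> top_degree a" unfolding top_degree_def using c(1) by (intro member_le_sum) auto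
    then show ?thesis using f[of "top_degree a"] pos c(1) by force
  qed
  finally show False by simp
qed

lemma grid_meets_colors: "(\<And>t. t < n \<Longrightarrow> 0 < v t) \<Longrightarrow> t < n \<Longrightarrow> \<exists>x\<in>grid n v. fst x = t"
  by (intro bexI[of _ "(t, 0)"]) (auto simp: grid_iff)

lemma unequal_not_all:
  fixes a :: "nat list"
  assumes inf: "infinite (UNIV :: 'v set)" and pos: "\<forall>t<length a. 0 < a ! t"
    and ij: "i < length a" "j < length a" "a ! i \<noteq> a ! j"
  shows "\<not> (\<forall>(V :: 'v set) \<Delta> P. colored_complex a V \<Delta> P \<longrightarrow>
         (\<exists>M. revlex_complex a M \<and> complex_f_vector (set_mset ` M) = complex_f_vector \<Delta>))"
    and "\<not> (\<forall>(X :: 'v set) M P. colored_multicomplex a X M P \<and> finite M \<longrightarrow>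
         (\<exists>M'. revlex_multicomplex a M' \<and> multicomplex_f_vector M' = multicomplex_f_vector M))"
proof -
  have ne: "a \<noteq> []" using ij by auto
  define A where "A = Max (set a)"
  have le: "\<forall>t<length a. a ! t \<le> A" by (simp add: A_def)
  have "A \<in> set a" unfolding A_def using ne by (intro Max_in) auto
  then obtain c where c: "c < length a" "a ! c = A" by (auto simp: in_set_conv_nth)
  obtain e where e: "e < length a" "a ! e < A" using ij le by (metis le_neq_implies_less)
  let ?W = "grid (length a) (shifted_bounds A c e)"
  let ?M = "\<lambda>sq. grid_monomials sq a (shifted_bounds A c e)"
  have A: "0 < A" using e by simp
  have W: "finite ?W" "?W \<subseteq> all_vars (length a)" "\<And>t. t < length a \<Longrightarrow> \<exists>x\<in>?W. fst x = t"
    using finite_grid grid_subset grid_meets_colors[of "length a" "shifted_bounds A c e"] A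
    by (auto simp: shifted_bounds_def)
  have M: "divisor_closed (?M sq)" "?M sq \<subseteq> bounded_kind sq a" "\<And>m. m \<in> ?M sq \<Longrightarrow> set_mset m \<subseteq> ?W" for sq
    using grid_monomials_divisor_closed by (auto simp: grid_monomials_def)
  have single: "{#x#} \<in> ?M sq" if "x \<in> ?W" for x sq
    using that single_bounded[OF pos] W(2) by (auto simp: grid_monomials_def)
  show "\<not> (\<forall>(V :: 'v set) \<Delta> P. colored_complex a V \<Delta> P \<longrightarrow>
         (\<exists>M. revlex_complex a M \<and> complex_f_vector (set_mset ` M) = complex_f_vector \<Delta>))"
  proof
    assume ex: "\<forall>(V :: 'v set) \<Delta> P. colored_complex a V \<Delta> P \<longrightarrow>
         (\<exists>M. revlex_complex a M \<and> complex_f_vector (set_mset ` M) = complex_f_vector \<Delta>)"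
    show False
    proof (rule complex_obstruction[OF inf ne M(1,2) W M(3) single ex])
      fix M' assume "revlex_kind True a M'" "\<And>d. 0 < d \<Longrightarrow> card (degree_part M' d) = card (degree_part (?M True) d)"
      then show False using unequal_no_revlex[OF pos c le e] by blast
    qed
  qed
  show "\<not> (\<forall>(X :: 'v set) M P. colored_multicomplex a X M P \<and> finite M \<longrightarrow>
         (\<exists>M'. revlex_multicomplex a M' \<and> multicomplex_f_vector M' = multicomplex_f_vector M))"
  proof
    assume ex: "\<forall>(X :: 'v set) M P. colored_multicomplex a X M P \<and> finite M \<longrightarrow>
         (\<exists>M'. revlex_multicomplex a M' \<and> multicomplex_f_vector M' = multicomplex_f_vector M)"
    show False
    proof (rule multicomplex_obstruction[OF inf ne M(1,2) W M(3) ex])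
      fix M' assume "revlex_kind False a M'" "\<And>d. card (degree_part M' d) = card (degree_part (?M False) d)"
      then show False using unequal_no_revlex[OF pos c le e] by blast
    qed
  qed
qed

section \<open>Equal bounds: complexes\<close>

locale equal_bounds =
  fixes a :: "nat list" and n b :: nat
  assumes len: "length a = n" and n: "2 \<le> n" and b: "2 \<le> b" and nth: "\<And>t. t < n \<Longrightarrow> a ! t = b"
begin

lemma pos: "\<forall>t<length a. 0 < a ! t"
  using nth b len by simp

lemma ne: "a \<noteq> []"
  using len n by auto

lemma top: "top_degree a = n * b"
  using nth by (simp add: top_degree_def len)

lemma colors: "{..<n} = insert (n - 1) (insert (n - 2) {..<n - 2})"
  using n by auto

lemma prod_colors: "(\<Prod>t<n. g t) = g (n - 1) * (g (n - 2) * (\<Prod>t<n - 2. g t))" for g :: "nat \<Rightarrow> nat"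
proof -
  have "n - 1 \<notin> insert (n - 2) {..<n - 2}" "n - 2 \<notin> {..<n - 2}" using n by auto
  then show ?thesis by (subst colors) simp
qed

lemma count_bounds: "monomial_count True (b + 1) b = b + 1" "monomial_count True b b = 1"
    "monomial_count False 2 b = b + 1" "monomial_count False 1 b = 1"
  by (simp_all add: monomial_count_def)

text \<open>Each colour has \<open>b\<close> vertices, just enough for one facet. Among variables of
  equal index those of larger colour number are smaller, so giving the extra vertices to the last
  two colours keeps the grid an initial segment.\<close>

definition cv :: "nat \<Rightarrow> nat" where
  "cv t = (if n - 2 \<le> t then b + 1 else b)"

text \<open>Two colours get one vertex more than necessary and a pair of equal colour is forbidden. A
  reverse-lexicographic complex with as many vertices and edges must omit the last pair \<open>{w, z}\<close> of
  differently coloured vertices, which leaves \<open>2 b + 1\<close> facets instead of \<open>2 b + 2\<close>.\<close>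

definition split_complex :: "var multiset set" where
  "split_complex = {m \<in> bounded_kind True a. set_mset m \<subseteq> grid n cv \<and> \<not> ((n - 2, 0) \<in># m \<and> (n - 2, 1) \<in># m)}"

lemma split_complex_props: "divisor_closed split_complex" "split_complex \<subseteq> bounded_kind True a"
    "m \<in> split_complex \<Longrightarrow> set_mset m \<subseteq> grid n cv" "x \<in> grid n cv \<Longrightarrow> {#x#} \<in> split_complex"
    "{x. {#x#} \<in> split_complex} = grid n cv"
proof -
  show "divisor_closed split_complex"
  proof (rule divisor_closed_restrict)
    show "finite split_complex"
      by (rule finite_subset[OF _ finite_bounded_grid[of True a n cv]]) (auto simp: split_complex_def)
    show "split_complex = {m \<in> bounded_kind True a. set_mset m \<subseteq> grid n cv \<and> \<not> ((n - 2, 0) \<in># m \<and> (n - 2, 1) \<in># m)}"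
      by (simp add: split_complex_def)
  qed (auto dest: mset_subset_eqD)
  show "split_complex \<subseteq> bounded_kind True a" "m \<in> split_complex \<Longrightarrow> set_mset m \<subseteq> grid n cv"
    by (auto simp: split_complex_def)
  show s: "{#x#} \<in> split_complex" if "x \<in> grid n cv" for x
    using that single_bounded[OF pos] grid_subset[of n cv] len by (auto simp: split_complex_def)
  then show "{x. {#x#} \<in> split_complex} = grid n cv" by (auto simp: split_complex_def)
qed

lemma pair_bounded: "x \<in> grid n cv \<Longrightarrow> y \<in> grid n cv \<Longrightarrow> x \<noteq> y \<Longrightarrow> {#x, y#} \<in> bounded_kind True a"
  using b grid_subset[of n cv] nth len
  by (auto simp: bounded_kind_iff color_part_add_mset monomial_part_def[of "{#}"] all_vars_iff grid_iff)

text \<open>A facet omits exactly one vertex of colour \<open>n - 2\<close>, which may be vertex 0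
  or vertex 1; for colour \<open>n - 1\<close> there are \<open>b + 1\<close> choices, for the other
  colours only one.\<close>

lemma card_split_top: "2 * (b + 1) \<le> card (degree_part split_complex (top_degree a))"
proof -
  let ?F = "\<lambda>t. if t = n - 2 then {x \<in> monomials_in True t (cv t) (a ! t). \<not> ((n - 2, 0) \<in># x \<and> (n - 2, 1) \<in># x)}
    else monomials_in True t (cv t) (a ! t)"
  have q: "n - 2 < n" using n by simp
  have "degree_part split_complex (top_degree a) =
    {m \<in> {m \<in> bounded_kind True a. set_mset m \<subseteq> grid (length a) cv \<and> size m = top_degree a}.
      \<not> ((n - 2, 0) \<in># m \<and> (n - 2, 1) \<in># m)}"
    by (auto simp: degree_part_def split_complex_def len)
  also have "\<dots> = {m. set_mset m \<subseteq> all_vars n \<and> (\<forall>t<n. color_part t m \<in> ?F t)}"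
    unfolding full_grid unfolding len using q by (auto simp: set_color_part)
  finally have "card (degree_part split_complex (top_degree a)) = (\<Prod>t<n. card (?F t))"
    by (simp only:) (rule card_by_color_parts, auto simp: monomials_in_def var_class_iff split: if_splits)
  also have "\<dots> = card (?F (n - 1)) * (card (?F (n - 2)) * (\<Prod>t<n - 2. card (?F t)))"
    by (rule prod_colors)
  also have "card (?F (n - 1)) = b + 1"
  proof -
    have "n - 1 \<noteq> n - 2" "n - 1 < n" "cv (n - 1) = b + 1" using n by (auto simp: cv_def)
    then show ?thesis using nth count_bounds(1) by (simp add: card_monomials_in)
  qed
  also have "(\<Prod>t<n - 2. card (?F t)) = 1"
  proof (rule prod.neutral, intro ballI)
    fix t assume "t \<in> {..<n - 2}"
    then have "t \<noteq> n - 2" "t < n" "cv t = b" by (auto simp: cv_def)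
    then show "card (?F t) = 1" using nth count_bounds(2) by (simp add: card_monomials_in)
  qed
  finally have eq: "card (degree_part split_complex (top_degree a)) = (b + 1) * card (?F (n - 2))" by simp
  have "2 \<le> card (?F (n - 2))"
  proof -
    have cq: "cv (n - 2) = b + 1" "a ! (n - 2) = b" using nth[OF q] by (auto simp: cv_def)
    define D where "D i = mset_set ({n - 2} \<times> ({..<b + 1} - {i}))" for i
    have setD: "set_mset (D i) = {n - 2} \<times> ({..<b + 1} - {i})" for i by (simp add: D_def)
    have inD: "D i \<in> ?F (n - 2)" if "i < 2" for i
    proof -
      have "size (D i) = b" using that b by (simp add: D_def card_cartesian_product card_Diff_singleton)
      moreover have "count (D i) x \<le> 1" for x by (simp add: D_def count_mset_set')
      moreover have "\<not> ((n - 2, 0) \<in># D i \<and> (n - 2, 1) \<in># D i)" using that less_2_cases[OF that] by (auto simp: setD)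
      ultimately show ?thesis using setD[of i] cq by (auto simp: monomials_in_def)
    qed
    have "(n - 2, 0) \<in># D 1" "(n - 2, 0) \<notin># D 0" using b by (auto simp: setD)
    then have "D 0 \<noteq> D 1" by auto
    then have "card {D 0, D 1} = 2" by simp
    have "D 0 \<in> ?F (n - 2)" "D 1 \<in> ?F (n - 2)" by (rule inD, simp)+
    then have sub: "{D 0, D 1} \<subseteq> ?F (n - 2)" by blast
    have "finite (?F (n - 2))"
    proof -
      have "card (monomials_in True (n - 2) (cv (n - 2)) (a ! (n - 2))) = b + 1"
        using cq count_bounds(1) by (simp add: card_monomials_in)
      then have "finite (monomials_in True (n - 2) (cv (n - 2)) (a ! (n - 2)))"
        by (intro card_ge_0_finite) simp
      then show ?thesis by simp
    qed
    from card_mono[OF this sub] show ?thesis using \<open>card {D 0, D 1} = 2\<close> by linarith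
  qed
  then have "(b + 1) * 2 \<le> (b + 1) * card (?F (n - 2))" by (rule mult_le_mono2)
  then show ?thesis unfolding eq by linarith
qed

lemma no_revlex_complex:
  assumes M: "revlex_kind True a M"
    and f: "\<And>d. 0 < d \<Longrightarrow> card (degree_part M d) = card (degree_part split_complex d)"
  shows False
proof -
  let ?W = "grid n cv"
  \<comment> \<open>The second greatest and, next, the greatest vertex: at equal index the smaller
    colour number is greater.\<close>
  define w :: var where "w = (n - 1, b)"
  define z :: var where "z = (n - 2, b)"
  have wz: "w \<in> ?W" "z \<in> ?W" "w \<noteq> z" using n by (auto simp: w_def z_def grid_iff cv_def)
  have zmax: "\<not> var_less z x" if "x \<in> ?W" for x
    using that n by (auto simp: z_def grid_iff cv_def var_less_def split: if_splits)
  have wmax: "x = z" if "x \<in> ?W" "var_less w x" for x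
    using that n by (auto simp: z_def w_def grid_iff cv_def var_less_def prod_eq_iff split: if_splits)
  have Wdown: "y \<in> ?W" if "x \<in> ?W" "y \<in> all_vars (length a)" "var_less y x" for x y
    using that len by (auto simp: grid_iff all_vars_iff var_less_def cv_def split: if_splits)
  have "card (degree_part M 1) = card ?W"
    using f[of 1] split_complex_props(5) by (simp only: card_degree_part_1)
  then have cd: "card (degree_part M 1) = card ?W" .
  have verts: "set_mset m \<subseteq> ?W" if m: "m \<in> M" for m
  proof (rule revlex_vertices(2)[OF pos M finite_grid _ _ cd m])
    show "?W \<subseteq> all_vars (length a)" using grid_subset[of n cv] len by simp
  qed (rule Wdown)
  have Mb: "M \<subseteq> bounded_kind True a" and mc: "multicomplex_on (all_vars (length a)) M"
    using M by (auto simp: revlex_kind_def)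
  define P2 where "P2 = degree_part (grid_monomials True a cv) 2"
  have finP2: "finite P2"
    using grid_monomials_divisor_closed[of True a cv] by (simp add: P2_def degree_part_def divisor_closed_def)
  \<comment> \<open>This pair is the last of all admissible ones. Its presence would force all of
    \<open>P2\<close> into \<open>M\<close>, but \<open>split_complex\<close> has fewer
    edges.\<close>
  have "{#w, z#} \<notin> M"
  proof
    assume wzM: "{#w, z#} \<in> M"
    have "P2 \<subseteq> degree_part M 2"
    proof
      fix m assume m: "m \<in> P2"
      then have mb: "m \<in> bounded_kind True a" "set_mset m \<subseteq> ?W" "size m = 2"
        by (auto simp: P2_def degree_part_def grid_monomials_def len)
      obtain x m1 where m1: "m = add_mset x m1" using mb(3) by (cases m) auto
      then have "size m1 = 1" using mb(3) by simp
      then obtain y where xy: "m = {#x, y#}" using m1 by (metis size_1_singleton_mset)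
      then have xyW: "x \<in> ?W" "y \<in> ?W" "x \<noteq> y"
        using mb by (auto simp: bounded_kind_iff split: if_splits)
      have pair: "{#z, u#} \<in> M" if u: "u \<in> ?W" "u \<noteq> z" for u
      proof (cases "u = w")
        case True
        then show ?thesis using wzM by (simp add: add_mset_commute)
      next
        case False
        have "lex_less {#z, u#} {#w, z#}"
          unfolding lex_less_def
        proof (intro conjI exI[of _ w] allI impI)
          show "count {#z, u#} w < count {#w, z#} w" using False wz by simp
          fix r assume "var_less w r"
          moreover have "r \<noteq> w" using \<open>var_less w r\<close> by (auto simp: var_less_def)
          ultimately show "count {#z, u#} r = count {#w, z#} r"
            using wmax[of u] u wz by auto
        qed simp
        then show ?thesis using revlex_closedD[OF M wzM] pair_bounded[OF wz(2) u(1)] u(2) by blast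
      qed
      have "m \<in> M"
      proof (cases "x = z \<or> y = z")
        case True
        then show ?thesis using pair[of x] pair[of y] xyW xy by (auto simp: add_mset_commute)
      next
        case False
        have "lex_less m {#w, z#}"
          unfolding lex_less_def
        proof (intro conjI exI[of _ z] allI impI)
          show "count m z < count {#w, z#} z" using False wz xy by simp
          fix r assume r: "var_less z r"
          then have "r \<notin> ?W" using zmax by blast
          then show "count m r = count {#w, z#} r" using wz xy xyW by auto
        qed (use mb in simp)
        then show ?thesis using revlex_closedD[OF M wzM mb(1)] by blast
      qed
      then show "m \<in> degree_part M 2" using mb(3) by (simp add: degree_part_def)
    qed
    then have "card P2 \<le> card (degree_part M 2)"
      using M by (intro card_mono) (auto simp: degree_part_def revlex_kind_def)
    also have "\<dots> = card (degree_part split_complex 2)" using f by simp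
    also have "\<dots> < card P2"
    proof (rule psubset_card_mono[OF finP2])
      let ?e = "{#(n - 2, 0), (n - 2, 1)#} :: var multiset"
      have g: "(n - 2, 0) \<in> ?W" "(n - 2, 1) \<in> ?W" using n b by (auto simp: grid_iff cv_def)
      then have "?e \<in> bounded_kind True a" by (intro pair_bounded) auto
      then have "?e \<in> P2" using g by (simp add: P2_def degree_part_def grid_monomials_def len)
      moreover have "?e \<notin> degree_part split_complex 2" by (simp add: degree_part_def split_complex_def)
      moreover have "degree_part split_complex 2 \<subseteq> P2"
        by (auto simp: P2_def degree_part_def grid_monomials_def split_complex_def len)
      ultimately show "degree_part split_complex 2 \<subset> P2" by blast
    qed
    finally show False by simp
  qed
  \<comment> \<open>A facet of \<open>M\<close> avoids \<open>w\<close> (counted by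
    \<open>vw\<close>) or \<open>z\<close> (counted by \<open>vz\<close>). Either kind has
    \<open>b + 1\<close> members, and the facet on the first \<open>b\<close> vertices of each
    colour is of both kinds, so the union stays below \<open>2 * (b + 1)\<close>.\<close>
  define full where "full v = {m \<in> bounded_kind True a. set_mset m \<subseteq> grid (length a) v \<and> size m = top_degree a}" for v
  define vw where "vw t = (if t = n - 2 then b + 1 else b)" for t
  define vz where "vz t = (if t = n - 1 then b + 1 else b)" for t
  have fin: "finite (full v)" for v
    by (rule finite_subset[OF _ finite_bounded_grid[of True a "length a" v]]) (auto simp: full_def)
  have sub: "degree_part M (top_degree a) \<subseteq> full vw \<union> full vz"
  proof
    fix m assume "m \<in> degree_part M (top_degree a)"
    then have m: "m \<in> M" "size m = top_degree a" by (auto simp: degree_part_def)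
    have "\<not> (w \<in># m \<and> z \<in># m)"
    proof
      assume "w \<in># m \<and> z \<in># m"
      then have "{#w, z#} \<subseteq># m" using wz(3) by (simp add: insert_subset_eq_iff in_diff_count)
      then show False using mc m(1) \<open>{#w, z#} \<notin> M\<close> unfolding multicomplex_on_def by blast
    qed
    moreover have "x \<in> grid n vw" if "x \<in> ?W" "x \<noteq> w" for x
      using that n by (auto simp: grid_iff cv_def vw_def w_def prod_eq_iff split: if_splits)
    moreover have "x \<in> grid n vz" if "x \<in> ?W" "x \<noteq> z" for x
      using that n by (auto simp: grid_iff cv_def vz_def z_def prod_eq_iff split: if_splits)
    ultimately have "set_mset m \<subseteq> grid n vw \<or> set_mset m \<subseteq> grid n vz" using verts[OF m(1)] by blast
    then show "m \<in> full vw \<union> full vz" using m Mb by (auto simp: full_def len)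
  qed
  have prods: "card (full vw) = b + 1" "card (full vz) = b + 1" "card (full (\<lambda>_. b)) = 1"
  proof -
    have one: "(\<Prod>t<n - 2. monomial_count True (v t) (a ! t)) = 1" if "\<And>t. t < n - 2 \<Longrightarrow> v t = b" for v
      using that nth count_bounds(2) by (intro prod.neutral) auto
    have C: "card (full v) = monomial_count True (v (n - 1)) (a ! (n - 1)) *
      (monomial_count True (v (n - 2)) (a ! (n - 2)) * (\<Prod>t<n - 2. monomial_count True (v t) (a ! t)))" for v
      unfolding full_def card_full_grid unfolding len by (rule prod_colors)
    have v: "vw (n - 1) = b" "vw (n - 2) = b + 1" "vz (n - 1) = b + 1" "vz (n - 2) = b"
      "a ! (n - 1) = b" "a ! (n - 2) = b"
      using n nth[of "n - 1"] nth[of "n - 2"] by (auto simp: vw_def vz_def)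
    have "vw t = b" "vz t = b" if "t < n - 2" for t using that by (auto simp: vw_def vz_def)
    then show "card (full vw) = b + 1" "card (full vz) = b + 1" "card (full (\<lambda>_. b)) = 1"
      by (simp_all only: C v one count_bounds mult_1 mult_1_right)
  qed
  then obtain m0 where "m0 \<in> full (\<lambda>_. b)" by fastforce
  moreover have "grid n (\<lambda>_. b) \<subseteq> grid n vw" "grid n (\<lambda>_. b) \<subseteq> grid n vz"
    by (auto simp: grid_iff vw_def vz_def)
  ultimately have "m0 \<in> full vw \<inter> full vz" by (auto simp: full_def len)
  then have ne0: "card (full vw \<inter> full vz) \<noteq> 0" using fin by auto
  then obtain i where i: "card (full vw \<inter> full vz) = Suc i" by (metis not0_implies_Suc)
  have "card (full vw) + card (full vz) = card (full vw \<union> full vz) + card (full vw \<inter> full vz)"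
    by (rule card_Un_Int) (rule fin)+
  then have "card (full vw \<union> full vz) < 2 * (b + 1)" unfolding prods i by simp
  moreover have "card (degree_part M (top_degree a)) \<le> card (full vw \<union> full vz)"
    using sub fin by (intro card_mono) auto
  moreover have "0 < top_degree a" using n b by (simp add: top)
  ultimately show False using card_split_top f[OF \<open>0 < top_degree a\<close>] by linarith
qed

lemma complex_not_all:
  assumes inf: "infinite (UNIV :: 'v set)"
  shows "\<not> (\<forall>(V :: 'v set) \<Delta> P. colored_complex a V \<Delta> P \<longrightarrow>
         (\<exists>M. revlex_complex a M \<and> complex_f_vector (set_mset ` M) = complex_f_vector \<Delta>))"
proof
  assume ex: "\<forall>(V :: 'v set) \<Delta> P. colored_complex a V \<Delta> P \<longrightarrow>
         (\<exists>M. revlex_complex a M \<and> complex_f_vector (set_mset ` M) = complex_f_vector \<Delta>)"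
  have W: "finite (grid n cv)" "grid n cv \<subseteq> all_vars (length a)" "\<And>t. t < length a \<Longrightarrow> \<exists>x\<in>grid n cv. fst x = t"
    using finite_grid grid_subset grid_meets_colors[of n cv] b len by (auto simp: cv_def)
  show False
  proof (rule complex_obstruction[OF inf ne split_complex_props(1,2) W split_complex_props(3,4) ex])
    fix M' assume "revlex_kind True a M'" "\<And>d. 0 < d \<Longrightarrow> card (degree_part M' d) = card (degree_part split_complex d)"
    then show False by (rule no_revlex_complex)
  qed
qed

end

section \<open>Equal bounds: multicomplexes\<close>

lemma size_as_sum:
  assumes "finite A" "set_mset m \<subseteq> A"
  shows "size m = (\<Sum>x\<in>A. count m x)"
  unfolding size_multiset_overloaded_eq
  using assms by (intro sum.mono_neutral_left) (auto simp: not_in_iff)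

context equal_bounds begin

text \<open>With repetition a single variable per colour already admits full degree. The last two
  colours get the extra variable, again so that the grid is an initial segment of the
  variables.\<close>

definition two :: "nat \<Rightarrow> nat" where
  "two t = (if n - 2 \<le> t then 2 else 1)"

definition exps :: "var multiset \<Rightarrow> nat \<times> nat" where
  "exps m = (count m (n - 1, 1), count m (n - 2, 1))"

definition full_two :: "var multiset set" where
  "full_two = {m \<in> bounded_kind False a. set_mset m \<subseteq> grid n two \<and> size m = top_degree a}"

lemma finite_full_two: "finite full_two"
  by (rule finite_subset[OF _ finite_bounded_grid[of False a n two]]) (auto simp: full_two_def)

lemma color_size: "m \<in> full_two \<Longrightarrow> t < n \<Longrightarrow> size (color_part t m) = b"
  using full_iff[of m False a] nth len by (auto simp: full_two_def)

lemma color_exponents: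
  assumes "m \<in> full_two" "t < n"
  shows "count m (t, 0) + (if n - 2 \<le> t then count m (t, 1) else 0) = b"
proof -
  have "set_mset (color_part t m) \<subseteq> {t} \<times> {..<two t}"
    using assms by (intro grid_color_part[of m n two]) (simp add: full_two_def)
  then have "b = (\<Sum>x\<in>{t} \<times> {..<two t}. count (color_part t m) x)"
    using size_as_sum[of "{t} \<times> {..<two t}"] color_size[OF assms] by simp
  also have "{t} \<times> {..<two t} = Pair t ` {..<two t}" by auto
  also have "(\<Sum>x\<in>Pair t ` {..<two t}. count (color_part t m) x) = (\<Sum>j<two t. count m (t, j))"
    by (subst sum.reindex) (auto simp: inj_on_def count_color_part)
  also have "\<dots> = count m (t, 0) + (if n - 2 \<le> t then count m (t, 1) else 0)"
    by (simp add: two_def numeral_2_eq_2)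
  finally show ?thesis by simp
qed

lemma last_exponents:
  assumes "m \<in> full_two"
  shows "count m (n - 1, 0) + fst (exps m) = b" "count m (n - 2, 0) + snd (exps m) = b"
proof -
  have "n - 1 < n" "n - 2 < n" and le: "n - 2 \<le> n - 1" using n by auto
  note color_exponents[OF assms this(1)] color_exponents[OF assms this(2)]
  then show "count m (n - 1, 0) + fst (exps m) = b" "count m (n - 2, 0) + snd (exps m) = b"
    using le by (simp_all only: exps_def fst_conv snd_conv if_True order_refl)
qed

text \<open>In full degree each colour has total exponent \<open>b\<close>, so the exponents of the
  additional variables determine those of the first variables.\<close>

lemma exps_inj: "inj_on exps full_two"
proof (rule inj_onI, rule multiset_eqI)
  fix m m' x assume m: "m \<in> full_two" "m' \<in> full_two" "exps m = exps m'"
  show "count m x = count m' x"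
  proof (cases "x \<in> grid n two")
    case True
    obtain t j where x: "x = (t, j)" by (cases x)
    have t: "t < n" "j < two t" using True x by (auto simp: grid_iff)
    have one: "n - 2 \<le> t \<Longrightarrow> count m (t, 1) = count m' (t, 1)"
    proof -
      assume "n - 2 \<le> t"
      then have "t = n - 1 \<or> t = n - 2" using t(1) by auto
      then show ?thesis using m(3) by (auto simp: exps_def)
    qed
    have zero: "count m (t, 0) = count m' (t, 0)"
      using color_exponents[OF m(1) t(1)] color_exponents[OF m(2) t(1)] one by (auto split: if_splits)
    have "j = 0 \<or> (j = 1 \<and> n - 2 \<le> t)" using t(2) by (auto simp: two_def split: if_splits)
    then show ?thesis using x one zero by auto
  next
    case False
    then have "x \<notin># m" "x \<notin># m'" using m by (auto simp: full_two_def)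
    then show ?thesis by (simp add: not_in_iff)
  qed
qed

text \<open>Surjectivity follows from injectivity by counting: there are
  \<open>(b + 1) * (b + 1)\<close> monomials of full degree on this grid.\<close>

lemma exps_image: "exps ` full_two = {..b} \<times> {..b}"
proof (rule card_subset_eq)
  show "exps ` full_two \<subseteq> {..b} \<times> {..b}"
  proof
    fix e assume "e \<in> exps ` full_two"
    then obtain m where m: "m \<in> full_two" "e = exps m" by blast
    then show "e \<in> {..b} \<times> {..b}"
      using last_exponents[OF m(1)] by (simp add: mem_Times_iff)
  qed
  have "card full_two = (\<Prod>t<n. monomial_count False (two t) (a ! t))"
    using card_full_grid[of False a two] by (simp only: full_two_def len)
  also have "\<dots> = monomial_count False (two (n - 1)) (a ! (n - 1)) *
      (monomial_count False (two (n - 2)) (a ! (n - 2)) * (\<Prod>t<n - 2. monomial_count False (two t) (a ! t)))"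
    by (rule prod_colors)
  also have "\<dots> = (b + 1) * (b + 1)"
  proof -
    have "(\<Prod>t<n - 2. monomial_count False (two t) (a ! t)) = 1"
      using nth by (intro prod.neutral ballI) (simp add: two_def count_bounds(4)[unfolded One_nat_def])
    moreover have "two (n - 1) = 2" "two (n - 2) = 2" "a ! (n - 1) = b" "a ! (n - 2) = b"
      using n nth[of "n - 1"] nth[of "n - 2"] by (auto simp: two_def)
    ultimately show ?thesis by (simp only: count_bounds mult_1_right)
  qed
  finally show "card (exps ` full_two) = card ({..b} \<times> {..b})"
    by (simp add: card_image[OF exps_inj] card_cartesian_product)
qed simp

lemma card_exps: "card {m \<in> full_two. Q (exps m)} = card {e \<in> {..b} \<times> {..b}. Q e}"
proof -
  have "{e \<in> {..b} \<times> {..b}. Q e} = exps ` {m \<in> full_two. Q (exps m)}"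
    unfolding exps_image[symmetric] by blast
  moreover have "inj_on exps {m \<in> full_two. Q (exps m)}" using exps_inj by (rule inj_on_subset) auto
  ultimately show ?thesis by (simp only: card_image)
qed

text \<open>With exponents \<open>(i, j)\<close> of the two additional variables, the monomials of full degree form a grid.
  Dividing by the first variable of each colour fails only at \<open>i = b\<close> or \<open>j = b\<close>; this happens twice
  in the cross, but only once in the initial segment of the same size.\<close>

definition cross :: "var multiset set" where
  "cross = {m \<in> full_two. fst (exps m) = 0 \<or> snd (exps m) = 0}"

definition first_rows :: "var multiset set" where
  "first_rows = {m \<in> full_two. snd (exps m) = 0 \<or> (snd (exps m) = 1 \<and> fst (exps m) < b)}"

lemma card_cross: "card cross = 2 * b + 1"
proof -
  have "{e \<in> {..b} \<times> {..b}. fst e = 0 \<or> snd e = 0} = {..b} \<times> {0} \<union> {0} \<times> {1..b}" by auto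
  moreover have "card ({..b} \<times> {0} \<union> {0} \<times> {1..b}) = card ({..b} \<times> {0::nat}) + card ({0::nat} \<times> {1..b})"
    by (intro card_Un_disjoint) auto
  ultimately show ?thesis
    using card_exps[of "\<lambda>e. fst e = 0 \<or> snd e = 0"] by (simp add: cross_def card_cartesian_product)
qed

lemma card_first_rows: "card first_rows = 2 * b + 1"
proof -
  have "{e \<in> {..b} \<times> {..b}. snd e = 0 \<or> (snd e = 1 \<and> fst e < b)} = {..b} \<times> {0} \<union> {..<b} \<times> {1}"
    using b by auto
  moreover have "card ({..b} \<times> {0::nat} \<union> {..<b} \<times> {1}) = card ({..b} \<times> {0::nat}) + card ({..<b} \<times> {1::nat})"
    by (intro card_Un_disjoint) auto
  ultimately show ?thesis
    using card_exps[of "\<lambda>e. snd e = 0 \<or> (snd e = 1 \<and> fst e < b)"]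
    by (simp add: first_rows_def card_cartesian_product)
qed

definition cross_multicomplex :: "var multiset set" where
  "cross_multicomplex = {m \<in> bounded_kind False a. set_mset m \<subseteq> grid n two \<and> \<not> ((n - 1, 1) \<in># m \<and> (n - 2, 1) \<in># m)}"

lemma cross_multicomplex_props: "divisor_closed cross_multicomplex" "cross_multicomplex \<subseteq> bounded_kind False a"
    "m \<in> cross_multicomplex \<Longrightarrow> set_mset m \<subseteq> grid n two"
    "degree_part cross_multicomplex (top_degree a) = cross"
proof -
  show "divisor_closed cross_multicomplex"
  proof (rule divisor_closed_restrict)
    show "finite cross_multicomplex"
      by (rule finite_subset[OF _ finite_bounded_grid[of False a n two]]) (auto simp: cross_multicomplex_def)
    show "cross_multicomplex = {m \<in> bounded_kind False a. set_mset m \<subseteq> grid n two \<and> \<not> ((n - 1, 1) \<in># m \<and> (n - 2, 1) \<in># m)}"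
      by (simp add: cross_multicomplex_def)
  qed (auto dest: mset_subset_eqD)
qed (auto simp: cross_multicomplex_def degree_part_def cross_def full_two_def exps_def not_in_iff)

definition peel :: "var multiset \<times> nat \<Rightarrow> var multiset" where
  "peel = (\<lambda>(m, t). m - {#(t, 0)#})"

definition peelable :: "var multiset set \<Rightarrow> (var multiset \<times> nat) set" where
  "peelable A = {(m, t). m \<in> A \<and> t < n \<and> (t, 0) \<in># m}"

text \<open>The colour whose degree has dropped reveals which variable was removed. Different pairs
  therefore yield different monomials, and shadow elements can be counted by pairs.\<close>

lemma peel_inj:
  assumes "A \<subseteq> full_two"
  shows "inj_on peel (peelable A)"
proof (rule inj_onI)
  fix p p' assume p: "p \<in> peelable A" "p' \<in> peelable A" "peel p = peel p'"
  obtain m t m' t' where mt: "p = (m, t)" "p' = (m', t')" by (cases p, cases p')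
  have m: "m \<in> full_two" "t < n" "(t, 0) \<in># m" "m' \<in> full_two" "t' < n" "(t', 0) \<in># m'"
    using p mt assms by (auto simp: peelable_def)
  have eq: "m - {#(t, 0)#} = m' - {#(t', 0)#}" using p(3) mt by (simp add: peel_def)
  have "m = add_mset (t, 0) (m - {#(t, 0)#})" using m(3) by simp
  moreover have "m' = add_mset (t', 0) (m - {#(t, 0)#})" unfolding eq using m(6) by simp
  ultimately have add: "m = add_mset (t, 0) (m - {#(t, 0)#})" "m' = add_mset (t', 0) (m - {#(t, 0)#})" .
  have "size (color_part t m) = Suc (size (color_part t (m - {#(t, 0)#})))"
    by (subst add(1)) (simp add: color_part_add_mset)
  moreover have "size (color_part t m') = (if t' = t then Suc (size (color_part t (m - {#(t, 0)#})))
      else size (color_part t (m - {#(t, 0)#})))"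
    by (subst add(2)) (simp add: color_part_add_mset)
  ultimately have "t = t'" using color_size[OF m(1,2)] color_size[OF m(4,2)] by (auto split: if_splits)
  then have "m = m'" using add by simp
  then show "p = p'" using mt \<open>t = t'\<close> by simp
qed

lemma peelable_subset: "peelable A \<subseteq> A \<times> {..<n}"
  by (auto simp: peelable_def)

lemma exps_exists: "i \<le> b \<Longrightarrow> j \<le> b \<Longrightarrow> \<exists>m\<in>full_two. exps m = (i, j)"
  using exps_image by (metis SigmaI atMost_iff imageE)

text \<open>A monomial of degree one less is deficient in some colour \<open>t\<close>. Multiplying
  it by the first variable of \<open>t\<close> creates no forbidden product, so it is peeled from a
  monomial of \<open>cross\<close>. Of the \<open>n * (2 * b + 1)\<close> pairs two cannot be
  peeled, at exponents \<open>(b, 0)\<close> and \<open>(0, b)\<close>.\<close>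

lemma card_below_cross: "card (degree_part cross_multicomplex (top_degree a - 1)) + 2 \<le> n * (2 * b + 1)"
proof -
  have T: "0 < top_degree a" using n b by (simp add: top)
  have finC: "finite cross" using finite_full_two by (simp add: cross_def)
  have finP: "finite (peelable cross)"
    using finite_subset[OF peelable_subset[of cross]] finC by simp
  have "degree_part cross_multicomplex (top_degree a - 1) \<subseteq> peel ` peelable cross"
  proof
    fix m assume "m \<in> degree_part cross_multicomplex (top_degree a - 1)"
    then have m: "m \<in> bounded_kind False a" "set_mset m \<subseteq> grid n two" "\<not> ((n - 1, 1) \<in># m \<and> (n - 2, 1) \<in># m)"
      "Suc (size m) = top_degree a" using T by (auto simp: degree_part_def cross_multicomplex_def)
    have "\<exists>t<n. size (color_part t m) \<noteq> a ! t" using full_iff[OF m(1)] m(4) len by auto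
    then obtain t where t: "t < n" "size (color_part t m) < a ! t"
      using m(1) len by (auto simp: bounded_kind_iff le_neq_implies_less)
    let ?h = "add_mset (t, 0) m"
    have "?h \<in> bounded_kind False a"
      using m(1) t len by (auto simp: bounded_kind_iff color_part_add_mset all_vars_iff)
    moreover have "set_mset ?h \<subseteq> grid n two" using m(2) t(1) by (auto simp: grid_iff two_def)
    ultimately have "?h \<in> degree_part cross_multicomplex (top_degree a)"
      using m(3,4) by (auto simp: degree_part_def cross_multicomplex_def)
    then have "?h \<in> cross" by (simp only: cross_multicomplex_props(4))
    then have "(?h, t) \<in> peelable cross" using t(1) by (simp add: peelable_def)
    then show "m \<in> peel ` peelable cross" by (rule image_eqI[rotated]) (simp add: peel_def)
  qed
  then have "card (degree_part cross_multicomplex (top_degree a - 1)) \<le> card (peel ` peelable cross)"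
    using finP by (intro card_mono) auto
  also have "\<dots> \<le> card (peelable cross)" using finP by (rule card_image_le)
  finally have le: "card (degree_part cross_multicomplex (top_degree a - 1)) \<le> card (peelable cross)" .
  obtain h1 where h1: "h1 \<in> full_two" "exps h1 = (b, 0)" using exps_exists[of b 0] by auto
  obtain h2 where h2: "h2 \<in> full_two" "exps h2 = (0, b)" using exps_exists[of 0 b] by auto
  have "(n - 1, 0) \<notin># h1" "(n - 2, 0) \<notin># h2"
    using last_exponents(1)[OF h1(1)] last_exponents(2)[OF h2(1)] h1(2) h2(2)
    by (simp_all add: not_in_iff)
  then have sub: "peelable cross \<subseteq> cross \<times> {..<n} - {(h1, n - 1), (h2, n - 2)}"
    by (auto simp: peelable_def)
  have two: "{(h1, n - 1), (h2, n - 2)} \<subseteq> cross \<times> {..<n}" using h1 h2 n by (auto simp: cross_def)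
  have "(h1, n - 1) \<noteq> (h2, n - 2)" using n by auto
  then have "card {(h1, n - 1), (h2, n - 2)} = 2" by simp
  then have "card (cross \<times> {..<n} - {(h1, n - 1), (h2, n - 2)}) = (2 * b + 1) * n - 2"
    using two by (subst card_Diff_subset) (auto simp: card_cartesian_product card_cross)
  moreover have "card (peelable cross) \<le> card (cross \<times> {..<n} - {(h1, n - 1), (h2, n - 2)})"
    using sub finC by (intro card_mono) auto
  moreover have "2 \<le> (2 * b + 1) * n"
    using n b by (metis add_leE le_trans mult_le_mono nat_mult_1 one_le_numeral le_add2)
  ultimately show ?thesis using le by (simp add: mult.commute)
qed

text \<open>The additional variables of colours \<open>n - 2\<close> and \<open>n - 1\<close> are,
  in this order, the greatest of the grid. The lexicographic order on full degree thus compares the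
  second entry of \<open>exps\<close> first and then the first entry.\<close>

lemma first_rows_closed:
  assumes g: "g \<in> first_rows" and m: "m \<in> bounded_kind False a" "lex_less m g"
  shows "m \<in> first_rows"
proof -
  let ?W = "grid n two"
  have gF: "g \<in> full_two" and g2: "snd (exps g) = 0 \<or> (snd (exps g) = 1 \<and> fst (exps g) < b)"
    using g by (auto simp: first_rows_def)
  have gW: "set_mset g \<subseteq> ?W" "size g = top_degree a" using gF by (auto simp: full_two_def)
  obtain w where w: "count m w < count g w" "\<And>y. var_less w y \<Longrightarrow> count m y = count g y" and sz: "size m = size g"
    using m(2) by (auto simp: lex_less_def)
  have "w \<in># g" using w(1) by (intro count_inI) simp
  then have wW: "w \<in> ?W" using gW by blast
  have "set_mset m \<subseteq> ?W"
  proof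
    fix u assume u: "u \<in># m"
    show "u \<in> ?W"
    proof (rule ccontr)
      assume uW: "u \<notin> ?W"
      have "fst u < n" using u m(1) len by (auto simp: bounded_kind_iff all_vars_iff)
      then have "two (fst u) \<le> snd u" using uW by (auto simp: grid_iff)
      then have "var_less w u"
        using wW \<open>fst u < n\<close> by (auto simp: grid_iff two_def var_less_def split: if_splits)
      then have "count m u = count g u" by (rule w(2))
      moreover have "u \<notin># g" using uW gW by blast
      ultimately show False using u by (metis count_eq_zero_iff)
    qed
  qed
  then have mF: "m \<in> full_two" using m(1) sz gW by (simp add: full_two_def)
  have y: "var_less w (n - 2, 1)" if "w \<noteq> (n - 2, 1)"
    using that wW by (auto simp: grid_iff two_def var_less_def prod_eq_iff split: if_splits)
  have x: "var_less w (n - 1, 1)" if "w \<noteq> (n - 2, 1)" "w \<noteq> (n - 1, 1)"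
    using that wW by (auto simp: grid_iff two_def var_less_def prod_eq_iff split: if_splits)
  show ?thesis
  proof (cases "w = (n - 2, 1)")
    case True
    then have "snd (exps m) = 0" using w(1) g2 by (auto simp: exps_def)
    then show ?thesis using mF by (simp add: first_rows_def)
  next
    case False
    then have eq2: "snd (exps m) = snd (exps g)" using w(2)[OF y[OF False]] by (simp add: exps_def)
    show ?thesis
    proof (cases "w = (n - 1, 1)")
      case True
      then have "fst (exps m) < fst (exps g)" using w(1) by (simp add: exps_def)
      then show ?thesis using mF g2 eq2 by (auto simp: first_rows_def)
    next
      case False
      then have "fst (exps m) = fst (exps g)" using w(2)[OF x[OF \<open>w \<noteq> (n - 2, 1)\<close>]] by (simp add: exps_def)
      then have "exps m = exps g" using eq2 by (simp add: prod_eq_iff)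
      then have "m = g" using exps_inj mF gF by (auto dest: inj_onD)
      then show ?thesis using w(1) by simp
    qed
  qed
qed

text \<open>In top degree \<open>M\<close> has as many monomials as the initial segment
  \<open>first_rows\<close> and so contains it. Peeling then gives at least
  \<open>n * (2 * b + 1) - 1\<close> monomials one degree lower, one more than
  \<open>cross_multicomplex\<close> can have.\<close>

lemma no_revlex_multicomplex:
  assumes M: "revlex_kind False a M"
    and f: "\<And>d. card (degree_part M d) = card (degree_part cross_multicomplex d)"
  shows False
proof -
  let ?T = "top_degree a"
  have Mb: "M \<subseteq> bounded_kind False a" and mc: "multicomplex_on (all_vars (length a)) M" and finM: "finite M"
    using M by (auto simp: revlex_kind_def)
  have finR: "finite first_rows" using finite_full_two by (simp add: first_rows_def)
  have rows: "g \<in> M" if g: "g \<in> first_rows" for g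
  proof (rule ccontr)
    assume "g \<notin> M"
    have gb: "g \<in> bounded_kind False a" "size g = ?T" using g by (auto simp: first_rows_def full_two_def)
    have "degree_part M ?T \<subseteq> first_rows - {g}"
    proof
      fix m assume "m \<in> degree_part M ?T"
      then have m: "m \<in> M" "size m = ?T" by (auto simp: degree_part_def)
      then have "m \<noteq> g" using \<open>g \<notin> M\<close> by blast
      have "m \<in> bounded_kind False a" using Mb m(1) by blast
      then have "lex_less m g \<or> lex_less g m"
        using m(2) gb n len \<open>m \<noteq> g\<close> by (intro lex_total[of _ n]) (simp_all add: bounded_kind_iff)
      then have "lex_less m g" using revlex_closedD[OF M m(1) gb(1)] \<open>g \<notin> M\<close> by blast
      then show "m \<in> first_rows - {g}" using first_rows_closed[OF g] Mb m(1) \<open>m \<noteq> g\<close> by blast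
    qed
    then have "card (degree_part M ?T) \<le> card (first_rows - {g})" using finR by (intro card_mono) auto
    also have "\<dots> < card first_rows" using finR g by (rule card_Diff1_less)
    also have "\<dots> = card (degree_part M ?T)"
      using f[of ?T] by (simp only: cross_multicomplex_props(4) card_cross card_first_rows)
    finally show False by simp
  qed
  have RF: "first_rows \<subseteq> full_two" by (auto simp: first_rows_def)
  have "peel ` peelable first_rows \<subseteq> degree_part M (?T - 1)"
  proof
    fix m assume "m \<in> peel ` peelable first_rows"
    then obtain g t where g: "g \<in> first_rows" "(t, 0) \<in># g" "m = g - {#(t, 0)#}"
      by (auto simp: peelable_def peel_def)
    have "m \<in> M" using mc rows[OF g(1)] g(3) unfolding multicomplex_on_def by (meson diff_subset_eq_self)
    moreover have "size m = ?T - 1" using g RF by (auto simp: full_two_def size_Diff_singleton)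
    ultimately show "m \<in> degree_part M (?T - 1)" by (simp add: degree_part_def)
  qed
  then have "card (peel ` peelable first_rows) \<le> card (degree_part M (?T - 1))"
    using finM by (intro card_mono) (auto simp: degree_part_def)
  then have le: "card (peelable first_rows) \<le> card (degree_part M (?T - 1))"
    by (simp add: card_image[OF peel_inj[OF RF]])
  obtain g1 where g1: "g1 \<in> full_two" "exps g1 = (b, 0)" using exps_exists[of b 0] by auto
  have "first_rows \<times> {..<n} - {(g1, n - 1)} \<subseteq> peelable first_rows"
  proof
    fix p assume p: "p \<in> first_rows \<times> {..<n} - {(g1, n - 1)}"
    obtain g t where gt: "p = (g, t)" by (cases p)
    have g: "g \<in> first_rows" "t < n" "\<not> (g = g1 \<and> t = n - 1)" using p gt by auto
    have gF: "g \<in> full_two" using g(1) RF by blast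
    have "count g (t, 0) \<noteq> 0"
    proof
      assume z: "count g (t, 0) = 0"
      then have t1: "n - 2 \<le> t" "count g (t, 1) = b" using color_exponents[OF gF g(2)] b by (auto split: if_splits)
      then consider "t = n - 1" | "t = n - 2" using g(2) by linarith
      then show False
      proof cases
        case 1
        then have "fst (exps g) = b" using t1 by (simp add: exps_def)
        then have "snd (exps g) = 0" using g(1) by (auto simp: first_rows_def)
        then have "exps g = exps g1" using \<open>fst (exps g) = b\<close> g1(2) by (simp add: prod_eq_iff)
        then have "g = g1" using exps_inj gF g1(1) by (auto dest: inj_onD)
        then show False using g(3) 1 by blast
      next
        case 2
        then have "snd (exps g) = b" using t1 by (simp add: exps_def)
        \<comment> \<open>Here \<open>2 \<le> b\<close> is essential: the second exponent in
          \<open>first_rows\<close> never exceeds 1.\<close>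
        then show False using g(1) b by (auto simp: first_rows_def)
      qed
    qed
    then have "(t, 0) \<in># g" by (intro count_inI) simp
    then show "p \<in> peelable first_rows" using g gt by (simp add: peelable_def)
  qed
  then have "card (first_rows \<times> {..<n} - {(g1, n - 1)}) \<le> card (peelable first_rows)"
    using finite_subset[OF peelable_subset] finR by (intro card_mono) auto
  moreover have "n * (2 * b + 1) - 1 \<le> card (first_rows \<times> {..<n} - {(g1, n - 1)})"
    using diff_card_le_card_Diff[of "{(g1, n - 1)}" "first_rows \<times> {..<n}"]
    by (simp add: card_cartesian_product card_first_rows mult.commute)
  ultimately show False using le card_below_cross f[of "?T - 1"] by linarith
qed

lemma multicomplex_not_all:
  assumes inf: "infinite (UNIV :: 'v set)"
  shows "\<not> (\<forall>(X :: 'v set) M P. colored_multicomplex a X M P \<and> finite M \<longrightarrow>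
         (\<exists>M'. revlex_multicomplex a M' \<and> multicomplex_f_vector M' = multicomplex_f_vector M))"
proof
  assume ex: "\<forall>(X :: 'v set) M P. colored_multicomplex a X M P \<and> finite M \<longrightarrow>
         (\<exists>M'. revlex_multicomplex a M' \<and> multicomplex_f_vector M' = multicomplex_f_vector M)"
  have W: "finite (grid n two)" "grid n two \<subseteq> all_vars (length a)" "\<And>t. t < length a \<Longrightarrow> \<exists>x\<in>grid n two. fst x = t"
    using finite_grid grid_subset grid_meets_colors[of n two] len by (auto simp: two_def)
  show False
  proof (rule multicomplex_obstruction[OF inf ne cross_multicomplex_props(1,2) W cross_multicomplex_props(3) ex])
    fix M' assume "revlex_kind False a M'" "\<And>d. card (degree_part M' d) = card (degree_part cross_multicomplex d)"
    then show False by (rule no_revlex_multicomplex)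
  qed
qed

end

theorem theorem1p3:
  fixes a :: "nat list"
  assumes "a \<noteq> []"
    and "\<forall>i<length a. 0 < a ! i"
    and "infinite (UNIV :: 'v set)"
  shows
    "((\<forall>(V :: 'v set) \<Delta> P. colored_complex a V \<Delta> P \<longrightarrow>
         (\<exists>M. revlex_complex a M \<and> complex_f_vector (set_mset ` M) = complex_f_vector \<Delta>))
      \<longleftrightarrow> (length a = 1 \<or> a = replicate (length a) 1)) \<and>
     ((\<forall>(X :: 'v set) M P. colored_multicomplex a X M P \<and> finite M \<longrightarrow>
         (\<exists>M'. revlex_multicomplex a M' \<and> multicomplex_f_vector M' = multicomplex_f_vector M))
      \<longleftrightarrow> (length a = 1 \<or> a = replicate (length a) 1))"
proof (cases "length a = 1 \<or> a = replicate (length a) 1")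
  case True
  then show ?thesis
    using revlex_complex_exists[OF True assms(1)] revlex_multicomplex_exists[OF True assms(1)] by blast
next
  case False
  have "2 \<le> length a" using False assms(1) by (cases a) (auto simp: Suc_le_eq)
  consider i j where "i < length a" "j < length a" "a ! i \<noteq> a ! j"
    | "\<forall>i<length a. a ! i = a ! 0"
    using assms(1) by (metis length_greater_0_conv)
  then show ?thesis
  proof cases
    case (1 i j)
    then show ?thesis using False unequal_not_all[OF assms(3,2) 1] by blast
  next
    case 2
    have eq: "a = replicate (length a) (a ! 0)" using 2 by (intro nth_equalityI) auto
    then have "a ! 0 \<noteq> 1" using False by metis
    then have "2 \<le> a ! 0" using assms(1,2) by (cases "a ! 0") (auto simp: not_less_eq_eq[symmetric])
    then interpret equal_bounds a "length a" "a ! 0"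
      using 2 \<open>2 \<le> length a\<close> by unfold_locales auto
    show ?thesis using False complex_not_all[OF assms(3)] multicomplex_not_all[OF assms(3)] by blast
  qed
qed

end
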